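(* Let $\alpha\ge 1/2$, and let $\mathcal{S}$ and $\mathcal{S}_0$ be the integral operators on $L^2(P_0)$ with kernels $K$ and $K_0$ defined in the context. The eigenvalues $\{\delta_k:k\ge1\}$ of $\mathcal{S}$ and the eigenvalues $\{\rho_k:k\ge0\}$ of $\mathcal{S}_0$ are positive and simple (of multiplicity one). In particular, $\mathcal{S}$ and $\mathcal{S}_0$ are injective. Further, the corresponding eigenfunctions $\{\phi_k:k\ge1\}$ of $\mathcal{S}$ satisfy the oscillation property $$(-1)^{r(r-1)/2}\det\big(\phi_i(s_j)\big)\ \ge\ 0$$ for all $r\ge1$ and $0\le s_1<\cdots<s_r<\infty$, where $\det(\phi_i(s_j))$ is the $r\times r$ determinant with $(i,j)$th entry $\phi_i(s_j)$; and the same property holds for the eigenfunctions $\{\mathfrak{L}_k^{(\alpha-1)}:k\ge0\}$ of $\mathcal{S}_0$, that is, $(-1)^{r(r-1)/2}\det\big(\mathfrak{L}_{i-1}^{(\alpha-1)}(s_j)\big)\ge0$ for all such $r$ and $s_1,\ldots,s_r$.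
   Context: $P_0$ is the $Gamma(\alpha,1)$ distribution, with density $x^{\alpha-1}e^{-x}/\Gamma(\alpha)$ on $(0,\infty)$, and $L^2=L^2(P_0)$ is the Hilbert space of (equivalence classes of) Borel measurable functions $f:[0,\infty)\to\mathbb{C}$ that are square-integrable with respect to $P_0$. With $I_\nu(x)=\sum_{j\ge0}\frac{1}{j!\,\Gamma(\nu+1+j)}(x/2)^{2j+\nu}$ the modified Bessel function of the first kind, define for $s,t\ge0$ $$K_0(s,t)=e^{-(s+t)/\alpha}\,\Gamma(\alpha)(st/\alpha^2)^{(1-\alpha)/2}I_{\alpha-1}\big(2\sqrt{st}/\alpha\big),\qquad K(s,t)=K_0(s,t)-e^{-(s+t)/\alpha}\big(\alpha^{-3}st+1\big)$$ (the expression $x^{(1-\alpha)/2}I_{\alpha-1}(2\sqrt x)$ is a power series in $x$, equal to $1/\Gamma(\alpha)$ at $x=0$), and $\mathcal{S}_0f(s)=\int_0^\infty K_0(s,t)f(t)\,dP_0(t)$, $\mathcal{S}f(s)=\int_0^\infty K(s,t)f(t)\,dP_0(t)$ for $f\in L^2$. The eigenvalues $\delta_1,\delta_2,\ldots$ of $\mathcal{S}$ are listed in non-increasing order, and $\phi_k$ denotes the eigenfunction of $\mathcal{S}$ corresponding to $\delta_k$. Set $\beta=((\alpha+4)/\alpha)^{1/2}$, $b_\alpha=(1+\tfrac12\alpha(1-\beta))^{1/2}$, $\rho_k=\alpha^\alpha b_\alpha^{4k+2\alpha}$ for $k\ge 0$, and $$\mathfrak{L}_k^{(\alpha-1)}(s)=\beta^{\alpha/2}e^{(1-\beta)s/2}\Big(\frac{k!}{(\alpha)_k}\Big)^{1/2}L_k^{(\alpha-1)}(\beta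 s),\qquad L_n^{(\alpha-1)}(x)=\sum_{k=0}^n\frac{(\alpha+k)_{n-k}}{(n-k)!}\frac{(-x)^k}{k!},$$ where $(a)_k=a(a+1)\cdots(a+k-1)$. The $\rho_k$, $k\ge0$, are the eigenvalues of $\mathcal{S}_0$, with corresponding eigenfunctions $\mathfrak{L}_k^{(\alpha-1)}$. *)

theory Defs
  imports "HOL-Probability.Probability" "Jordan_Normal_Form.Determinant"
begin

definition gamma_measure :: "real \<Rightarrow> real measure" where
  "gamma_measure \<alpha> = density lborel
     (\<lambda>x. ennreal (if 0 < x then x powr (\<alpha> - 1) * exp (- x) / Gamma \<alpha> else 0))"

text \<open>Elements of $L^2(M)$ are represented by functions; equality in $L^2(M)$ is
  equality \<open>M\<close>-almost everywhere and is written out wherever it is used.\<close>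

definition L2 :: "'a measure \<Rightarrow> ('a \<Rightarrow> complex) set" where
  "L2 M = {f \<in> borel_measurable M. integrable M (\<lambda>x. (cmod (f x))\<^sup>2)}"

definition integral_op ::
    "'a measure \<Rightarrow> ('a \<Rightarrow> 'a \<Rightarrow> real) \<Rightarrow> ('a \<Rightarrow> complex) \<Rightarrow> 'a \<Rightarrow> complex" where
  "integral_op M k f s = (LINT t|M. complex_of_real (k s t) * f t)"

definition injective_on_L2 ::
    "'a measure \<Rightarrow> (('a \<Rightarrow> complex) \<Rightarrow> 'a \<Rightarrow> complex) \<Rightarrow> bool" where
  "injective_on_L2 M T \<longleftrightarrow>
     (\<forall>f\<in>L2 M. \<forall>g\<in>L2 M. (AE x in M. T f x = T g x) \<longrightarrow> (AE x in M. f x = g x))"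

definition is_eigenfunction ::
    "'a measure \<Rightarrow> (('a \<Rightarrow> complex) \<Rightarrow> 'a \<Rightarrow> complex) \<Rightarrow> complex \<Rightarrow> ('a \<Rightarrow> complex) \<Rightarrow> bool" where
  "is_eigenfunction M T z f \<longleftrightarrow>
     f \<in> L2 M \<and> \<not> (AE x in M. f x = 0) \<and> (AE x in M. T f x = z * f x)"

definition is_eigenvalue ::
    "'a measure \<Rightarrow> (('a \<Rightarrow> complex) \<Rightarrow> 'a \<Rightarrow> complex) \<Rightarrow> complex \<Rightarrow> bool" where
  "is_eigenvalue M T z \<longleftrightarrow> (\<exists>f. is_eigenfunction M T z f)"

text \<open>Multiplicity one: the eigenspace is one-dimensional. The operators considered here are
  self-adjoint, so geometric and algebraic multiplicity agree.\<close>

definition is_simple_eigenvalue ::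
    "'a measure \<Rightarrow> (('a \<Rightarrow> complex) \<Rightarrow> 'a \<Rightarrow> complex) \<Rightarrow> complex \<Rightarrow> bool" where
  "is_simple_eigenvalue M T z \<longleftrightarrow>
     (\<exists>f. is_eigenfunction M T z f \<and>
        (\<forall>g. is_eigenfunction M T z g \<longrightarrow> (\<exists>c. AE x in M. g x = c * f x)))"

text \<open>Modified Bessel function of the first kind, for \<open>x > 0\<close>. At \<open>x = 0\<close> the convention
  \<open>0 powr a = 0\<close> makes the value meaningless; \<open>bessel_I_scaled\<close> therefore
  inserts the value at \<open>0\<close> of the entire function
  $x \mapsto x^{(1-\alpha)/2} I_{\alpha-1}(2\sqrt{x})$ explicitly.\<close>

definition bessel_I :: "real \<Rightarrow> real \<Rightarrow> real" where
  "bessel_I \<nu> x = (\<Sum>j. 1 / (fact j * Gamma (\<nu> + 1 + real j)) * (x / 2) powr (2 * real j + \<nu>))"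

definition bessel_I_scaled :: "real \<Rightarrow> real \<Rightarrow> real" where
  "bessel_I_scaled \<alpha> x =
     (if x = 0 then 1 / Gamma \<alpha> else x powr ((1 - \<alpha>) / 2) * bessel_I (\<alpha> - 1) (2 * sqrt x))"

definition K0_kernel :: "real \<Rightarrow> real \<Rightarrow> real \<Rightarrow> real" where
  "K0_kernel \<alpha> s t = exp (- (s + t) / \<alpha>) * Gamma \<alpha> * bessel_I_scaled \<alpha> (s * t / \<alpha>\<^sup>2)"

definition K_kernel :: "real \<Rightarrow> real \<Rightarrow> real \<Rightarrow> real" where
  "K_kernel \<alpha> s t = K0_kernel \<alpha> s t - exp (- (s + t) / \<alpha>) * (s * t / \<alpha> ^ 3 + 1)"

definition S0_op :: "real \<Rightarrow> (real \<Rightarrow> complex) \<Rightarrow> real \<Rightarrow> complex" where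
  "S0_op \<alpha> = integral_op (gamma_measure \<alpha>) (K0_kernel \<alpha>)"

definition S_op :: "real \<Rightarrow> (real \<Rightarrow> complex) \<Rightarrow> real \<Rightarrow> complex" where
  "S_op \<alpha> = integral_op (gamma_measure \<alpha>) (K_kernel \<alpha>)"

definition beta_coeff :: "real \<Rightarrow> real" where
  "beta_coeff \<alpha> = sqrt ((\<alpha> + 4) / \<alpha>)"

definition b_coeff :: "real \<Rightarrow> real" where
  "b_coeff \<alpha> = sqrt (1 + \<alpha> * (1 - beta_coeff \<alpha>) / 2)"

definition rho :: "real \<Rightarrow> nat \<Rightarrow> real" where
  "rho \<alpha> k = \<alpha> powr \<alpha> * b_coeff \<alpha> powr (4 * real k + 2 * \<alpha>)"

definition laguerre :: "real \<Rightarrow> nat \<Rightarrow> real \<Rightarrow> real" where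
  "laguerre \<nu> n x =
     (\<Sum>k=0..n. pochhammer (\<nu> + 1 + real k) (n - k) / fact (n - k) * ((- x) ^ k / fact k))"

definition laguerre_eigenfun :: "real \<Rightarrow> nat \<Rightarrow> real \<Rightarrow> real" where
  "laguerre_eigenfun \<alpha> k s =
     beta_coeff \<alpha> powr (\<alpha> / 2) * exp ((1 - beta_coeff \<alpha>) * s / 2)
       * sqrt (fact k / pochhammer \<alpha> k) * laguerre (\<alpha> - 1) k (beta_coeff \<alpha> * s)"

text \<open>Rows, columns and the functions \<open>u\<close> are numbered from \<open>0\<close>; \<open>u i\<close> is the
  \<open>(i + 1)\<close>-st function of the family.\<close>

definition oscillation_property :: "(nat \<Rightarrow> real \<Rightarrow> real) \<Rightarrow> bool" where
  "oscillation_property u \<longleftrightarrow>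
     (\<forall>r\<ge>1. \<forall>s. strict_mono_on {..<r} s \<and> (\<forall>j<r. 0 \<le> s j) \<longrightarrow>
        0 \<le> (- 1) ^ (r * (r - 1) div 2) * Determinant.det (Matrix.mat r r (\<lambda>(i, j). u i (s j))))"

end

theory Submission
  imports Defs
begin

text \<open>Both kernels have the form \<open>K s t = (\<Sum>i. e i s * e i t)\<close> for \<open>s, t \<ge> 0\<close>, where the features are
\<open>gamma_feature \<alpha> j s = (j! (\<alpha>)\<^sub>j)\<^bsup>-1/2\<^esup> (s/\<alpha>)\<^bsup>j\<^esup> exp (-s/\<alpha>)\<close>. The power series of the Bessel
function gives all \<open>j \<ge> 0\<close> for \<open>K0_kernel\<close>; the term subtracted in \<open>K_kernel\<close> consists exactly of
\<open>j = 0\<close> and \<open>j = 1\<close>. Three facts about the features carry the proof.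

They are complete: a function in \<open>L2\<close> that is orthogonal to all \<open>gamma_feature \<alpha> j\<close> with \<open>j \<ge> p\<close> vanishes
almost everywhere, since the signed measure that it defines has an exponential moment and
vanishing polynomial moments (\<open>gamma_exponential_monomials_complete\<close>). As the quadratic form of the operator is
\<open>(\<Sum>i. \<bar>\<integral> e i f\<bar>\<^sup>2)\<close>, this yields injectivity and positivity of the eigenvalues.

They decay geometrically: \<open>\<bar>gamma_feature \<alpha> j s\<bar> \<le> q\<^bsup>j\<^esup> exp (s/8)\<close> with \<open>q < 1\<close>. Every \<open>f\<close> in \<open>L2\<close> is therefore
described by the rapidly decreasing sequence of its moments \<open>\<integral> e i f\<close>, and the integral operator acts
on these sequences as the Gram matrix \<open>G i j = \<integral> e i e j\<close>. The spectral theorem is needed only for such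
infinite matrices. There it follows by maximising the quadratic form over the unit ball of
\<open>\<ell>\<^sup>2\<close>, which is compact for coordinatewise convergence, and by splitting off the eigenvectors one
after another (\<open>spectral_decomposition\<close>).

They are totally positive: \<open>det (s l ^ i k) > 0\<close> for increasing exponents and increasing positive
arguments, because a real polynomial with \<open>r\<close> terms has fewer than \<open>r\<close> positive zeros. By Andreief's
identity all minors of \<open>G\<close> are positive (\<open>gram_minor_pos\<close>). Let \<open>\<delta>\<close> be the decreasing sequence
of eigenvalues of \<open>G\<close> and \<open>a k\<close> the eigenvectors. On alternating functions of \<open>r\<close> indices, the
\<open>r\<close>-th tensor power of \<open>G\<close> is bounded by \<open>\<delta> 0 \<dots> \<delta> (r-1)\<close>, and the wedge \<open>a 0 \<and> \<dots> \<and> a (r-1)\<close> attains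
the bound. In the quadratic form the kernel can be replaced by the minors of \<open>G\<close>, which are
positive on increasing indices, so replacing a maximiser by its
absolute value cannot lower the form; this forces every maximiser to have constant sign on
increasing indices (\<open>extremal_constant_sign\<close>). If \<open>\<delta> r = \<delta> (r-1)\<close>, the wedges with last
factor \<open>a (r-1)\<close> and \<open>a r\<close> would span a plane of maximisers of constant sign, which is
impossible for orthogonal vectors; hence the eigenvalues are simple. The eigenfunctions are \<open>\<phi> k = (\<Sum>j. a k j * e j)\<close>,
and Andreief's identity expresses \<open>det (\<phi> i (s j))\<close> by products of the wedge and the minors of the
features, so it inherits the constant sign. The signs of the \<open>a k\<close> are then chosen to match the
factor \<open>(-1)\<^bsup>r(r-1)/2\<^esup>\<close>.

For \<open>S0_op\<close> the eigenfunctions are explicit: the operator maps \<open>s\<^bsup>n\<^esup> exp (-\<mu> s)\<close> to a polynomial multiple of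
\<open>exp (-\<mu> s)\<close> by Kummer's transformation, and the Laguerre polynomials diagonalise this triangular action
(\<open>laguerre_eigen_equation\<close>). They span all \<open>s\<^bsup>n\<^esup> exp (-\<mu> s)\<close>, so completeness leaves no other
eigenfunctions, and their determinants are Vandermonde determinants up to the product of the leading coefficients.\<close>

section \<open>Spectral decomposition of rapidly decaying positive semidefinite matrices\<close>

text \<open>Infinite quadratic forms are handled through their finite sections, so that only finite sums and their
limits occur.\<close>

definition bilin :: "(nat \<Rightarrow> nat \<Rightarrow> real) \<Rightarrow> nat \<Rightarrow> (nat \<Rightarrow> real) \<Rightarrow> (nat \<Rightarrow> real) \<Rightarrow> real" where
  "bilin R n x y = (\<Sum>i<n. \<Sum>j<n. x i * R i j * y j)"

lemma bilin_truncate: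
  assumes "n \<le> m" "\<And>i. n \<le> i \<Longrightarrow> x i = 0" "\<And>i. n \<le> i \<Longrightarrow> y i = 0"
  shows "bilin R m x y = bilin R n x y"
proof -
  have "(\<Sum>j<m. x i * R i j * y j) = (\<Sum>j<n. x i * R i j * y j)" for i
    using assms by (intro sum.mono_neutral_right) auto
  then have "bilin R m x y = (\<Sum>i<m. \<Sum>j<n. x i * R i j * y j)" by (simp add: bilin_def)
  also have "\<dots> = bilin R n x y"
    unfolding bilin_def using assms by (intro sum.mono_neutral_right) auto
  finally show ?thesis .
qed

definition ell2_ball :: "(nat \<Rightarrow> real) set" where
  "ell2_ball = {x. \<forall>n. (\<Sum>i<n. (x i)\<^sup>2) \<le> 1}"

lemma ell2_ball_coord:
  assumes "x \<in> ell2_ball"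
  shows "\<bar>x i\<bar> \<le> 1"
proof -
  have "(x i)\<^sup>2 \<le> (\<Sum>j<Suc i. (x j)\<^sup>2)"
    by (rule member_le_sum) auto
  also have "\<dots> \<le> 1" using assms by (auto simp: ell2_ball_def simp del: sum.lessThan_Suc)
  finally show ?thesis by (simp add: abs_square_le_1)
qed

text \<open>The topology on \<open>nat \<Rightarrow> real\<close> is that of coordinatewise convergence. For it the ball is a closed subset of a
product of compact intervals. This is the substitute for weak compactness in \<open>\<ell>\<^sup>2\<close>.\<close>

lemma compact_ell2_ball: "compact ell2_ball"
proof -
  have cube: "compact (Pi\<^sub>E UNIV (\<lambda>_::nat. {-1..1::real}))"
    using compactin_PiE[of "\<lambda>_::nat. euclidean::real topology" UNIV "\<lambda>_. {-1..1}"]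
    by (simp add: euclidean_product_topology)
  have "closed {x::nat \<Rightarrow> real. (\<Sum>i<n. (x i)\<^sup>2) \<le> 1}" for n
    by (intro closed_Collect_le continuous_intros continuous_on_product_coordinates)
  then have cl: "closed ell2_ball"
    unfolding ell2_ball_def by (intro closed_Collect_all) auto
  have "ell2_ball = Pi\<^sub>E UNIV (\<lambda>_::nat. {-1..1::real}) \<inter> ell2_ball"
    using ell2_ball_coord by (fastforce simp: abs_le_iff)
  then show ?thesis using compact_Int_closed[OF cube cl] by metis
qed

lemma geometric_sum_le:
  fixes q :: real
  assumes "0 < q" "q < 1"
  shows "(\<Sum>j<n. q ^ j) \<le> 1 / (1 - q)"
  using assms sum_le_suminf[of "\<lambda>j. q ^ j" "{..<n}"] by (simp add: suminf_geometric summable_geometric)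

text \<open>By positivity a bound on the diagonal controls all entries. Assuming it only for the diagonal has the advantage
that it survives the subtraction of \<open>\<delta> a a\<^sup>T\<close> with the same constants.\<close>

locale decaying_psd =
  fixes R :: "nat \<Rightarrow> nat \<Rightarrow> real" and C q :: real
  assumes q: "0 < q" "q < 1"
    and sym: "R i j = R j i"
    and psd: "0 \<le> bilin R n x x"
    and diag: "R i i \<le> C * q ^ (2 * i)"
begin

lemma diag_nonneg: "0 \<le> R i i"
proof -
  have "bilin R (Suc i) (\<lambda>k. if k = i then 1 else 0) (\<lambda>k. if k = i then 1 else 0) = R i i"
    unfolding bilin_def by (simp add: if_distrib cong: if_cong)
  then show ?thesis using psd by metis
qed

lemma C_nonneg: "0 \<le> C"
  using diag_nonneg[of 0] diag[of 0] by simp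

lemma two_point_psd: "0 \<le> u\<^sup>2 * R i i + 2 * u * v * R i j + v\<^sup>2 * R j j" if "i \<noteq> j"
proof -
  define x where "x k = (if k = i then u else if k = j then v else 0)" for k
  define n where "n = Suc (max i j)"
  have "bilin R n x x = (\<Sum>a\<in>{i,j}. \<Sum>b\<in>{i,j}. x a * R a b * x b)"
  proof -
    have "(\<Sum>b<n. x a * R a b * x b) = (\<Sum>b\<in>{i,j}. x a * R a b * x b)" for a
      by (rule sum.mono_neutral_right) (auto simp: x_def n_def)
    then have "bilin R n x x = (\<Sum>a<n. \<Sum>b\<in>{i,j}. x a * R a b * x b)"
      by (simp add: bilin_def)
    also have "\<dots> = (\<Sum>a\<in>{i,j}. \<Sum>b\<in>{i,j}. x a * R a b * x b)"
      by (rule sum.mono_neutral_right) (auto simp: x_def n_def)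
    finally show ?thesis .
  qed
  also have "\<dots> = u\<^sup>2 * R i i + 2 * u * v * R i j + v\<^sup>2 * R j j"
    using that sym[of i j] by (simp add: x_def power2_eq_square algebra_simps)
  finally show ?thesis using psd[of n x] by simp
qed

lemma entry_square_le: "(R i j)\<^sup>2 \<le> R i i * R j j"
proof (cases "i = j")
  case False
  show ?thesis
  proof (cases "R j j = 0")
    case True
    have "R i j = 0"
    proof (rule ccontr)
      assume "R i j \<noteq> 0"
      then have p: "(R i j)\<^sup>2 > 0" by simp
      \<comment> \<open>A vanishing diagonal entry makes the form linear in \<open>v\<close>; this \<open>v\<close> drives it to \<open>-1\<close>.\<close>
      have "0 \<le> R i i + 2 * (- (R i i + 1) / (2 * (R i j)\<^sup>2) * R i j) * R i j"
        using two_point_psd[OF False, of 1 "- (R i i + 1) / (2 * (R i j)\<^sup>2) * R i j"] True by simp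
      also have "\<dots> = -1" using \<open>R i j \<noteq> 0\<close> by (simp add: field_simps power2_eq_square)
      finally show False by simp
    qed
    then show ?thesis by (simp add: True)
  next
    case nz: False
    have "0 \<le> R j j * (R i i * R j j - (R i j)\<^sup>2)"
      using two_point_psd[OF False, of "R j j" "- R i j"] by (simp add: power2_eq_square algebra_simps)
    then show ?thesis using nz diag_nonneg[of j] by (simp add: zero_le_mult_iff)
  qed
qed (simp add: power2_eq_square)

lemma entry_le: "\<bar>R i j\<bar> \<le> C * q ^ i * q ^ j"
proof (rule power2_le_imp_le)
  have "\<bar>R i j\<bar>\<^sup>2 \<le> R i i * R j j" using entry_square_le by simp
  also have "\<dots> \<le> (C * q ^ (2 * i)) * (C * q ^ (2 * j))"
    using diag diag_nonneg C_nonneg q by (intro mult_mono) auto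
  also have "\<dots> = (C * q ^ i * q ^ j)\<^sup>2"
    unfolding power_even_eq by (simp add: power2_eq_square mult_ac)
  finally show "\<bar>R i j\<bar>\<^sup>2 \<le> (C * q ^ i * q ^ j)\<^sup>2" .
  show "0 \<le> C * q ^ i * q ^ j" using C_nonneg q by simp
qed

lemma row_summable:
  assumes "\<And>j. \<bar>y j\<bar> \<le> B"
  shows "summable (\<lambda>j. R i j * y j)"
proof (rule summable_comparison_test')
  show "summable (\<lambda>j. C * q ^ i * B * q ^ j)"
    using q by (intro summable_mult summable_geometric) auto
  show "norm (R i j * y j) \<le> C * q ^ i * B * q ^ j" for j
    using mult_mono[OF entry_le[of i j] assms[of j]] C_nonneg q
    by (simp add: abs_mult mult_ac)
qed

lemma row_tail_le:
  assumes y: "\<And>j. \<bar>y j\<bar> \<le> B" and w: "(\<lambda>j. R i j * y j) sums w"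
  shows "\<bar>w - (\<Sum>j<n. R i j * y j)\<bar> \<le> C * q ^ i * B * q ^ n / (1 - q)"
proof -
  let ?f = "\<lambda>j. R i j * y j"
  have sf: "summable ?f" using row_summable[OF y] .
  have "w - (\<Sum>j<n. ?f j) = (\<Sum>j. ?f (j + n))"
    using suminf_minus_initial_segment[OF sf, of n] sums_unique[OF w] by simp
  also have "\<bar>\<dots>\<bar> \<le> (\<Sum>j. C * q ^ i * B * q ^ n * q ^ j)"
  proof -
    have g: "summable (\<lambda>j. C * q ^ i * B * q ^ n * q ^ j)"
      using q by (intro summable_mult summable_geometric) auto
    have b: "norm (?f (j + n)) \<le> C * q ^ i * B * q ^ n * q ^ j" for j
      using mult_mono[OF entry_le[of i "j+n"] y[of "j+n"]] C_nonneg q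
      by (simp add: abs_mult mult_ac power_add)
    show ?thesis using norm_suminf_le[OF b g] by simp
  qed
  also have "\<dots> = C * q ^ i * B * q ^ n / (1 - q)"
    using q by (subst suminf_mult) (auto simp: summable_geometric suminf_geometric)
  finally show ?thesis .
qed

text \<open>The tails of the rows are of order \<open>q ^ i * q ^ n\<close>, so in the limit the square sections may be evaluated row by
row.\<close>

lemma bilin_limit:
  assumes x: "\<And>j. \<bar>x j\<bar> \<le> B'" and y: "\<And>j. \<bar>y j\<bar> \<le> B"
    and w: "\<And>i. (\<lambda>j. R i j * y j) sums w i"
  shows "(\<lambda>n. bilin R n x y - (\<Sum>i<n. x i * w i)) \<longlonglongrightarrow> 0"
proof -
  have B: "0 \<le> B" "0 \<le> B'" using x[of 0] y[of 0] by linarith+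
  let ?c = "B' * (C * B / (1 - q)) / (1 - q)"
  have "norm (bilin R n x y - (\<Sum>i<n. x i * w i)) \<le> ?c * q ^ n" for n
  proof -
    have "bilin R n x y - (\<Sum>i<n. x i * w i) = - (\<Sum>i<n. x i * (w i - (\<Sum>j<n. R i j * y j)))"
      by (simp add: bilin_def right_diff_distrib sum_subtractf sum_distrib_left mult.assoc)
    also have "norm \<dots> \<le> (\<Sum>i<n. \<bar>x i * (w i - (\<Sum>j<n. R i j * y j))\<bar>)"
      by (simp add: sum_abs)
    also have "\<dots> \<le> (\<Sum>i<n. B' * (C * q ^ i * B * q ^ n / (1 - q)))"
      unfolding abs_mult using x row_tail_le[OF y w] B
      by (intro sum_mono mult_mono) auto
    also have "\<dots> = B' * (C * B / (1 - q)) * q ^ n * (\<Sum>i<n. q ^ i)"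
      unfolding sum_distrib_left by (intro sum.cong) (auto simp: field_simps)
    also have "\<dots> \<le> B' * (C * B / (1 - q)) * q ^ n * (1 / (1 - q))"
      using geometric_sum_le[OF q] B C_nonneg q by (intro mult_left_mono) auto
    finally show ?thesis by (simp add: mult_ac)
  qed
  moreover have "(\<lambda>n. ?c * q ^ n) \<longlonglongrightarrow> 0"
    using q by (intro tendsto_mult_right_zero LIMSEQ_realpow_zero) auto
  ultimately show ?thesis by (rule Lim_null_comparison[OF always_eventually[OF allI]])
qed

lemma bilin_Suc:
  "bilin R (Suc n) x y = bilin R n x y + x n * (\<Sum>j<n. R n j * y j) + y n * (\<Sum>i<n. R n i * x i) + x n * R n n * y n"
proof -
  have "(\<Sum>i<n. x i * R i n * y n) = y n * (\<Sum>i<n. R n i * x i)"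
    by (simp add: sum_distrib_left sym mult_ac)
  moreover have "(\<Sum>j<n. x n * R n j * y j) = x n * (\<Sum>j<n. R n j * y j)"
    by (simp add: sum_distrib_left mult_ac)
  ultimately show ?thesis
    by (simp add: bilin_def sum.distrib)
qed

lemma bilin_commute: "bilin R n x y = bilin R n y x"
  unfolding bilin_def by (subst sum.swap) (simp add: sym mult_ac)

lemma bilin_increment_le:
  assumes "\<And>j. \<bar>x j\<bar> \<le> 1"
  shows "\<bar>bilin R (Suc n) x x - bilin R n x x\<bar> \<le> 2 * C / (1 - q) * q ^ n"
proof -
  let ?s = "\<Sum>j<n. R n j * x j"
  have cq: "0 \<le> C * q ^ n" using C_nonneg q by simp
  have "\<bar>?s\<bar> \<le> (\<Sum>j<n. C * q ^ n * q ^ j * 1)"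
  proof (intro order_trans[OF sum_abs] sum_mono)
    show "\<bar>R n j * x j\<bar> \<le> C * q ^ n * q ^ j * 1" for j
      using mult_mono[OF entry_le[of n j] assms[of j]] C_nonneg q by (simp add: abs_mult)
  qed
  then have 1: "\<bar>?s\<bar> \<le> C * q ^ n * (\<Sum>j<n. q ^ j)" by (simp add: sum_distrib_left)
  have 2: "\<bar>x n * ?s\<bar> \<le> C * q ^ n * (\<Sum>j<n. q ^ j)"
    using mult_mono[OF assms[of n] 1] by (simp add: abs_mult)
  have "\<bar>x n * x n\<bar> \<le> 1" using mult_mono[OF assms[of n] assms[of n]] by (simp add: abs_mult)
  then have 3: "\<bar>x n * R n n * x n\<bar> \<le> C * q ^ n * q ^ n"
    using mult_mono[of "\<bar>x n * x n\<bar>" 1 "\<bar>R n n\<bar>" "C * q ^ n * q ^ n"] entry_le[of n n]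
    by (simp add: abs_mult mult_ac)
  have "\<bar>bilin R (Suc n) x x - bilin R n x x\<bar> \<le> 2 * (C * q ^ n * (\<Sum>j<n. q ^ j)) + C * q ^ n * q ^ n"
    using 2 3 unfolding bilin_Suc by linarith
  also have "\<dots> \<le> 2 * (C * q ^ n * (\<Sum>j<Suc n. q ^ j))"
    using mult_nonneg_nonneg[OF cq, of "q ^ n"] q by (simp add: algebra_simps)
  also have "\<dots> \<le> 2 * (C * q ^ n * (1 / (1 - q)))"
    using geometric_sum_le[OF q, of "Suc n"] cq by (intro mult_left_mono) auto
  finally show ?thesis by (simp add: mult_ac)
qed

text \<open>Decay makes the finite sections converge uniformly on the ball, so the quadratic form is continuous there
and attains its maximum.\<close>

lemma bilin_has_maximiser:
  obtains a \<delta> where "a \<in> ell2_ball" "(\<lambda>n. bilin R n a a) \<longlonglongrightarrow> \<delta>"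
    "\<And>n x. bilin R n x x \<le> \<delta> * (\<Sum>i<n. (x i)\<^sup>2)"
proof -
  define d where "d x n = bilin R (Suc n) x x - bilin R n x x" for n x
  define Q where "Q x = (\<Sum>n. d x n)" for x
  have tele: "(\<Sum>i<n. d x i) = bilin R n x x" for n x
    unfolding d_def by (subst sum_lessThan_telescope) (simp add: bilin_def)
  have bd: "norm (d x n) \<le> 2 * C / (1 - q) * q ^ n" if "x \<in> ell2_ball" for n x
    using bilin_increment_le[OF ell2_ball_coord[OF that], of n] by (simp add: d_def)
  have sm: "summable (\<lambda>n. 2 * C / (1 - q) * q ^ n)"
    using q by (intro summable_mult summable_geometric) auto
  have ul: "uniform_limit ell2_ball (\<lambda>n x. \<Sum>i<n. d x i) (\<lambda>x. \<Sum>i. d x i) sequentially"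
    using bd sm by (rule Weierstrass_m_test)
  have cont: "continuous_on ell2_ball (\<lambda>x. bilin R n x x)" for n
    unfolding bilin_def
    by (intro continuous_intros continuous_on_subset[OF continuous_on_product_coordinates]) auto
  have Qc: "continuous_on ell2_ball Q"
    unfolding Q_def using uniform_limit_theorem[OF _ ul] cont by (simp add: tele)
  have Qlim: "(\<lambda>n. bilin R n x x) \<longlonglongrightarrow> Q x" if "x \<in> ell2_ball" for x
    using tendsto_uniform_limitI[OF ul that] by (simp add: tele Q_def)
  have "(\<lambda>_. 0) \<in> ell2_ball" by (simp add: ell2_ball_def)
  then obtain a where a: "a \<in> ell2_ball" and max: "\<And>x. x \<in> ell2_ball \<Longrightarrow> Q x \<le> Q a"
    using continuous_attains_sup[OF compact_ell2_ball _ Qc] by blast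
  have "bilin R n x x \<le> Q a * (\<Sum>i<n. (x i)\<^sup>2)" for n x
  proof (cases "(\<Sum>i<n. (x i)\<^sup>2) = 0")
    case True
    then have "x i = 0" if "i < n" for i
      using that by (subst (asm) sum_nonneg_eq_0_iff) auto
    then show ?thesis using True by (simp add: bilin_def)
  next
    case False
    define N where "N = (\<Sum>i<n. (x i)\<^sup>2)"
    have N: "N > 0" using False by (simp add: N_def order_less_le sum_nonneg)
    define y where "y i = (if i < n then x i / sqrt N else 0)" for i
    have ysum: "(\<Sum>i<m. (y i)\<^sup>2) = (\<Sum>i<min m n. (x i)\<^sup>2) / N" for m
    proof -
      have "(\<Sum>i<m. (y i)\<^sup>2) = (\<Sum>i<min m n. (y i)\<^sup>2)"
        by (rule sum.mono_neutral_right) (auto simp: y_def)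
      also have "\<dots> = (\<Sum>i<min m n. (x i)\<^sup>2 / N)"
        using N by (intro sum.cong) (auto simp: y_def power_divide)
      finally show ?thesis by (simp add: sum_divide_distrib)
    qed
    have "(\<Sum>i<min m n. (x i)\<^sup>2) \<le> N" for m
      unfolding N_def by (rule sum_mono2) auto
    then have yb: "y \<in> ell2_ball" using N by (simp add: ell2_ball_def ysum)
    have ev: "bilin R m y y = bilin R n x x / N" if "m \<ge> n" for m
    proof -
      have "bilin R m y y = bilin R n y y"
        using that by (rule bilin_truncate) (auto simp: y_def)
      also have "\<dots> = bilin R n x x / N" unfolding bilin_def sum_divide_distrib
        using N by (intro sum.cong) (auto simp: y_def)
      finally show ?thesis .
    qed
    have "(\<lambda>m. bilin R m y y) \<longlonglongrightarrow> bilin R n x x / N"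
      using ev by (intro tendsto_eventually eventually_sequentiallyI) auto
    then have "Q y = bilin R n x x / N" using Qlim[OF yb] LIMSEQ_unique by blast
    then show ?thesis using mult_left_mono[OF max[OF yb], of N] N
      by (simp add: N_def[symmetric] field_simps)
  qed
  then show ?thesis using that[OF a Qlim[OF a]] by blast
qed

text \<open>First-order condition: perturbing the maximiser in the direction of the \<open>i\<close>-th coordinate by \<open>t\<close> changes the
form by \<open>2 t (R a)\<^sub>i + t\<^sup>2 R\<^sub>i\<^sub>i\<close>, which must not exceed \<open>\<delta> (2 t a\<^sub>i + t\<^sup>2)\<close> for any \<open>t\<close>.\<close>

lemma maximiser_is_eigenvector:
  assumes a: "a \<in> ell2_ball" and lim: "(\<lambda>n. bilin R n a a) \<longlonglongrightarrow> \<delta>"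
    and max: "\<And>n x. bilin R n x x \<le> \<delta> * (\<Sum>i<n. (x i)\<^sup>2)"
  shows "(\<lambda>j. R i j * a j) sums (\<delta> * a i)"
proof -
  define w where "w = (\<Sum>j. R i j * a j)"
  have ws: "(\<lambda>j. R i j * a j) sums w"
    unfolding w_def using row_summable[OF ell2_ball_coord[OF a]] by (rule summable_sums)
  have d0: "0 \<le> \<delta>" using max[of 1 "\<lambda>_. 1"] psd[of 1 "\<lambda>_. 1"] by simp
  have quad: "2 * t * w + t\<^sup>2 * R i i \<le> \<delta> * (2 * t * a i + t\<^sup>2)" for t
  proof -
    define x where "x j = a j + t * (if j = i then 1 else 0)" for j
    have b: "bilin R n x x = bilin R n a a + 2 * t * (\<Sum>j<n. R i j * a j) + t\<^sup>2 * R i i" if "i < n" for n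
    proof -
      have "bilin R n x x = bilin R n a a + (\<Sum>k<n. \<Sum>j<n. t * (if j = i then a k * R k j else 0))
         + (\<Sum>k<n. \<Sum>j<n. t * (if k = i then R k j * a j else 0)) + (\<Sum>k<n. \<Sum>j<n. t\<^sup>2 * (if k = i \<and> j = i then R i i else 0))"
        unfolding bilin_def sum.distrib[symmetric]
        by (intro sum.cong refl) (auto simp: x_def algebra_simps power2_eq_square)
      also have "(\<Sum>k<n. \<Sum>j<n. t * (if j = i then a k * R k j else 0)) = t * (\<Sum>j<n. R i j * a j)"
        using that by (simp add: sum_distrib_left sym mult_ac if_distrib cong: if_cong)
      also have "(\<Sum>k<n. \<Sum>j<n. t * (if k = i then R k j * a j else 0)) = t * (\<Sum>j<n. R i j * a j)"
        using that by (subst sum.swap) (simp add: sum_distrib_left if_distrib cong: if_cong)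
      also have "(\<Sum>k<n. \<Sum>j<n. t\<^sup>2 * (if k = i \<and> j = i then R i i else 0)) = t\<^sup>2 * R i i"
      proof -
        have "(\<Sum>j<n. t\<^sup>2 * (if k = i \<and> j = i then R i i else 0)) = (if k = i then t\<^sup>2 * R i i else 0)" for k
          using that by (cases "k = i") (simp_all add: if_distrib cong: if_cong)
        then show ?thesis using that by simp
      qed
      finally show ?thesis by (simp add: algebra_simps)
    qed
    have nrm: "(\<Sum>j<n. (x j)\<^sup>2) \<le> 1 + 2 * t * a i + t\<^sup>2" if "i < n" for n
    proof -
      have "(\<Sum>j<n. (x j)\<^sup>2) = (\<Sum>j<n. (a j)\<^sup>2) + (\<Sum>j<n. if j = i then 2 * t * a i + t\<^sup>2 else 0)"
        unfolding sum.distrib[symmetric] by (intro sum.cong) (auto simp: x_def power2_eq_square algebra_simps)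
      moreover have "(\<Sum>j<n. (a j)\<^sup>2) \<le> 1" using a by (simp add: ell2_ball_def)
      ultimately show ?thesis using that by simp
    qed
    have "(\<lambda>n. bilin R n a a + 2 * t * (\<Sum>j<n. R i j * a j) + t\<^sup>2 * R i i) \<longlonglongrightarrow> \<delta> + 2 * t * w + t\<^sup>2 * R i i"
      using lim ws unfolding sums_def by (intro tendsto_intros)
    moreover have "bilin R n a a + 2 * t * (\<Sum>j<n. R i j * a j) + t\<^sup>2 * R i i \<le> \<delta> * (1 + 2 * t * a i + t\<^sup>2)"
      if "n \<ge> Suc i" for n
      using max[of n x] b[of n] mult_left_mono[OF nrm[of n] d0] that by simp
    ultimately have "\<delta> + 2 * t * w + t\<^sup>2 * R i i \<le> \<delta> * (1 + 2 * t * a i + t\<^sup>2)"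
      by (intro Lim_bounded[where M = "Suc i"]) auto
    then show ?thesis by (simp add: algebra_simps)
  qed
  have "w = \<delta> * a i"
  proof (rule ccontr)
    assume ne: "w \<noteq> \<delta> * a i"
    define D where "D = w - \<delta> * a i"
    define E where "E = \<bar>\<delta> - R i i\<bar> + 1"
    have q2: "2 * t * D \<le> t\<^sup>2 * E" for t
    proof -
      have "2 * t * D \<le> t\<^sup>2 * (\<delta> - R i i)" using quad[of t] by (simp add: D_def algebra_simps)
      also have "\<dots> \<le> t\<^sup>2 * E" by (intro mult_left_mono) (auto simp: E_def)
      finally show ?thesis .
    qed
    have E: "E > 0" by (simp add: E_def add_nonneg_pos)
    \<comment> \<open>\<open>t = D / E\<close> minimises \<open>t\<^sup>2 E - 2 t D\<close>.\<close>
    have "2 * D\<^sup>2 / E \<le> D\<^sup>2 / E" using q2[of "D / E"] E by (simp add: power2_eq_square field_simps)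
    moreover have "D\<^sup>2 / E > 0" using ne E by (simp add: D_def)
    ultimately show False by simp
  qed
  then show ?thesis using ws by simp
qed

end

lemma bilin_minus_rank_one:
  "bilin (\<lambda>i j. R i j - d * a i * a j) n x x = bilin R n x x - d * (\<Sum>i<n. a i * x i)\<^sup>2"
proof -
  have "d * (\<Sum>i<n. a i * x i)\<^sup>2 = (\<Sum>i<n. \<Sum>j<n. x i * (d * a i * a j) * x j)"
    unfolding power2_eq_square sum_product unfolding sum_distrib_left by (intro sum.cong refl) (simp add: mult_ac)
  then show ?thesis by (simp add: bilin_def algebra_simps sum_subtractf)
qed

context decaying_psd
begin

text \<open>One step of the spectral decomposition. That the remainder is again positive semidefinite is the
Cauchy--Schwarz inequality \<open>\<langle>R a, x\<rangle>\<^sup>2 \<le> \<langle>R a, a\<rangle> \<langle>R x, x\<rangle>\<close>, where \<open>R a = \<delta> a\<close> and \<open>\<bar>a\<bar> = 1\<close>.\<close>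

lemma deflation:
  assumes nz: "R i0 i0 \<noteq> 0"
  shows "\<exists>\<delta> a. 0 < \<delta> \<and> a \<in> ell2_ball \<and> (\<lambda>n. \<Sum>i<n. (a i)\<^sup>2) \<longlonglongrightarrow> 1
    \<and> (\<forall>i. (\<lambda>j. R i j * a j) sums (\<delta> * a i))
    \<and> (\<forall>n x. bilin R n x x \<le> \<delta> * (\<Sum>i<n. (x i)\<^sup>2))
    \<and> decaying_psd (\<lambda>i j. R i j - \<delta> * a i * a j) C q"
proof -
  obtain a \<delta> where a: "a \<in> ell2_ball" and lim: "(\<lambda>n. bilin R n a a) \<longlonglongrightarrow> \<delta>"
    and max: "\<And>n x. bilin R n x x \<le> \<delta> * (\<Sum>i<n. (x i)\<^sup>2)"
    using bilin_has_maximiser by blast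
  have eig: "(\<lambda>j. R i j * a j) sums (\<delta> * a i)" for i
    using maximiser_is_eigenvector[OF a lim max] .
  have "R i0 i0 \<le> \<delta>"
  proof -
    define e where "e i = (if i = i0 then 1 else 0 :: real)" for i
    have "bilin R (Suc i0) e e = R i0 i0" "(\<Sum>i<Suc i0. (e i)\<^sup>2) = 1"
      unfolding bilin_def e_def by (simp_all add: if_distrib cong: if_cong)
    then show ?thesis using max[of "Suc i0" e] by simp
  qed
  then have d: "0 < \<delta>" using nz diag_nonneg[of i0] by simp
  have norm1: "(\<lambda>n. \<Sum>i<n. (a i)\<^sup>2) \<longlonglongrightarrow> 1"
  proof -
    have "incseq (\<lambda>n. \<Sum>i<n. (a i)\<^sup>2)" by (intro incseq_SucI) simp
    moreover have bnd: "(\<Sum>i<n. (a i)\<^sup>2) \<le> 1" for n using a by (simp add: ell2_ball_def)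
    ultimately obtain N where N: "(\<lambda>n. \<Sum>i<n. (a i)\<^sup>2) \<longlonglongrightarrow> N"
      using incseq_convergent by blast
    have "N \<le> 1" using N bnd by (intro Lim_bounded) auto
    moreover have "\<delta> \<le> \<delta> * N"
      using lim tendsto_mult_left[OF N, of \<delta>] max by (intro LIMSEQ_le) auto
    then have "1 \<le> N" using d by simp
    ultimately show ?thesis using N by simp
  qed
  have psd': "\<delta> * (\<Sum>i<n. a i * x i)\<^sup>2 \<le> bilin R n x x" for n x
  proof -
    \<comment> \<open>The form is evaluated at \<open>x - s a\<close>, with \<open>a\<close> cut off at \<open>m\<close>; the choice \<open>s = \<langle>a, x\<rangle>\<close> is optimal.\<close>
    define s where "s = (\<Sum>i<n. a i * x i)"
    have "0 \<le> bilin R n x x - 2 * s * (\<Sum>i<n. x i * (\<Sum>j<m. R i j * a j)) + s\<^sup>2 * bilin R m a a" if "n \<le> m" for m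
    proof -
      define y where "y i = (if i < n then x i else 0)" for i
      have lin: "bilin R m (\<lambda>i. y i - s * a i) (\<lambda>i. y i - s * a i)
        = bilin R m y y - s * bilin R m y a - s * bilin R m a y + s\<^sup>2 * bilin R m a a"
        unfolding bilin_def sum_distrib_left sum.distrib[symmetric] sum_subtractf[symmetric]
        by (intro sum.cong refl) (simp add: algebra_simps power2_eq_square)
      have yy: "bilin R m y y = bilin R n x x"
      proof -
        have "bilin R m y y = bilin R n y y" using that by (rule bilin_truncate) (auto simp: y_def)
        then show ?thesis by (simp add: bilin_def y_def)
      qed
      have ya: "bilin R m y a = (\<Sum>i<n. x i * (\<Sum>j<m. R i j * a j))"
      proof -
        have "bilin R m y a = (\<Sum>i<m. y i * (\<Sum>j<m. R i j * a j))"
          by (simp add: bilin_def sum_distrib_left mult.assoc)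
        also have "\<dots> = (\<Sum>i<n. x i * (\<Sum>j<m. R i j * a j))"
          using that by (intro sum.mono_neutral_cong_right) (auto simp: y_def)
        finally show ?thesis .
      qed
      show ?thesis using psd[of m "\<lambda>i. y i - s * a i"] lin yy ya bilin_commute[of m a y] by simp
    qed
    moreover have "(\<lambda>m. bilin R n x x - 2 * s * (\<Sum>i<n. x i * (\<Sum>j<m. R i j * a j)) + s\<^sup>2 * bilin R m a a)
      \<longlonglongrightarrow> bilin R n x x - 2 * s * (\<Sum>i<n. x i * (\<delta> * a i)) + s\<^sup>2 * \<delta>"
      using lim eig unfolding sums_def by (intro tendsto_intros)
    ultimately have "0 \<le> bilin R n x x - 2 * s * (\<Sum>i<n. x i * (\<delta> * a i)) + s\<^sup>2 * \<delta>"
      by (intro Lim_bounded2[where N = n and C = 0]) auto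
    moreover have "(\<Sum>i<n. x i * (\<delta> * a i)) = \<delta> * s"
      by (simp add: s_def sum_distrib_left mult_ac)
    ultimately have "0 \<le> bilin R n x x - 2 * s * (\<delta> * s) + s\<^sup>2 * \<delta>" by simp
    then show ?thesis by (simp add: s_def[symmetric] power2_eq_square algebra_simps)
  qed
  have "decaying_psd (\<lambda>i j. R i j - \<delta> * a i * a j) C q"
  proof
    show "R i j - \<delta> * a i * a j = R j i - \<delta> * a j * a i" for i j using sym[of i j] by simp
    show "0 \<le> bilin (\<lambda>i j. R i j - \<delta> * a i * a j) n x x" for n x
      using psd'[where n = n and x = x] by (simp add: bilin_minus_rank_one)
    show "R i i - \<delta> * a i * a i \<le> C * q ^ (2 * i)" for i
    proof -
      have "0 \<le> \<delta> * a i * a i" using d by (simp add: mult.assoc)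
      then show ?thesis using diag[of i] by linarith
    qed
  qed (use q in auto)
  then show ?thesis using d a norm1 eig max by blast
qed

end

text \<open>Infinite rank guarantees that the deflation never stops.\<close>

locale infinite_rank_psd = decaying_psd G C q for G C q +
  assumes infinite_rank: "\<exists>i j. G i j \<noteq> (\<Sum>k<(N::nat). d k * a k i * a k j)"
begin

text \<open>The deflation is iterated. Successive maxima decrease because the remainders do, and their sum is bounded by
the trace, so they tend to \<open>0\<close>; hence the remainders tend to \<open>0\<close> and the expansion of \<open>G\<close> follows. The last
property says that after \<open>N\<close> steps the remainder is bounded by \<open>\<delta> N\<close>; it replaces completeness of the
eigenvectors.\<close>

theorem spectral_decomposition:
  obtains \<delta> :: "nat \<Rightarrow> real" and a :: "nat \<Rightarrow> nat \<Rightarrow> real" where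
    "\<And>k. 0 < \<delta> k" "decseq \<delta>" "\<delta> \<longlonglongrightarrow> 0" "\<And>k. a k \<in> ell2_ball"
    "\<And>k l. (\<lambda>n. \<Sum>i<n. a k i * a l i) \<longlonglongrightarrow> (if k = l then 1 else 0)"
    "\<And>k i. (\<lambda>j. G i j * a k j) sums (\<delta> k * a k i)"
    "\<And>i j. (\<lambda>N. \<Sum>k<N. \<delta> k * a k i * a k j) \<longlonglongrightarrow> G i j"
    "\<And>N n x. bilin G n x x \<le> (\<Sum>k<N. \<delta> k * (\<Sum>i<n. a k i * x i)\<^sup>2) + \<delta> N * (\<Sum>i<n. (x i)\<^sup>2)"
proof -
  define good where "good D \<delta> a \<longleftrightarrow> 0 < \<delta> \<and> a \<in> ell2_ball \<and> (\<lambda>n. \<Sum>i<n. (a i)\<^sup>2) \<longlonglongrightarrow> 1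
    \<and> (\<forall>i. (\<lambda>j. D i j * a j) sums (\<delta> * a i))
    \<and> (\<forall>n x. bilin D n x x \<le> \<delta> * (\<Sum>i<n. (x i)\<^sup>2))
    \<and> decaying_psd (\<lambda>i j. D i j - \<delta> * a i * a j) C q"
    for D :: "nat \<Rightarrow> nat \<Rightarrow> real" and \<delta> :: real and a :: "nat \<Rightarrow> real"
  define pick where "pick D = (SOME p. good D (fst p) (snd p))" for D
  \<comment> \<open>\<open>D n\<close> is the remainder after \<open>n\<close> deflation steps.\<close>
  define D where "D = rec_nat G (\<lambda>_ D. \<lambda>i j. D i j - fst (pick D) * snd (pick D) i * snd (pick D) j)"
  define \<delta> where "\<delta> n = fst (pick (D n))" for n
  define a where "a n = snd (pick (D n))" for n
  have D0: "D 0 = G" and DS: "D (Suc n) = (\<lambda>i j. D n i j - \<delta> n * a n i * a n j)" for n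
    by (simp_all add: D_def \<delta>_def a_def)
  have Dsum: "D n i j = G i j - (\<Sum>k<n. \<delta> k * a k i * a k j)" for n i j
    by (induction n) (simp_all add: D0 DS)
  have psdD: "decaying_psd (D n) C q \<and> good (D n) (\<delta> n) (a n)" for n
  proof (induction n)
    have pickable: "good (D n) (\<delta> n) (a n)" if d: "decaying_psd (D n) C q" for n
    proof -
      interpret Dn: decaying_psd "D n" C q by (rule d)
      obtain i j where "D n i j \<noteq> 0" using infinite_rank[where N = n and d = \<delta> and a = a] by (auto simp: Dsum)
      then have "D n i i \<noteq> 0" using Dn.entry_square_le[of i j] zero_less_power2[of "D n i j"] by auto
      from Dn.deflation[OF this] have "\<exists>p. good (D n) (fst p) (snd p)" by (simp add: good_def)
      then show ?thesis unfolding \<delta>_def a_def pick_def by (rule someI_ex)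
    qed
    case 0
    have "decaying_psd (D 0) C q" unfolding D0 by (rule decaying_psd_axioms)
    then show ?case using pickable by blast
    case (Suc n)
    then have "decaying_psd (D (Suc n)) C q" by (simp add: DS good_def)
    then show ?case using pickable by blast
  qed
  have pos: "0 < \<delta> k" and ball: "a k \<in> ell2_ball" and norm1: "(\<lambda>n. \<Sum>i<n. (a k i)\<^sup>2) \<longlonglongrightarrow> 1"
    and eigD: "(\<lambda>j. D k i j * a k j) sums (\<delta> k * a k i)"
    and maxD: "bilin (D k) n x x \<le> \<delta> k * (\<Sum>i<n. (x i)\<^sup>2)" for k n x i
    using psdD[of k] by (simp_all add: good_def)
  have coord: "\<bar>a k j\<bar> \<le> 1" for k j using ell2_ball_coord[OF ball] .
  have orth_of_kernel: "(\<lambda>n. \<Sum>i<n. a k i * a l i) \<longlonglongrightarrow> 0"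
    if "\<And>i. (\<lambda>j. D l i j * a k j) sums 0" for k l
  proof -
    interpret Dl: decaying_psd "D l" C q using psdD by blast
    have "(\<lambda>n. bilin (D l) n (a k) (a l) - (\<Sum>i<n. a k i * (\<delta> l * a l i))) \<longlonglongrightarrow> 0"
      by (rule Dl.bilin_limit[OF coord coord eigD])
    moreover have "(\<lambda>n. bilin (D l) n (a l) (a k) - (\<Sum>i<n. a l i * 0)) \<longlonglongrightarrow> 0"
      by (rule Dl.bilin_limit[OF coord coord that])
    ultimately have "(\<lambda>n. bilin (D l) n (a l) (a k) - (bilin (D l) n (a k) (a l) - (\<Sum>i<n. a k i * (\<delta> l * a l i)))) \<longlonglongrightarrow> 0 - 0"
      by (intro tendsto_diff) simp_all
    then have "(\<lambda>n. (\<Sum>i<n. a k i * (\<delta> l * a l i)) / \<delta> l) \<longlonglongrightarrow> 0 / \<delta> l"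
      using Dl.bilin_commute[of _ "a l" "a k"] pos[of l] by (intro tendsto_divide) auto
    then show ?thesis using pos[of l] by (simp add: sum_divide_distrib)
  qed
  have kernel: "(\<lambda>j. D l i j * a k j) sums 0" if "k < l" for k l i
    using that
  proof (induction l arbitrary: i)
    case (Suc l)
    have split: "(\<lambda>j. D (Suc l) i j * a k j) = (\<lambda>j. D l i j * a k j - \<delta> l * a l i * (a k j * a l j))"
      by (simp add: DS algebra_simps)
    show ?case
    proof (cases "k = l")
      case True
      have "(\<lambda>j. a l j * a l j) sums 1" using norm1[of l] by (simp add: sums_def power2_eq_square)
      then have "(\<lambda>j. D l i j * a k j - \<delta> l * a l i * (a k j * a l j)) sums (\<delta> l * a l i - \<delta> l * a l i * 1)"
        unfolding True by (intro sums_diff eigD sums_mult)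
      then show ?thesis by (simp add: split)
    next
      case False
      then have "k < l" using Suc.prems by simp
      then have IH: "(\<lambda>j. D l i j * a k j) sums 0" for i using Suc.IH by blast
      have "(\<lambda>j. D l i j * a k j - \<delta> l * a l i * (a k j * a l j)) sums (0 - \<delta> l * a l i * 0)"
        using orth_of_kernel[OF IH] by (intro sums_diff IH sums_mult) (simp add: sums_def)
      then show ?thesis by (simp add: split)
    qed
  qed simp
  have orth: "(\<lambda>n. \<Sum>i<n. a k i * a l i) \<longlonglongrightarrow> (if k = l then 1 else 0)" for k l
  proof -
    consider "k = l" | "k < l" | "l < k" by linarith
    then show ?thesis
    proof cases
      case 1 then show ?thesis using norm1[of l] by (simp add: power2_eq_square)
    next
      case 2 then show ?thesis using orth_of_kernel[OF kernel[OF 2]] by simp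
    next
      case 3 then show ?thesis using orth_of_kernel[OF kernel[OF 3]] by (simp add: mult.commute)
    qed
  qed
  have dec: "decseq \<delta>"
  proof (rule decseq_SucI)
    fix k
    have "bilin (D (Suc k)) n (a (Suc k)) (a (Suc k)) \<le> \<delta> k * (\<Sum>i<n. (a (Suc k) i)\<^sup>2)" for n
      using maxD[of k n "a (Suc k)"] mult_nonneg_nonneg[OF less_imp_le[OF pos[of k]] zero_le_power2[of "\<Sum>i<n. a k i * a (Suc k) i"]]
      unfolding DS bilin_minus_rank_one by linarith
    moreover have "(\<lambda>n. bilin (D (Suc k)) n (a (Suc k)) (a (Suc k))) \<longlonglongrightarrow> \<delta> (Suc k)"
    proof -
      interpret Dk: decaying_psd "D (Suc k)" C q using psdD by blast
      have "(\<lambda>n. bilin (D (Suc k)) n (a (Suc k)) (a (Suc k)) - (\<Sum>i<n. a (Suc k) i * (\<delta> (Suc k) * a (Suc k) i))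
         + \<delta> (Suc k) * (\<Sum>i<n. (a (Suc k) i)\<^sup>2)) \<longlonglongrightarrow> 0 + \<delta> (Suc k) * 1"
        by (intro tendsto_add tendsto_mult_left Dk.bilin_limit[OF coord coord eigD] norm1)
      then show ?thesis by (simp add: power2_eq_square sum_distrib_left mult_ac)
    qed
    moreover have "(\<lambda>n. \<delta> k * (\<Sum>i<n. (a (Suc k) i)\<^sup>2)) \<longlonglongrightarrow> \<delta> k * 1"
      by (intro tendsto_mult_left norm1)
    ultimately show "\<delta> (Suc k) \<le> \<delta> k" by (intro LIMSEQ_le) auto
  qed
  have "summable \<delta>"
  proof (rule summableI_nonneg_bounded)
    fix n
    have "(\<Sum>k<n. \<delta> k * (\<Sum>i<m. (a k i)\<^sup>2)) \<le> C / (1 - q)" for m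
    proof -
      have "(\<Sum>k<n. \<delta> k * (\<Sum>i<m. (a k i)\<^sup>2)) = (\<Sum>i<m. \<Sum>k<n. \<delta> k * a k i * a k i)"
        by (subst sum.swap) (simp add: sum_distrib_left power2_eq_square mult.assoc)
      also have "\<dots> \<le> (\<Sum>i<m. C * q ^ i)"
      proof (rule sum_mono)
        fix i
        interpret Dn: decaying_psd "D n" C q using psdD by blast
        have "(\<Sum>k<n. \<delta> k * a k i * a k i) \<le> G i i"
          using Dn.diag_nonneg[of i] by (simp add: Dsum)
        also have "\<dots> \<le> C * q ^ (2 * i)" by (rule diag)
        also have "\<dots> \<le> C * q ^ i"
          using q C_nonneg by (intro mult_left_mono power_decreasing) auto
        finally show "(\<Sum>k<n. \<delta> k * a k i * a k i) \<le> C * q ^ i" .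
      qed
      also have "\<dots> = C * (\<Sum>i<m. q ^ i)" by (simp add: sum_distrib_left)
      also have "\<dots> \<le> C * (1 / (1 - q))" by (intro mult_left_mono geometric_sum_le q C_nonneg)
      finally show ?thesis by simp
    qed
    moreover have "(\<lambda>m. \<Sum>k<n. \<delta> k * (\<Sum>i<m. (a k i)\<^sup>2)) \<longlonglongrightarrow> (\<Sum>k<n. \<delta> k * 1)"
      by (intro tendsto_sum tendsto_mult_left norm1)
    ultimately show "sum \<delta> {..<n} \<le> C / (1 - q)" by (intro Lim_bounded) auto
  qed (use pos in \<open>auto intro: less_imp_le\<close>)
  then have d0: "\<delta> \<longlonglongrightarrow> 0" by (rule summable_LIMSEQ_zero)
  have expand: "(\<lambda>N. \<Sum>k<N. \<delta> k * a k i * a k j) \<longlonglongrightarrow> G i j" for i j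
  proof -
    have diagD: "0 \<le> D n i i \<and> D n i i \<le> \<delta> n" for n i
    proof -
      interpret Dn: decaying_psd "D n" C q using psdD by blast
      have "bilin (D n) (Suc i) (\<lambda>k. if k = i then 1 else 0) (\<lambda>k. if k = i then 1 else 0) = D n i i"
        "(\<Sum>k<Suc i. (if k = i then 1 else 0 :: real)\<^sup>2) = 1"
        unfolding bilin_def by (simp_all add: if_distrib cong: if_cong)
      then show ?thesis using maxD[of n "Suc i" "\<lambda>k. if k = i then 1 else 0"] Dn.diag_nonneg[of i] by simp
    qed
    have "norm (D n i j) \<le> \<delta> n" for n
    proof -
      interpret Dn: decaying_psd "D n" C q using psdD by blast
      have "\<bar>D n i j\<bar>\<^sup>2 \<le> D n i i * D n j j" using Dn.entry_square_le[of i j] by simp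
      also have "\<dots> \<le> \<delta> n * \<delta> n" using diagD[of n i] diagD[of n j] pos[of n] by (intro mult_mono) auto
      finally have "\<bar>D n i j\<bar>\<^sup>2 \<le> (\<delta> n)\<^sup>2" by (simp add: power2_eq_square)
      then have "\<bar>D n i j\<bar> \<le> \<delta> n" using less_imp_le[OF pos[of n]] by (rule power2_le_imp_le)
      then show ?thesis by simp
    qed
    then have "(\<lambda>n. D n i j) \<longlonglongrightarrow> 0" using d0 by (rule Lim_null_comparison[OF always_eventually[OF allI]])
    then have "(\<lambda>n. G i j - D n i j) \<longlonglongrightarrow> G i j - 0" by (intro tendsto_diff tendsto_const)
    then show ?thesis by (simp add: Dsum)
  qed
  have eigG: "(\<lambda>j. G i j * a k j) sums (\<delta> k * a k i)" for k i
  proof -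
    have "(\<lambda>j. D k i j * a k j + (\<Sum>m<k. \<delta> m * a m i * (a m j * a k j))) sums (\<delta> k * a k i + (\<Sum>m<k. \<delta> m * a m i * 0))"
    proof (intro sums_add eigD sums_sum sums_mult)
      show "(\<lambda>j. a m j * a k j) sums 0" if "m \<in> {..<k}" for m
        using orth[of m k] that by (simp add: sums_def)
    qed
    then show ?thesis by (simp add: Dsum algebra_simps sum_distrib_left)
  qed
  have form: "bilin G n x x \<le> (\<Sum>k<N. \<delta> k * (\<Sum>i<n. a k i * x i)\<^sup>2) + \<delta> N * (\<Sum>i<n. (x i)\<^sup>2)" for N n x
  proof -
    have "bilin (D N) n x x = bilin G n x x - (\<Sum>k<N. \<delta> k * (\<Sum>i<n. a k i * x i)\<^sup>2)"
      by (induction N) (simp_all add: D0 DS bilin_minus_rank_one)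
    then show ?thesis using maxD[of N n x] by simp
  qed
  show ?thesis using that[OF pos dec d0 ball orth eigG expand form] .
qed

end

section \<open>Leibniz determinants\<close>

definition sgnr :: "(nat \<Rightarrow> nat) \<Rightarrow> real" where
  "sgnr \<sigma> = of_int (sign \<sigma>)"

text \<open>Determinants of functions of two indices, which spares the carrier sets of matrices. They agree with
\<open>Determinant.det\<close> by \<open>ldet_eq_det\<close>.\<close>

definition ldet :: "nat \<Rightarrow> (nat \<Rightarrow> nat \<Rightarrow> real) \<Rightarrow> real" where
  "ldet r f = (\<Sum>\<sigma> | \<sigma> permutes {..<r}. sgnr \<sigma> * (\<Prod>k<r. f k (\<sigma> k)))"

lemma permutes_lessThan: "\<sigma> permutes {..<r} \<Longrightarrow> k < r \<Longrightarrow> \<sigma> k < (r::nat)"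
  using permutes_in_image[of \<sigma> "{..<r}" k] by simp

lemma sgnr_compose:
  assumes "\<sigma> permutes {..<r}" "\<tau> permutes {..<r}"
  shows "sgnr (\<sigma> \<circ> \<tau>) = sgnr \<sigma> * sgnr \<tau>"
  using sign_compose[of \<sigma> \<tau>] assms permutes_imp_permutation[of "{..<r}"] by (simp add: sgnr_def)

lemma sgnr_inv: "\<sigma> permutes {..<r} \<Longrightarrow> sgnr (Hilbert_Choice.inv \<sigma>) = sgnr \<sigma>"
  using sign_inverse[of \<sigma>] permutes_imp_permutation[of "{..<r}" \<sigma>] by (simp add: sgnr_def)

lemma sgnr_square [simp]: "sgnr \<sigma> * sgnr \<sigma> = 1"
  using sign_idempotent[of \<sigma>] unfolding sgnr_def by (simp only: of_int_mult[symmetric] of_int_1)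

lemma sgnr_square_left [simp]: "sgnr \<sigma> * (sgnr \<sigma> * x) = x"
  by (simp add: mult.assoc[symmetric])

lemma sgnr_cases: "sgnr \<sigma> = 1 \<or> sgnr \<sigma> = -1"
  by (cases \<sigma> rule: sign_cases) (auto simp: sgnr_def)

lemma ldet_eq_det: "Determinant.det (Matrix.mat r r (\<lambda>(i, j). f i j)) = ldet r f"
proof -
  have "Determinant.det (Matrix.mat r r (\<lambda>(i, j). f i j)) =
    (\<Sum>p | p permutes {0..<r}. signof p * (\<Prod>i = 0..<r. Matrix.mat r r (\<lambda>(i, j). f i j) $$ (i, p i)))"
    by (rule det_def') simp
  also have "\<dots> = ldet r f" unfolding ldet_def lessThan_atLeast0 sgnr_def
    by (intro sum.cong refl arg_cong2[where f = "(*)"] prod.cong) (auto simp: permutes_lessThan)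
  finally show ?thesis .
qed

lemma ldet_cong: "(\<And>k l. k < r \<Longrightarrow> l < r \<Longrightarrow> f k l = g k l) \<Longrightarrow> ldet r f = ldet r g"
  unfolding ldet_def by (intro sum.cong refl arg_cong2[where f = "(*)"] prod.cong) (auto simp: permutes_lessThan)

lemma ldet_permute_rows:
  assumes t: "\<tau> permutes {..<r}"
  shows "ldet r (\<lambda>k l. f (\<tau> k) l) = sgnr \<tau> * ldet r f"
proof -
  have "ldet r (\<lambda>k l. f (\<tau> k) l) = (\<Sum>\<sigma> | \<sigma> permutes {..<r}. sgnr (\<sigma> \<circ> \<tau>) * (\<Prod>k<r. f (\<tau> k) ((\<sigma> \<circ> \<tau>) k)))"
    unfolding ldet_def by (rule sum_permutations_compose_right[OF t])
  also have "\<dots> = (\<Sum>\<sigma> | \<sigma> permutes {..<r}. sgnr \<tau> * (sgnr \<sigma> * (\<Prod>k<r. f k (\<sigma> k))))"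
  proof (intro sum.cong refl)
    fix \<sigma> assume "\<sigma> \<in> {\<sigma>. \<sigma> permutes {..<r}}"
    then have s: "\<sigma> permutes {..<r}" by simp
    have "(\<Prod>k<r. f k (\<sigma> k)) = (\<Prod>k<r. f (\<tau> k) ((\<sigma> \<circ> \<tau>) k))"
      using prod.permute[OF t, of "\<lambda>k. f k (\<sigma> k)"] by (simp add: o_def)
    then show "sgnr (\<sigma> \<circ> \<tau>) * (\<Prod>k<r. f (\<tau> k) ((\<sigma> \<circ> \<tau>) k)) = sgnr \<tau> * (sgnr \<sigma> * (\<Prod>k<r. f k (\<sigma> k)))"
      using sgnr_compose[OF s t] by simp
  qed
  finally show ?thesis by (simp add: ldet_def sum_distrib_left)
qed

lemma ldet_transpose: "ldet r (\<lambda>k l. f l k) = ldet r f"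
proof -
  have "ldet r (\<lambda>k l. f l k) = (\<Sum>\<sigma> | \<sigma> permutes {..<r}. sgnr (Hilbert_Choice.inv \<sigma>) * (\<Prod>k<r. f (Hilbert_Choice.inv \<sigma> k) k))"
    unfolding ldet_def by (rule sum_permutations_inverse)
  also have "\<dots> = ldet r f"
    unfolding ldet_def
  proof (intro sum.cong refl)
    fix \<sigma> assume "\<sigma> \<in> {\<sigma>. \<sigma> permutes {..<r}}"
    then have s: "\<sigma> permutes {..<r}" by simp
    have "(\<Prod>k<r. f (Hilbert_Choice.inv \<sigma> k) k) = (\<Prod>k<r. f k (\<sigma> k))"
      using prod.permute[OF s, of "\<lambda>k. f (Hilbert_Choice.inv \<sigma> k) k"] permutes_inverses[OF s] by (simp add: o_def)
    then show "sgnr (Hilbert_Choice.inv \<sigma>) * (\<Prod>k<r. f (Hilbert_Choice.inv \<sigma> k) k) = sgnr \<sigma> * (\<Prod>k<r. f k (\<sigma> k))"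
      using sgnr_inv[OF s] by simp
  qed
  finally show ?thesis .
qed

lemma ldet_permute_cols:
  assumes t: "\<tau> permutes {..<r}"
  shows "ldet r (\<lambda>k l. f k (\<tau> l)) = sgnr \<tau> * ldet r f"
  using ldet_permute_rows[OF t, of "\<lambda>k l. f l k"] ldet_transpose[of r "\<lambda>k l. f l (\<tau> k)"] ldet_transpose[of r f] by simp

lemma ldet_zero_row:
  assumes "i < r" "\<And>l. l < r \<Longrightarrow> f i l = 0"
  shows "ldet r f = 0"
  unfolding ldet_def
proof (intro sum.neutral ballI)
  fix \<sigma> assume "\<sigma> \<in> {\<sigma>. \<sigma> permutes {..<r}}"
  then have "\<sigma> i < r" using assms(1) by (auto simp: permutes_lessThan)
  then have "(\<Prod>k<r. f k (\<sigma> k)) = 0" using assms by (intro prod_zero) auto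
  then show "sgnr \<sigma> * (\<Prod>k<r. f k (\<sigma> k)) = 0" by simp
qed

lemma ldet_mult: "ldet r (\<lambda>k l. \<Sum>n<r. D k n * V n l) = ldet r D * ldet r V"
proof -
  have "Matrix.mat r r (\<lambda>(k, l). \<Sum>n<r. D k n * V n l) = Matrix.mat r r (\<lambda>(k, l). D k l) * Matrix.mat r r (\<lambda>(k, l). V k l)"
    by (rule eq_matI) (auto simp: scalar_prod_def atLeast0LessThan)
  then show ?thesis unfolding ldet_eq_det[symmetric] by (subst det_mult[symmetric]) auto
qed

lemma ldet_lower_triangular:
  assumes "\<And>k l. k < l \<Longrightarrow> l < r \<Longrightarrow> D k l = 0"
  shows "ldet r D = (\<Prod>k<r. D k k)"
proof -
  have "Determinant.det (Matrix.mat r r (\<lambda>(k, l). D k l)) = prod_list (diag_mat (Matrix.mat r r (\<lambda>(k, l). D k l)))"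
    by (rule det_lower_triangular[where n = r]) (use assms in auto)
  then show ?thesis unfolding ldet_eq_det by (simp add: prod_list_diag_prod atLeast0LessThan)
qed

lemma ldet_equal_columns:
  assumes "p < r" "q < r" "p \<noteq> q" "\<And>k. k < r \<Longrightarrow> f k p = f k q"
  shows "ldet r f = 0"
proof -
  let ?t = "Transposition.transpose p q"
  have t: "?t permutes {..<r}" using assms by (intro permutes_swap_id) auto
  have "ldet r (\<lambda>k l. f k (?t l)) = ldet r f"
    by (rule ldet_cong) (use assms in \<open>auto simp: Transposition.transpose_def\<close>)
  then have "ldet r f = sgnr ?t * ldet r f" using ldet_permute_cols[OF t, of f] by simp
  then show ?thesis using assms(3) by (simp add: sgnr_def sign_swap_id)
qed

lemma ldet_scale:
  "ldet r (\<lambda>k l. u k * v l * f k l) = (\<Prod>k<r. u k) * (\<Prod>l<r. v l) * ldet r f"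
proof -
  have "(\<Prod>k<r. u k * v (\<sigma> k) * f k (\<sigma> k)) = (\<Prod>k<r. u k) * (\<Prod>l<r. v l) * (\<Prod>k<r. f k (\<sigma> k))"
    if "\<sigma> permutes {..<r}" for \<sigma>
    using prod.permute[OF that, of v] by (simp add: prod.distrib o_def)
  then show ?thesis by (simp add: ldet_def sum_distrib_left mult_ac)
qed

lemma tendsto_ldet [tendsto_intros]:
  assumes "\<And>k l. ((\<lambda>x. f x k l) \<longlongrightarrow> g k l) F"
  shows "((\<lambda>x. ldet r (f x)) \<longlongrightarrow> ldet r g) F"
  unfolding ldet_def by (intro tendsto_intros assms)

text \<open>The combinatorial core of Andreief's identity: for fixed \<open>\<sigma>\<close> the sum over \<open>\<tau>\<close> is the determinant with rows
permuted by \<open>\<sigma>\<close>, multiplied by the sign of \<open>\<sigma>\<close>.\<close>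

lemma sum_permutation_pairs:
  "(\<Sum>\<sigma> | \<sigma> permutes {..<r}. \<Sum>\<tau> | \<tau> permutes {..<r}. sgnr \<sigma> * sgnr \<tau> * (\<Prod>l<r. b (\<sigma> l) (\<tau> l)))
    = fact r * ldet r b"
proof -
  have "(\<Sum>\<tau> | \<tau> permutes {..<r}. sgnr \<sigma> * sgnr \<tau> * (\<Prod>l<r. b (\<sigma> l) (\<tau> l))) = ldet r b"
    if s: "\<sigma> permutes {..<r}" for \<sigma>
  proof -
    have "(\<Sum>\<tau> | \<tau> permutes {..<r}. sgnr \<sigma> * sgnr \<tau> * (\<Prod>l<r. b (\<sigma> l) (\<tau> l)))
      = sgnr \<sigma> * ldet r (\<lambda>k l. b (\<sigma> k) l)"
      by (simp add: ldet_def sum_distrib_left mult.assoc)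
    then show ?thesis using ldet_permute_rows[OF s, of b] by simp
  qed
  moreover have "card {\<sigma>. \<sigma> permutes {..<r}} = fact r" by (rule card_permutations) auto
  ultimately show ?thesis by simp
qed

lemma permutes_sorting:
  fixes J :: "nat \<Rightarrow> 'a::linorder"
  assumes "inj_on J {..<r}"
  obtains \<tau> where "\<tau> permutes {..<r}" "strict_mono_on {..<r} (J \<circ> \<tau>)"
proof -
  define ys where "ys = sort_key J [0..<r]"
  have len: "length ys = r" and dist: "distinct ys" and set: "set ys = {..<r}"
    by (simp_all add: ys_def atLeast0LessThan)
  define \<tau> where "\<tau> k = (if k < r then ys ! k else k)" for k
  have "bij_betw ((!) ys) {..<r} {..<r}"
    by (rule bij_betw_nth[OF dist]) (simp_all add: len set)
  moreover have "bij_betw \<tau> {..<r} {..<r} = bij_betw ((!) ys) {..<r} {..<r}"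
    by (rule bij_betw_cong) (simp add: \<tau>_def)
  ultimately have "bij_betw \<tau> {..<r} {..<r}" by blast
  then have perm: "\<tau> permutes {..<r}"
    by (rule bij_imp_permutes) (auto simp: \<tau>_def)
  have srt: "sorted (map J ys)" by (simp add: ys_def)
  have "J (\<tau> k) < J (\<tau> l)" if "k < l" "l < r" for k l
  proof -
    have "J (\<tau> k) \<le> J (\<tau> l)" using sorted_nth_mono[OF srt, of k l] that len by (simp add: \<tau>_def)
    moreover have "\<tau> k \<noteq> \<tau> l" using permutes_inj[OF perm] that by (auto dest: injD)
    then have "J (\<tau> k) \<noteq> J (\<tau> l)"
      using assms that permutes_lessThan[OF perm] by (auto simp: inj_on_def)
    ultimately show ?thesis by simp
  qed
  then have "strict_mono_on {..<r} (J \<circ> \<tau>)" by (intro strict_mono_onI) auto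
  with perm show ?thesis by (rule that)
qed

text \<open>Exchanging the two equal entries fixes the tuple and changes the sign.\<close>

lemma alternating_eq_0:
  assumes alt: "\<And>\<tau>. \<tau> permutes {..<r} \<Longrightarrow> x (J \<circ> \<tau>) = sgnr \<tau> * x J"
    and "\<not> inj_on J {..<r}"
  shows "x J = (0::real)"
proof -
  obtain i j where ij: "i < r" "j < r" "i \<noteq> j" "J i = J j" using assms(2) by (auto simp: inj_on_def)
  let ?t = "Transposition.transpose i j"
  have t: "?t permutes {..<r}" using ij by (intro permutes_swap_id) auto
  have "J \<circ> ?t = J" using ij by (auto simp: Transposition.transpose_def)
  then have "x J = sgnr ?t * x J" using alt[OF t] by simp
  also have "sgnr ?t = -1" using ij by (simp add: sgnr_def sign_swap_id)
  finally show ?thesis by simp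
qed

section \<open>Oscillation of eigenvectors of totally positive matrices\<close>

text \<open>Wedge products are represented by alternating functions on all tuples rather than by functions on
\<open>r\<close>-subsets: sums over tuples factor, and the price is only a factor \<open>r!\<close>.\<close>

abbreviation tuples :: "nat \<Rightarrow> nat \<Rightarrow> (nat \<Rightarrow> nat) set" where
  "tuples r n \<equiv> Pi\<^sub>E {..<r} (\<lambda>_. {..<n})"

definition alternating :: "nat \<Rightarrow> ((nat \<Rightarrow> nat) \<Rightarrow> real) \<Rightarrow> bool" where
  "alternating r x \<longleftrightarrow> (\<forall>\<tau> J. \<tau> permutes {..<r} \<longrightarrow> x (J \<circ> \<tau>) = sgnr \<tau> * x J)"

lemma alternatingD: "alternating r x \<Longrightarrow> \<tau> permutes {..<r} \<Longrightarrow> x (J \<circ> \<tau>) = sgnr \<tau> * x J"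
  by (simp add: alternating_def)

lemma finite_tuples [simp]: "finite (tuples r n)"
  by (intro finite_PiE) auto

lemma tuples_compose:
  assumes "\<tau> permutes {..<r}" "J \<in> tuples r n"
  shows "J \<circ> \<tau> \<in> tuples r n"
  using assms permutes_lessThan[OF assms(1)] permutes_not_in[OF assms(1)]
  by (auto simp: PiE_iff extensional_def)

lemma sum_tuples_compose:
  assumes t: "\<tau> permutes {..<r}"
  shows "(\<Sum>J\<in>tuples r n. f (J \<circ> \<tau>)) = (\<Sum>J\<in>tuples r n. f J)"
proof (rule sum.reindex_bij_witness[where i = "\<lambda>J. J \<circ> Hilbert_Choice.inv \<tau>" and j = "\<lambda>J. J \<circ> \<tau>"])
  show "J \<circ> Hilbert_Choice.inv \<tau> \<circ> \<tau> = J" "J \<circ> \<tau> \<circ> Hilbert_Choice.inv \<tau> = J" for J :: "nat \<Rightarrow> nat"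
    using permutes_inv_o[OF t] by (simp_all add: comp_assoc)
  show "J \<circ> Hilbert_Choice.inv \<tau> \<in> tuples r n" "J \<circ> \<tau> \<in> tuples r n" if "J \<in> tuples r n" for J
    using tuples_compose[OF t that] tuples_compose[OF permutes_inv[OF t] that] by auto
qed auto

lemma sum_tuples_prod: "(\<Sum>J\<in>tuples r n. \<Prod>k<r. f k (J k)) = (\<Prod>k<r. \<Sum>j<n. (f k j :: real))"
  by (rule prod_sum_PiE[symmetric]) auto

lemma sum_rotate:
  "(\<Sum>x\<in>A. \<Sum>y\<in>B. \<Sum>z\<in>D. F x y z) = (\<Sum>y\<in>B. \<Sum>z\<in>D. \<Sum>x\<in>A. F x y z)"
proof -
  have "(\<Sum>x\<in>A. \<Sum>y\<in>B. \<Sum>z\<in>D. F x y z) = (\<Sum>y\<in>B. \<Sum>x\<in>A. \<Sum>z\<in>D. F x y z)" by (rule sum.swap)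
  also have "\<dots> = (\<Sum>y\<in>B. \<Sum>z\<in>D. \<Sum>x\<in>A. F x y z)" by (intro sum.cong refl sum.swap)
  finally show ?thesis .
qed

lemma prod_sum_pairs:
  "(\<Sum>I\<in>tuples r n. \<Sum>J\<in>tuples r n. \<Prod>k<r. f k (I k) (J k)) = (\<Prod>k<r. \<Sum>i<n. \<Sum>j<n. (f k i j :: real))"
proof -
  have "(\<Sum>J\<in>tuples r n. \<Prod>k<r. f k (I k) (J k)) = (\<Prod>k<r. \<Sum>j<n. f k (I k) j)" for I
    by (rule sum_tuples_prod)
  then show ?thesis using sum_tuples_prod[where f = "\<lambda>k i. \<Sum>j<n. f k i j"] by simp
qed

text \<open>A form of the Cauchy--Binet formula in which the sum runs over all tuples.\<close>

lemma finite_Andreief: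
  "(\<Sum>J\<in>tuples r n. ldet r (\<lambda>l k. A k (J l)) * ldet r (\<lambda>l k. B k (J l)))
    = fact r * ldet r (\<lambda>k l. \<Sum>j<n. A k j * B l j)"
proof -
  have "(\<Sum>J\<in>tuples r n. ldet r (\<lambda>l k. A k (J l)) * ldet r (\<lambda>l k. B k (J l)))
    = (\<Sum>J\<in>tuples r n. \<Sum>\<sigma> | \<sigma> permutes {..<r}. \<Sum>\<tau> | \<tau> permutes {..<r}.
         sgnr \<sigma> * sgnr \<tau> * (\<Prod>l<r. A (\<sigma> l) (J l) * B (\<tau> l) (J l)))"
    unfolding ldet_def sum_product by (intro sum.cong refl) (simp add: prod.distrib mult_ac)
  also have "\<dots> = (\<Sum>\<sigma> | \<sigma> permutes {..<r}. \<Sum>\<tau> | \<tau> permutes {..<r}. \<Sum>J\<in>tuples r n.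
         sgnr \<sigma> * sgnr \<tau> * (\<Prod>l<r. A (\<sigma> l) (J l) * B (\<tau> l) (J l)))"
    by (rule sum_rotate)
  also have "\<dots> = (\<Sum>\<sigma> | \<sigma> permutes {..<r}. \<Sum>\<tau> | \<tau> permutes {..<r}.
         sgnr \<sigma> * sgnr \<tau> * (\<Prod>l<r. \<Sum>j<n. A (\<sigma> l) j * B (\<tau> l) j))"
    by (simp only: sum_distrib_left[symmetric] sum_tuples_prod[where f = "\<lambda>l j. A (\<sigma> l) j * B (\<tau> l) j" for \<sigma> \<tau>])
  also have "\<dots> = fact r * ldet r (\<lambda>k l. \<Sum>j<n. A k j * B l j)"
    by (rule sum_permutation_pairs)
  finally show ?thesis .
qed

text \<open>Replace the largest index by \<open>card S - 1\<close>, which it cannot be below, and proceed by induction.\<close>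

lemma prod_decseq_inj_le:
  fixes \<delta> :: "nat \<Rightarrow> real"
  assumes "decseq \<delta>" "\<And>k. 0 < \<delta> k" "finite S"
  shows "prod \<delta> S \<le> (\<Prod>k<card S. \<delta> k)"
  using assms(3)
proof (induction "card S" arbitrary: S)
  case (Suc m)
  then have ne: "S \<noteq> {}" and fin: "finite S" by auto
  define M where "M = Max S"
  have M: "M \<in> S" using ne fin by (simp add: M_def)
  have "card S \<le> card {..M}" by (rule card_mono) (auto simp: M_def fin)
  then have "m \<le> M" using Suc.hyps(2) by simp
  have c: "card (S - {M}) = m" using Suc.hyps(2) M fin by simp
  have "prod \<delta> S = \<delta> M * prod \<delta> (S - {M})" using M fin by (rule prod.remove[rotated])
  also have "\<dots> \<le> \<delta> m * (\<Prod>k<m. \<delta> k)"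
    using Suc.hyps(1)[of "S - {M}"] c fin assms(1,2) \<open>m \<le> M\<close>
    by (intro mult_mono) (auto simp: decseqD less_imp_le intro!: prod_nonneg)
  also have "\<dots> = (\<Prod>k<card S. \<delta> k)" by (simp add: Suc.hyps(2)[symmetric] mult.commute)
  finally show ?case .
qed simp

text \<open>Two linear forms on the plane that never have opposite signs are proportional.\<close>

lemma parallel_of_nonneg_products:
  fixes p1 p2 q1 q2 :: real
  assumes "\<And>u v. 0 \<le> (u * p1 + v * p2) * (u * q1 + v * q2)"
  shows "p1 * q2 = p2 * q1"
proof (rule ccontr)
  assume "p1 * q2 \<noteq> p2 * q1"
  \<comment> \<open>If \<open>D \<noteq> 0\<close>, Cramer's rule yields a point where the two forms take the values \<open>1\<close> and \<open>-1\<close>.\<close>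
  define D where "D = p1 * q2 - p2 * q1"
  have D: "D \<noteq> 0" using \<open>p1 * q2 \<noteq> p2 * q1\<close> by (simp add: D_def)
  have "(q2 + p2) / D * p1 + - (q1 + p1) / D * p2 = D / D"
    unfolding add_divide_distrib[symmetric] times_divide_eq_left by (simp add: D_def algebra_simps)
  moreover have "(q2 + p2) / D * q1 + - (q1 + p1) / D * q2 = - D / D"
    unfolding add_divide_distrib[symmetric] times_divide_eq_left by (simp add: D_def algebra_simps)
  ultimately show False using assms[of "(q2 + p2) / D" "- (q1 + p1) / D"] D by simp
qed

text \<open>The data provided by a spectral decomposition of a matrix all of whose minors are positive.\<close>

locale totally_positive_spectrum =
  fixes G :: "nat \<Rightarrow> nat \<Rightarrow> real" and \<delta> :: "nat \<Rightarrow> real" and a :: "nat \<Rightarrow> nat \<Rightarrow> real"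
  assumes pos: "0 < \<delta> k" and dec: "decseq \<delta>"
    and orth: "(\<lambda>n. \<Sum>i<n. a k i * a l i) \<longlonglongrightarrow> (if k = l then 1 else 0)"
    and form: "(\<lambda>n. bilin G n (a k) (a l)) \<longlonglongrightarrow> (if k = l then \<delta> k else 0)"
    and expand: "(\<lambda>N. \<Sum>k<N. \<delta> k * a k i * a k j) \<longlonglongrightarrow> G i j"
    and minor_pos: "strict_mono_on {..<r} I \<Longrightarrow> strict_mono_on {..<r} J \<Longrightarrow> 0 < ldet r (\<lambda>k l. G (I k) (J l))"
begin

text \<open>The bilinear form of the \<open>r\<close>-th tensor power of \<open>G\<close>, restricted to indices below \<open>n\<close>.\<close>

definition tensor_form :: "nat \<Rightarrow> nat \<Rightarrow> ((nat \<Rightarrow> nat) \<Rightarrow> real) \<Rightarrow> ((nat \<Rightarrow> nat) \<Rightarrow> real) \<Rightarrow> real" where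
  "tensor_form r n x y = (\<Sum>I\<in>tuples r n. \<Sum>J\<in>tuples r n. (\<Prod>k<r. G (I k) (J k)) * x I * y J)"

definition tensor_inner :: "nat \<Rightarrow> nat \<Rightarrow> ((nat \<Rightarrow> nat) \<Rightarrow> real) \<Rightarrow> ((nat \<Rightarrow> nat) \<Rightarrow> real) \<Rightarrow> real" where
  "tensor_inner r n x y = (\<Sum>J\<in>tuples r n. x J * y J)"

definition minor :: "nat \<Rightarrow> (nat \<Rightarrow> nat) \<Rightarrow> (nat \<Rightarrow> nat) \<Rightarrow> real" where
  "minor r I J = ldet r (\<lambda>k l. G (I k) (J l))"

text \<open>The sign of the permutation that sorts \<open>J\<close>, and \<open>0\<close> when \<open>J\<close> has a repeated entry. By total positivity it can
be read off from any minor with increasing rows.\<close>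

definition orient :: "nat \<Rightarrow> (nat \<Rightarrow> nat) \<Rightarrow> real" where
  "orient r J = sgn (minor r id J)"

text \<open>The wedge product of the eigenvectors with indices \<open>c 0, \<dots>, c (r - 1)\<close>.\<close>

definition wedge :: "nat \<Rightarrow> (nat \<Rightarrow> nat) \<Rightarrow> (nat \<Rightarrow> nat) \<Rightarrow> real" where
  "wedge r c J = ldet r (\<lambda>l k. a (c k) (J l))"

lemma minor_alternating_right: "alternating r (minor r I)"
  unfolding alternating_def minor_def o_def using ldet_permute_cols[where f = "\<lambda>k l. G (I k) (J l)" for J] by blast

lemma minor_alternating_left: "alternating r (\<lambda>I. minor r I J)"
  unfolding alternating_def minor_def o_def using ldet_permute_rows[where f = "\<lambda>k l. G (I k) (J l)" for I] by blast

lemma wedge_alternating: "alternating r (wedge r c)"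
  unfolding alternating_def wedge_def o_def using ldet_permute_rows[where f = "\<lambda>l k. a (c k) (J l)" for J] by blast

lemma orient_alternating: "alternating r (orient r)"
  unfolding alternating_def
proof (intro allI impI)
  fix \<tau> and J :: "nat \<Rightarrow> nat" assume t: "\<tau> permutes {..<r}"
  show "orient r (J \<circ> \<tau>) = sgnr \<tau> * orient r J"
    using sgnr_cases[of \<tau>] unfolding orient_def alternatingD[OF minor_alternating_right t]
    by (auto simp: sgn_mult)
qed

lemma strict_mono_on_id: "strict_mono_on {..<r} (id :: nat \<Rightarrow> nat)"
  by (simp add: strict_mono_on_def)

lemma orient_sorted: "strict_mono_on {..<r} J \<Longrightarrow> orient r J = 1"
  using minor_pos[OF strict_mono_on_id] by (simp add: orient_def minor_def)

lemma orient_le_1: "(orient r J)\<^sup>2 \<le> 1"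
  by (simp add: orient_def sgn_if)

text \<open>Sorting rows and columns turns every minor without repetitions into one that is positive by assumption.\<close>

lemma oriented_minor: "minor r I J * orient r I * orient r J = \<bar>minor r I J\<bar>"
proof (cases "inj_on I {..<r} \<and> inj_on J {..<r}")
  case False
  then have "minor r I J = 0"
    using alternating_eq_0[of r "minor r I" J] alternating_eq_0[of r "\<lambda>I. minor r I J" I]
      alternatingD[OF minor_alternating_right] alternatingD[OF minor_alternating_left] by blast
  then show ?thesis by simp
next
  case True
  obtain \<sigma> where s: "\<sigma> permutes {..<r}" "strict_mono_on {..<r} (I \<circ> \<sigma>)" using permutes_sorting True by blast
  obtain \<tau> where t: "\<tau> permutes {..<r}" "strict_mono_on {..<r} (J \<circ> \<tau>)" using permutes_sorting True by blast
  have "0 < minor r (I \<circ> \<sigma>) (J \<circ> \<tau>)" unfolding minor_def by (rule minor_pos[OF s(2) t(2)])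
  then have p: "0 < sgnr \<tau> * (sgnr \<sigma> * minor r I J)"
    using alternatingD[OF minor_alternating_left s(1), of I "J \<circ> \<tau>"]
      alternatingD[OF minor_alternating_right t(1), of I J] by (simp add: mult_ac)
  have "1 = sgnr \<sigma> * orient r I" "1 = sgnr \<tau> * orient r J"
    using orient_sorted[OF s(2)] orient_sorted[OF t(2)] alternatingD[OF orient_alternating s(1)]
      alternatingD[OF orient_alternating t(1)] by simp_all
  then have "orient r I = sgnr \<sigma>" "orient r J = sgnr \<tau>"
    using sgnr_cases[of \<sigma>] sgnr_cases[of \<tau>] by auto
  then show ?thesis using p sgnr_cases[of \<sigma>] sgnr_cases[of \<tau>] by auto
qed

text \<open>Against an alternating function the kernel may be antisymmetrised: each permutation of the column indices
contributes the same amount.\<close>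

lemma tensor_form_eq_minors:
  assumes "alternating r y"
  shows "fact r * tensor_form r n x y = (\<Sum>I\<in>tuples r n. \<Sum>J\<in>tuples r n. minor r I J * x I * y J)"
proof -
  have "(\<Sum>J\<in>tuples r n. minor r I J * x I * y J) = fact r * (\<Sum>J\<in>tuples r n. (\<Prod>k<r. G (I k) (J k)) * x I * y J)" for I
  proof -
    \<comment> \<open>Reindexing by \<open>\<sigma>\<close> moves the sign from the kernel to \<open>y\<close>, where it cancels.\<close>
    have s: "(\<Sum>J\<in>tuples r n. sgnr \<sigma> * (\<Prod>k<r. G (I k) (J (\<sigma> k))) * x I * y J)
      = (\<Sum>J\<in>tuples r n. (\<Prod>k<r. G (I k) (J k)) * x I * y J)" if s: "\<sigma> permutes {..<r}" for \<sigma>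
      using sum_tuples_compose[OF s, of "\<lambda>J. (\<Prod>k<r. G (I k) (J k)) * x I * y J" n]
      by (simp add: alternatingD[OF assms s] mult_ac)
    have "(\<Sum>J\<in>tuples r n. minor r I J * x I * y J)
      = (\<Sum>J\<in>tuples r n. \<Sum>\<sigma> | \<sigma> permutes {..<r}. sgnr \<sigma> * (\<Prod>k<r. G (I k) (J (\<sigma> k))) * x I * y J)"
      by (simp add: minor_def ldet_def sum_distrib_right)
    also have "\<dots> = (\<Sum>\<sigma> | \<sigma> permutes {..<r}. \<Sum>J\<in>tuples r n. sgnr \<sigma> * (\<Prod>k<r. G (I k) (J (\<sigma> k))) * x I * y J)"
      by (rule sum.swap)
    also have "\<dots> = (\<Sum>\<sigma> | \<sigma> permutes {..<r}. \<Sum>J\<in>tuples r n. (\<Prod>k<r. G (I k) (J k)) * x I * y J)"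
      by (rule sum.cong[OF refl]) (rule s, simp)
    finally show ?thesis using card_permutations[of "{..<r}" r] by simp
  qed
  then show ?thesis by (simp add: tensor_form_def sum_distrib_left)
qed

text \<open>The coefficient of \<open>x\<close> with respect to the product eigenvector \<open>a (K 0) \<otimes> \<dots> \<otimes> a (K (r - 1))\<close>.\<close>

definition tensor_coeff :: "nat \<Rightarrow> nat \<Rightarrow> ((nat \<Rightarrow> nat) \<Rightarrow> real) \<Rightarrow> (nat \<Rightarrow> nat) \<Rightarrow> real" where
  "tensor_coeff r n x K = (\<Sum>J\<in>tuples r n. (\<Prod>k<r. a (K k) (J k)) * x J)"

lemma tensor_coeff_alternating:
  assumes "alternating r x"
  shows "alternating r (tensor_coeff r n x)"
  unfolding alternating_def
proof (intro allI impI)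
  fix \<tau> K assume t: "\<tau> permutes {..<r}"
  have "tensor_coeff r n x (K \<circ> \<tau>) = (\<Sum>J\<in>tuples r n. (\<Prod>k<r. a (K (\<tau> k)) ((J \<circ> \<tau>) k)) * x (J \<circ> \<tau>))"
    unfolding tensor_coeff_def
    using sum_tuples_compose[OF t, of "\<lambda>J. (\<Prod>k<r. a (K (\<tau> k)) (J k)) * x J" n] by simp
  also have "\<dots> = (\<Sum>J\<in>tuples r n. sgnr \<tau> * ((\<Prod>k<r. a (K k) (J k)) * x J))"
  proof (intro sum.cong refl)
    fix J
    have "(\<Prod>k<r. a (K (\<tau> k)) ((J \<circ> \<tau>) k)) = (\<Prod>k<r. a (K k) (J k))"
      using prod.permute[OF t, of "\<lambda>k. a (K k) (J k)"] by (simp add: o_def)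
    then show "(\<Prod>k<r. a (K (\<tau> k)) ((J \<circ> \<tau>) k)) * x (J \<circ> \<tau>) = sgnr \<tau> * ((\<Prod>k<r. a (K k) (J k)) * x J)"
      by (simp add: alternatingD[OF assms t])
  qed
  finally show "tensor_coeff r n x (K \<circ> \<tau>) = sgnr \<tau> * tensor_coeff r n x K"
    by (simp add: tensor_coeff_def sum_distrib_left)
qed

text \<open>Bessel's inequality for the product eigenvectors. Their orthonormality holds only for infinite sums, so the
nonnegative square is expanded over the indices below \<open>m\<close> and \<open>m\<close> tends to infinity.\<close>

lemma tensor_coeff_Bessel: "(\<Sum>K\<in>tuples r N. (tensor_coeff r n x K)\<^sup>2) \<le> tensor_inner r n x x"
proof -
  define c where "c = tensor_coeff r n x"
  define y where "y J = (if J \<in> tuples r n then x J else 0)" for J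
  define A where "A K J = (\<Prod>k<r. a (K k) (J k))" for K J
  have sub: "tuples r n \<subseteq> tuples r m" if "n \<le> m" for m
    using that by (intro PiE_mono) auto
  have ge: "0 \<le> tensor_inner r n x x - 2 * (\<Sum>K\<in>tuples r N. (c K)\<^sup>2)
     + (\<Sum>K\<in>tuples r N. \<Sum>L\<in>tuples r N. c K * c L * (\<Prod>k<r. \<Sum>j<m. a (K k) j * a (L k) j))" if "n \<le> m" for m
  proof -
    have "0 \<le> (\<Sum>J\<in>tuples r m. (y J - (\<Sum>K\<in>tuples r N. c K * A K J))\<^sup>2)" by (intro sum_nonneg) simp
    also have "\<dots> = (\<Sum>J\<in>tuples r m. (y J)\<^sup>2) - 2 * (\<Sum>J\<in>tuples r m. \<Sum>K\<in>tuples r N. c K * (A K J * y J))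
       + (\<Sum>J\<in>tuples r m. (\<Sum>K\<in>tuples r N. c K * A K J)\<^sup>2)"
      by (simp add: power2_diff sum.distrib sum_subtractf sum_distrib_left mult_ac)
    also have "(\<Sum>J\<in>tuples r m. (y J)\<^sup>2) = tensor_inner r n x x"
      unfolding tensor_inner_def using sub[OF that]
      by (intro sum.mono_neutral_cong_right) (auto simp: y_def power2_eq_square)
    also have "(\<Sum>J\<in>tuples r m. \<Sum>K\<in>tuples r N. c K * (A K J * y J)) = (\<Sum>K\<in>tuples r N. (c K)\<^sup>2)"
    proof (subst sum.swap, intro sum.cong refl)
      fix K
      have "(\<Sum>J\<in>tuples r m. A K J * y J) = c K"
        unfolding c_def tensor_coeff_def A_def[symmetric] using sub[OF that]
        by (intro sum.mono_neutral_cong_right) (auto simp: y_def)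
      then show "(\<Sum>J\<in>tuples r m. c K * (A K J * y J)) = (c K)\<^sup>2"
        by (simp add: sum_distrib_left[symmetric] power2_eq_square)
    qed
    also have "(\<Sum>J\<in>tuples r m. (\<Sum>K\<in>tuples r N. c K * A K J)\<^sup>2)
       = (\<Sum>K\<in>tuples r N. \<Sum>L\<in>tuples r N. c K * c L * (\<Sum>J\<in>tuples r m. A K J * A L J))"
    proof -
      have "(\<Sum>J\<in>tuples r m. (\<Sum>K\<in>tuples r N. c K * A K J)\<^sup>2)
        = (\<Sum>J\<in>tuples r m. \<Sum>K\<in>tuples r N. \<Sum>L\<in>tuples r N. c K * c L * (A K J * A L J))"
        by (simp add: power2_eq_square sum_product mult_ac)
      also have "\<dots> = (\<Sum>K\<in>tuples r N. \<Sum>L\<in>tuples r N. \<Sum>J\<in>tuples r m. c K * c L * (A K J * A L J))"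
        by (rule sum_rotate)
      finally show ?thesis by (simp add: sum_distrib_left)
    qed
    also have "\<dots> = (\<Sum>K\<in>tuples r N. \<Sum>L\<in>tuples r N. c K * c L * (\<Prod>k<r. \<Sum>j<m. a (K k) j * a (L k) j))"
      unfolding A_def prod.distrib[symmetric]
      by (simp only: sum_tuples_prod[where f = "\<lambda>k j. a (K k) j * a (L k) j" for K L])
    finally show ?thesis .
  qed
  have "(\<lambda>m. tensor_inner r n x x - 2 * (\<Sum>K\<in>tuples r N. (c K)\<^sup>2)
     + (\<Sum>K\<in>tuples r N. \<Sum>L\<in>tuples r N. c K * c L * (\<Prod>k<r. \<Sum>j<m. a (K k) j * a (L k) j)))
    \<longlonglongrightarrow> tensor_inner r n x x - 2 * (\<Sum>K\<in>tuples r N. (c K)\<^sup>2)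
     + (\<Sum>K\<in>tuples r N. \<Sum>L\<in>tuples r N. c K * c L * (\<Prod>k<r. if K k = L k then 1 else 0))"
    by (intro tendsto_intros orth)
  then have "0 \<le> tensor_inner r n x x - 2 * (\<Sum>K\<in>tuples r N. (c K)\<^sup>2)
     + (\<Sum>K\<in>tuples r N. \<Sum>L\<in>tuples r N. c K * c L * (\<Prod>k<r. if K k = L k then 1 else 0))"
    using ge by (intro Lim_bounded2[where N = n and C = 0]) auto
  moreover have "(\<Sum>L\<in>tuples r N. c K * c L * (\<Prod>k<r. if K k = L k then 1 else 0)) = (c K)\<^sup>2"
    if K: "K \<in> tuples r N" for K
  proof -
    have "(\<Prod>k<r. if K k = L k then 1 else 0 :: real) = (if L = K then 1 else 0)" if L: "L \<in> tuples r N" for L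
    proof (cases "L = K")
      case False
      then obtain k where "k < r" "K k \<noteq> L k" using PiE_ext[OF L K] by (metis lessThan_iff)
      then have "(\<Prod>k<r. if K k = L k then 1 else 0 :: real) = 0" by (intro prod_zero) auto
      then show ?thesis using False by simp
    qed simp
    then have "(\<Sum>L\<in>tuples r N. c K * c L * (\<Prod>k<r. if K k = L k then 1 else 0))
      = (\<Sum>L\<in>tuples r N. if L = K then c K * c L else 0)" by (intro sum.cong) auto
    then show ?thesis using K by (simp add: power2_eq_square)
  qed
  ultimately show ?thesis unfolding c_def by simp
qed

text \<open>In the basis of product eigenvectors the form is diagonal. The coefficients of an alternating function vanish
unless the indices are distinct, and for distinct indices the eigenvalue is at most \<open>\<delta> 0 \<dots> \<delta> (r - 1)\<close>.\<close>

lemma tensor_form_le: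
  assumes alt: "alternating r x"
  shows "tensor_form r n x x \<le> (\<Prod>k<r. \<delta> k) * tensor_inner r n x x"
proof -
  have "(\<Sum>K\<in>tuples r N. (\<Prod>k<r. \<delta> (K k)) * (tensor_coeff r n x K)\<^sup>2)
    = (\<Sum>I\<in>tuples r n. \<Sum>J\<in>tuples r n. (\<Prod>k<r. \<Sum>m<N. \<delta> m * a m (I k) * a m (J k)) * x I * x J)" for N
  proof -
    have "(\<Prod>k<r. \<delta> (K k)) * (tensor_coeff r n x K)\<^sup>2
      = (\<Sum>I\<in>tuples r n. \<Sum>J\<in>tuples r n. (\<Prod>k<r. \<delta> (K k) * a (K k) (I k) * a (K k) (J k)) * x I * x J)" for K
      unfolding tensor_coeff_def power2_eq_square sum_product unfolding sum_distrib_left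
      by (intro sum.cong refl) (simp add: prod.distrib mult_ac)
    then have "(\<Sum>K\<in>tuples r N. (\<Prod>k<r. \<delta> (K k)) * (tensor_coeff r n x K)\<^sup>2)
      = (\<Sum>I\<in>tuples r n. \<Sum>J\<in>tuples r n. \<Sum>K\<in>tuples r N. (\<Prod>k<r. \<delta> (K k) * a (K k) (I k) * a (K k) (J k)) * x I * x J)"
      by (simp only: sum_rotate[where A = "tuples r N"])
    then show ?thesis
      by (simp add: sum_distrib_right[symmetric] sum_tuples_prod[where f = "\<lambda>k m. \<delta> m * a m (I k) * a m (J k)" for I J])
  qed
  then have "(\<lambda>N. \<Sum>K\<in>tuples r N. (\<Prod>k<r. \<delta> (K k)) * (tensor_coeff r n x K)\<^sup>2) \<longlonglongrightarrow> tensor_form r n x x"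
    unfolding tensor_form_def by (simp, intro tendsto_intros expand)
  moreover have "(\<Sum>K\<in>tuples r N. (\<Prod>k<r. \<delta> (K k)) * (tensor_coeff r n x K)\<^sup>2) \<le> (\<Prod>k<r. \<delta> k) * tensor_inner r n x x" for N
  proof -
    have le: "(\<Prod>k<r. \<delta> (K k)) * (tensor_coeff r n x K)\<^sup>2 \<le> (\<Prod>k<r. \<delta> k) * (tensor_coeff r n x K)\<^sup>2" for K
    proof (cases "inj_on K {..<r}")
      case True
      have "(\<Prod>k<r. \<delta> (K k)) = prod \<delta> (K ` {..<r})" using True by (simp add: prod.reindex)
      also have "\<dots> \<le> (\<Prod>k<r. \<delta> k)"
        using prod_decseq_inj_le[OF dec pos, of "K ` {..<r}"] True by (simp add: card_image)
      finally show ?thesis by (intro mult_right_mono) auto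
    next
      case False
      have "tensor_coeff r n x K = 0"
        using alternating_eq_0[OF _ False, of "tensor_coeff r n x"] alternatingD[OF tensor_coeff_alternating[OF alt]] by blast
      then show ?thesis by simp
    qed
    have "(\<Sum>K\<in>tuples r N. (\<Prod>k<r. \<delta> (K k)) * (tensor_coeff r n x K)\<^sup>2)
      \<le> (\<Prod>k<r. \<delta> k) * (\<Sum>K\<in>tuples r N. (tensor_coeff r n x K)\<^sup>2)"
      unfolding sum_distrib_left by (intro sum_mono le)
    also have "\<dots> \<le> (\<Prod>k<r. \<delta> k) * tensor_inner r n x x"
      using pos by (intro mult_left_mono tensor_coeff_Bessel prod_nonneg) (auto intro: less_imp_le)
    finally show ?thesis .
  qed
  ultimately show ?thesis by (intro Lim_bounded) auto
qed

text \<open>The key step. Replacing \<open>y\<close> by its oriented absolute value does not change the norm and changes the form by a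
sum of the nonnegative terms \<open>T I J\<close>. As \<open>y\<close> already attains the upper bound in the limit, all these terms
vanish; on increasing indices the minor in \<open>T\<close> is positive, which leaves \<open>\<bar>y I\<bar> * \<bar>y J\<bar> \<le> y I * y J\<close>.\<close>

lemma extremal_constant_sign:
  assumes alt: "alternating r y"
    and Q: "(\<lambda>n. tensor_form r n y y) \<longlonglongrightarrow> (\<Prod>k<r. \<delta> k) * Y" and N: "(\<lambda>n. tensor_inner r n y y) \<longlonglongrightarrow> Y"
    and I: "strict_mono_on {..<r} I" "I \<in> tuples r n0" and J: "strict_mono_on {..<r} J" "J \<in> tuples r n0"
  shows "0 \<le> y I * y J"
proof -
  define z where "z J = orient r J * \<bar>y J\<bar>" for J
  define T where "T I J = \<bar>minor r I J\<bar> * (\<bar>y I\<bar> * \<bar>y J\<bar>) - minor r I J * (y I * y J)" for I J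
  have T0: "0 \<le> T I J" for I J
    unfolding T_def using abs_ge_self[of "minor r I J * (y I * y J)"] by (simp add: abs_mult)
  have altz: "alternating r z"
    unfolding alternating_def
  proof (intro allI impI)
    fix \<tau> and J :: "nat \<Rightarrow> nat" assume t: "\<tau> permutes {..<r}"
    show "z (J \<circ> \<tau>) = sgnr \<tau> * z J"
      unfolding z_def alternatingD[OF orient_alternating t] alternatingD[OF alt t]
      using sgnr_cases[of \<tau>] by auto
  qed
  have zn: "tensor_inner r n z z \<le> tensor_inner r n y y" for n
    unfolding tensor_inner_def
  proof (intro sum_mono)
    fix J
    have "z J * z J = (orient r J)\<^sup>2 * (y J * y J)" by (simp add: z_def power2_eq_square mult_ac)
    also have "\<dots> \<le> 1 * (y J * y J)" by (intro mult_right_mono orient_le_1) simp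
    finally show "z J * z J \<le> y J * y J" by simp
  qed
  have bound: "T I J \<le> fact r * ((\<Prod>k<r. \<delta> k) * tensor_inner r n y y - tensor_form r n y y)" if "n \<ge> n0" for n
  proof -
    have sub: "tuples r n0 \<subseteq> tuples r n" using that by (intro PiE_mono) auto
    have Isub: "I \<in> tuples r n" "J \<in> tuples r n" using I J sub by auto
    have "T I J \<le> (\<Sum>J\<in>tuples r n. T I J)"
      using Isub T0 by (intro member_le_sum) auto
    also have "\<dots> \<le> (\<Sum>I\<in>tuples r n. \<Sum>J\<in>tuples r n. T I J)"
      using Isub T0 by (intro member_le_sum[of I _ "\<lambda>I. \<Sum>J\<in>tuples r n. T I J"]) (auto intro: sum_nonneg)
    also have "\<dots> = fact r * tensor_form r n z z - fact r * tensor_form r n y y"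
      unfolding tensor_form_eq_minors[OF altz] tensor_form_eq_minors[OF alt] sum_subtractf[symmetric]
    proof (intro sum.cong refl)
      fix I J
      have "minor r I J * z I * z J = (minor r I J * orient r I * orient r J) * (\<bar>y I\<bar> * \<bar>y J\<bar>)"
        by (simp add: z_def mult_ac)
      then show "T I J = minor r I J * z I * z J - minor r I J * y I * y J"
        unfolding oriented_minor T_def by (simp add: mult_ac)
    qed
    also have "\<dots> \<le> fact r * ((\<Prod>k<r. \<delta> k) * tensor_inner r n y y) - fact r * tensor_form r n y y"
    proof -
      have "tensor_form r n z z \<le> (\<Prod>k<r. \<delta> k) * tensor_inner r n z z" by (rule tensor_form_le[OF altz])
      also have "\<dots> \<le> (\<Prod>k<r. \<delta> k) * tensor_inner r n y y"
        using pos by (intro mult_left_mono zn prod_nonneg) (auto intro: less_imp_le)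
      finally show ?thesis by simp
    qed
    finally show ?thesis by (simp add: right_diff_distrib)
  qed
  have "(\<lambda>n. fact r * ((\<Prod>k<r. \<delta> k) * tensor_inner r n y y - tensor_form r n y y))
    \<longlonglongrightarrow> fact r * ((\<Prod>k<r. \<delta> k) * Y - (\<Prod>k<r. \<delta> k) * Y)"
    by (intro tendsto_intros Q N)
  then have "T I J \<le> fact r * ((\<Prod>k<r. \<delta> k) * Y - (\<Prod>k<r. \<delta> k) * Y)"
    by (rule Lim_bounded2[where N = n0]) (use bound in blast)
  then have "T I J \<le> 0" by simp
  moreover have m: "minor r I J > 0" unfolding minor_def by (rule minor_pos[OF I(1) J(1)])
  ultimately have "minor r I J * (\<bar>y I\<bar> * \<bar>y J\<bar>) \<le> minor r I J * (y I * y J)" by (simp add: T_def)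
  then have "\<bar>y I\<bar> * \<bar>y J\<bar> \<le> y I * y J" using m by simp
  then show ?thesis by (meson abs_ge_zero mult_nonneg_nonneg order_trans)
qed

lemma tensor_inner_wedge:
  "(\<lambda>n. tensor_inner r n (wedge r c) (wedge r c')) \<longlonglongrightarrow> fact r * ldet r (\<lambda>k l. if c k = c' l then 1 else 0)"
proof -
  have "tensor_inner r n (wedge r c) (wedge r c') = fact r * ldet r (\<lambda>k l. \<Sum>j<n. a (c k) j * a (c' l) j)" for n
    unfolding tensor_inner_def wedge_def by (rule finite_Andreief)
  then show ?thesis by (simp, intro tendsto_intros orth)
qed

lemma tensor_form_wedge:
  "(\<lambda>n. tensor_form r n (wedge r c) (wedge r c')) \<longlonglongrightarrow> fact r * ldet r (\<lambda>k l. if c k = c' l then \<delta> (c k) else 0)"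
proof -
  have "tensor_form r n (wedge r c) (wedge r c') = fact r * ldet r (\<lambda>k l. bilin G n (a (c k)) (a (c' l)))" for n
  proof -
    have "tensor_form r n (wedge r c) (wedge r c') = (\<Sum>I\<in>tuples r n. \<Sum>J\<in>tuples r n.
       \<Sum>\<sigma> | \<sigma> permutes {..<r}. \<Sum>\<tau> | \<tau> permutes {..<r}.
         sgnr \<sigma> * sgnr \<tau> * (\<Prod>l<r. a (c (\<sigma> l)) (I l) * G (I l) (J l) * a (c' (\<tau> l)) (J l)))"
      unfolding tensor_form_def wedge_def ldet_def mult.assoc[of "prod _ _"] sum_product unfolding sum_distrib_left
      by (intro sum.cong refl) (simp add: prod.distrib mult_ac)
    also have "\<dots> = (\<Sum>\<sigma> | \<sigma> permutes {..<r}. \<Sum>\<tau> | \<tau> permutes {..<r}. \<Sum>I\<in>tuples r n. \<Sum>J\<in>tuples r n.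
         sgnr \<sigma> * sgnr \<tau> * (\<Prod>l<r. a (c (\<sigma> l)) (I l) * G (I l) (J l) * a (c' (\<tau> l)) (J l)))"
      by (simp only: sum_rotate[where A = "tuples r n"])
    also have "\<dots> = (\<Sum>\<sigma> | \<sigma> permutes {..<r}. \<Sum>\<tau> | \<tau> permutes {..<r}.
         sgnr \<sigma> * sgnr \<tau> * (\<Prod>l<r. bilin G n (a (c (\<sigma> l))) (a (c' (\<tau> l)))))"
      by (simp only: sum_distrib_left[symmetric] bilin_def
        prod_sum_pairs[where f = "\<lambda>l i j. a (c (\<sigma> l)) i * G i j * a (c' (\<tau> l)) j" for \<sigma> \<tau>])
    also have "\<dots> = fact r * ldet r (\<lambda>k l. bilin G n (a (c k)) (a (c' l)))"
      by (rule sum_permutation_pairs)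
    finally show ?thesis .
  qed
  moreover have "(\<lambda>n. bilin G n (a (c k)) (a (c' l))) \<longlonglongrightarrow> (if c k = c' l then \<delta> (c k) else 0)" for k l
    by (rule form)
  ultimately show ?thesis by (simp, intro tendsto_intros)
qed

text \<open>The index sequence \<open>0, \<dots>, m - 1, m + 1\<close>.\<close>

definition replace_last :: "nat \<Rightarrow> nat \<Rightarrow> nat" where
  "replace_last m k = (if k = m then Suc m else k)"

lemma ldet_index_match:
  assumes "inj_on c {..<r}"
  shows "ldet r (\<lambda>k l. if c k = c l then d (c k) else 0) = (\<Prod>k<r. d (c k))"
  using assms by (subst ldet_lower_triangular) (auto simp: inj_on_def)

lemma ldet_index_mismatch:
  "ldet (Suc m) (\<lambda>k l. if id k = replace_last m l then d (id k) else 0) = 0"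
  "ldet (Suc m) (\<lambda>k l. if replace_last m k = id l then d (replace_last m k) else 0) = 0"
proof -
  show "ldet (Suc m) (\<lambda>k l. if replace_last m k = id l then d (replace_last m k) else 0) = 0"
    by (rule ldet_zero_row[of m]) (auto simp: replace_last_def)
  show "ldet (Suc m) (\<lambda>k l. if id k = replace_last m l then d (id k) else 0) = 0"
    by (rule ldet_zero_row[of m]) (auto simp: replace_last_def)
qed

lemma inj_replace_last: "inj_on (replace_last m) {..<Suc m}"
  by (auto simp: inj_on_def replace_last_def)

lemma tensor_inner_linear: "tensor_inner r n (\<lambda>J. u * x J + v * y J) (\<lambda>J. u * x J + v * y J)
   = u\<^sup>2 * tensor_inner r n x x + u * v * tensor_inner r n x y + u * v * tensor_inner r n y x + v\<^sup>2 * tensor_inner r n y y"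
  unfolding tensor_inner_def sum_distrib_left sum.distrib[symmetric]
  by (intro sum.cong refl) (simp add: algebra_simps power2_eq_square)

lemma tensor_form_linear: "tensor_form r n (\<lambda>J. u * x J + v * y J) (\<lambda>J. u * x J + v * y J)
   = u\<^sup>2 * tensor_form r n x x + u * v * tensor_form r n x y + u * v * tensor_form r n y x + v\<^sup>2 * tensor_form r n y y"
  unfolding tensor_form_def sum_distrib_left sum.distrib[symmetric]
  by (intro sum.cong refl) (simp add: algebra_simps power2_eq_square)

text \<open>If \<open>\<delta> (Suc m) = \<delta> m\<close>, all combinations of the two wedges maximise the form, because both have the eigenvalue
\<open>\<delta> 0 \<dots> \<delta> m\<close>. The case \<open>v = 0\<close> concerns the first wedge alone.\<close>

lemma wedge_pair_constant_sign:
  assumes eq: "v = 0 \<or> \<delta> (Suc m) = \<delta> m"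
    and I: "strict_mono_on {..<Suc m} I" and J: "strict_mono_on {..<Suc m} J"
  shows "0 \<le> (u * wedge (Suc m) id I + v * wedge (Suc m) (replace_last m) I)
           * (u * wedge (Suc m) id J + v * wedge (Suc m) (replace_last m) J)"
proof -
  let ?r = "Suc m"
  let ?p = "wedge ?r id" and ?q = "wedge ?r (replace_last m)"
  let ?y = "\<lambda>J. u * ?p J + v * ?q J"
  have alt: "alternating ?r ?y"
    unfolding alternating_def
    by (simp add: alternatingD[OF wedge_alternating] distrib_left mult.left_commute)
  have "(\<lambda>n. tensor_form ?r n ?y ?y) \<longlonglongrightarrow> u\<^sup>2 * (fact ?r * (\<Prod>k<?r. \<delta> (id k))) + u * v * (fact ?r * 0)
     + u * v * (fact ?r * 0) + v\<^sup>2 * (fact ?r * (\<Prod>k<?r. \<delta> (replace_last m k)))"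
    unfolding tensor_form_linear
    using tensor_form_wedge[of ?r id id] tensor_form_wedge[of ?r id "replace_last m"] tensor_form_wedge[of ?r "replace_last m" id]
      tensor_form_wedge[of ?r "replace_last m" "replace_last m"]
    unfolding ldet_index_match[OF inj_on_id] ldet_index_match[OF inj_replace_last] ldet_index_mismatch
    by (intro tendsto_intros)
  moreover have "v\<^sup>2 * (\<Prod>k<?r. \<delta> (replace_last m k)) = v\<^sup>2 * (\<Prod>k<?r. \<delta> k)"
    using eq by (auto simp: replace_last_def)
  then have "u\<^sup>2 * (fact ?r * (\<Prod>k<?r. \<delta> (id k))) + u * v * (fact ?r * 0)
     + u * v * (fact ?r * 0) + v\<^sup>2 * (fact ?r * (\<Prod>k<?r. \<delta> (replace_last m k)))
     = (\<Prod>k<?r. \<delta> k) * ((u\<^sup>2 + v\<^sup>2) * fact ?r)"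
    by (simp add: distrib_left distrib_right mult_ac del: prod.lessThan_Suc fact_Suc)
  ultimately have Q: "(\<lambda>n. tensor_form ?r n ?y ?y) \<longlonglongrightarrow> (\<Prod>k<?r. \<delta> k) * ((u\<^sup>2 + v\<^sup>2) * fact ?r)"
    by simp
  have "(\<lambda>n. tensor_inner ?r n ?y ?y) \<longlonglongrightarrow> u\<^sup>2 * (fact ?r * (\<Prod>k<?r. 1)) + u * v * (fact ?r * 0)
     + u * v * (fact ?r * 0) + v\<^sup>2 * (fact ?r * (\<Prod>k<?r. 1))"
    unfolding tensor_inner_linear
    using tensor_inner_wedge[of ?r id id] tensor_inner_wedge[of ?r id "replace_last m"] tensor_inner_wedge[of ?r "replace_last m" id]
      tensor_inner_wedge[of ?r "replace_last m" "replace_last m"]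
    unfolding ldet_index_match[OF inj_on_id, where d = "\<lambda>_. 1"] ldet_index_match[OF inj_replace_last, where d = "\<lambda>_. 1"]
      ldet_index_mismatch[where d = "\<lambda>_. 1"]
    by (intro tendsto_intros)
  then have N: "(\<lambda>n. tensor_inner ?r n ?y ?y) \<longlonglongrightarrow> (u\<^sup>2 + v\<^sup>2) * fact ?r" by (simp add: algebra_simps)
  \<comment> \<open>Any bound on the entries of \<open>I\<close> and \<open>J\<close> will do.\<close>
  define n0 where "n0 = Suc ((\<Sum>k<?r. I k) + (\<Sum>k<?r. J k))"
  let ?R = "\<lambda>J. restrict J {..<?r}"
  have "?R I \<in> tuples ?r n0" "?R J \<in> tuples ?r n0"
    using member_le_sum[of _ "{..<?r}" I] member_le_sum[of _ "{..<?r}" J]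
    by (force simp: n0_def less_Suc_eq_le simp del: sum.lessThan_Suc)+
  moreover have "strict_mono_on {..<?r} (?R I)" "strict_mono_on {..<?r} (?R J)"
    using I J by (auto simp: strict_mono_on_def)
  ultimately have "0 \<le> ?y (?R I) * ?y (?R J)"
    using extremal_constant_sign[OF alt Q N] by blast
  moreover have "wedge ?r c (?R J) = wedge ?r c J" for c J
    unfolding wedge_def by (rule ldet_cong) auto
  ultimately show ?thesis by simp
qed

text \<open>If two eigenvalues agreed, all combinations of the two wedges would have constant sign, so that the wedges
would be proportional on increasing tuples and hence everywhere; but they are orthogonal and nonzero.\<close>

theorem spectrum_strictly_decreasing: "\<delta> (Suc m) < \<delta> m"
proof (rule ccontr)
  assume "\<not> \<delta> (Suc m) < \<delta> m"
  then have eq: "\<delta> (Suc m) = \<delta> m" using decseq_SucD[OF dec, of m] by simp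
  let ?r = "Suc m"
  let ?p = "wedge ?r id" and ?q = "wedge ?r (replace_last m)"
  have pp: "(\<lambda>n. tensor_inner ?r n ?p ?p) \<longlonglongrightarrow> fact ?r"
    using tensor_inner_wedge[of ?r id id] ldet_index_match[OF inj_on_id, where d = "\<lambda>_. 1" and r = ?r] by simp
  have qq: "(\<lambda>n. tensor_inner ?r n ?q ?q) \<longlonglongrightarrow> fact ?r"
    using tensor_inner_wedge[of ?r "replace_last m" "replace_last m"] ldet_index_match[OF inj_replace_last, where d = "\<lambda>_. 1"] by simp
  have pq: "(\<lambda>n. tensor_inner ?r n ?p ?q) \<longlonglongrightarrow> 0"
    using tensor_inner_wedge[of ?r id "replace_last m"] ldet_index_mismatch(1)[where d = "\<lambda>_. 1"] by simp
  have sortedI: "\<exists>\<tau>. \<tau> permutes {..<?r} \<and> strict_mono_on {..<?r} (K \<circ> \<tau>)"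
    if "wedge ?r c K \<noteq> 0" for c K
  proof -
    have "inj_on K {..<?r}"
      using alternating_eq_0[of ?r "wedge ?r c" K] alternatingD[OF wedge_alternating] that by blast
    then show ?thesis using permutes_sorting by blast
  qed
  have "\<exists>K. ?p K \<noteq> 0"
  proof (rule ccontr)
    assume "\<nexists>K. ?p K \<noteq> 0"
    then have "tensor_inner ?r n ?p ?p = 0" for n by (simp add: tensor_inner_def)
    then show False using pp LIMSEQ_unique[OF pp, of 0] by simp
  qed
  then obtain K where K: "?p K \<noteq> 0" by blast
  then obtain \<tau> where t: "\<tau> permutes {..<?r}" "strict_mono_on {..<?r} (K \<circ> \<tau>)" using sortedI by blast
  define I where "I = K \<circ> \<tau>"
  have I: "strict_mono_on {..<?r} I" "?p I \<noteq> 0"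
    using t K alternatingD[OF wedge_alternating t(1), of id K] sgnr_cases[of \<tau>] by (auto simp: I_def)
  define ratio where "ratio = ?q I / ?p I"
  have sorted_prop: "?q J = ratio * ?p J" if "strict_mono_on {..<?r} J" for J
  proof -
    have "?p I * ?q J = ?q I * ?p J"
      using wedge_pair_constant_sign[OF disjI2[OF eq] I(1) that] by (rule parallel_of_nonneg_products)
    then show ?thesis using I(2) by (simp add: ratio_def field_simps)
  qed
  have proportional: "?q J = ratio * ?p J" for J
  proof (cases "inj_on J {..<?r}")
    case True
    then obtain \<tau> where t: "\<tau> permutes {..<?r}" "strict_mono_on {..<?r} (J \<circ> \<tau>)" using permutes_sorting by blast
    show ?thesis using sorted_prop[OF t(2)] sgnr_cases[of \<tau>]
      by (auto simp: alternatingD[OF wedge_alternating t(1)])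
  next
    case False
    have "wedge ?r c J = 0" for c
      using alternating_eq_0[of ?r "wedge ?r c" J] alternatingD[OF wedge_alternating] False by blast
    then show ?thesis by simp
  qed
  have "tensor_inner ?r n ?p ?q = ratio * tensor_inner ?r n ?p ?p" "tensor_inner ?r n ?q ?q = ratio\<^sup>2 * tensor_inner ?r n ?p ?p" for n
    unfolding tensor_inner_def proportional by (simp_all add: sum_distrib_left mult_ac power2_eq_square)
  then have pq': "(\<lambda>n. tensor_inner ?r n ?p ?q) \<longlonglongrightarrow> ratio * fact ?r"
    and qq': "(\<lambda>n. tensor_inner ?r n ?q ?q) \<longlonglongrightarrow> ratio\<^sup>2 * fact ?r"
    using tendsto_mult_left[OF pp, of ratio] tendsto_mult_left[OF pp, of "ratio\<^sup>2"] by simp_all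
  have "ratio * fact ?r = 0" by (rule LIMSEQ_unique[OF pq' pq])
  then have "ratio = 0" by (simp del: fact_Suc)
  moreover have "ratio\<^sup>2 * fact ?r = fact ?r" by (rule LIMSEQ_unique[OF qq' qq])
  ultimately show False by (simp del: fact_Suc)
qed

theorem wedge_constant_sign:
  obtains s :: real where "s = 1 \<or> s = -1"
    "\<And>J. strict_mono_on {..<r} J \<Longrightarrow> 0 \<le> s * ldet r (\<lambda>k l. a k (J l))"
proof -
  have tr: "ldet r (\<lambda>k l. a k (J l)) = wedge r id J" for J
    unfolding wedge_def using ldet_transpose[of r "\<lambda>k l. a k (J l)"] by simp
  show ?thesis
  proof (cases r)
    case 0
    then show ?thesis using that[of 1] by (simp add: ldet_def sgnr_def)
  next
    case (Suc m)
    have same: "0 \<le> wedge r id I * wedge r id J"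
      if "strict_mono_on {..<r} I" "strict_mono_on {..<r} J" for I J
      using wedge_pair_constant_sign[of 0 m I J 1] that Suc by simp
    show ?thesis
    proof (cases "\<exists>I. strict_mono_on {..<r} I \<and> wedge r id I < 0")
      case True
      then obtain I where I: "strict_mono_on {..<r} I" "wedge r id I < 0" by blast
      have "wedge r id J \<le> 0" if "strict_mono_on {..<r} J" for J
        using same[OF I(1) that] I(2) by (simp add: zero_le_mult_iff)
      then show ?thesis using that[of "-1"] tr by simp
    next
      case False
      then show ?thesis using that[of 1] tr by (simp add: not_less)
    qed
  qed
qed

end

section \<open>Generalized Vandermonde and Gram determinants\<close>

text \<open>A weak form of Descartes' rule of signs. After division by the lowest power, Rolle's theorem gives \<open>r\<close> zeros
of the derivative, which has only \<open>r\<close> terms.\<close>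

lemma sparse_polynomial_few_roots:
  fixes c s :: "nat \<Rightarrow> real" and i :: "nat \<Rightarrow> nat"
  assumes "strict_mono_on {..<r} i" "strict_mono_on {..<r} s" "\<And>l. l < r \<Longrightarrow> 0 < s l"
    and "\<And>l. l < r \<Longrightarrow> (\<Sum>k<r. c k * s l ^ i k) = 0"
    and "k < r"
  shows "c k = 0"
  using assms
proof (induction r arbitrary: c s i k)
  case (Suc r)
  define d where "d k = i k - i 0" for k
  have i: "i k < i l" if "k < l" "l < Suc r" for k l
    using strict_mono_onD[OF Suc.prems(1)] that by simp
  have s: "s k < s l" if "k < l" "l < Suc r" for k l
    using strict_mono_onD[OF Suc.prems(2)] that by simp
  have ik: "i k = i 0 + d k" if "k < Suc r" for k
    using i[of 0 k] that by (cases "k = 0") (auto simp: d_def)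
  have d_pos: "0 < d (Suc k)" if "k < r" for k using i[of 0 "Suc k"] that by (simp add: d_def)
  define g where "g x = (\<Sum>k<Suc r. c k * x ^ d k)" for x
  define g' where "g' x = (\<Sum>k<r. (c (Suc k) * real (d (Suc k))) * x ^ (d (Suc k) - 1))" for x
  have g0: "g (s l) = 0" if "l < Suc r" for l
  proof -
    have "(\<Sum>k<Suc r. c k * s l ^ i k) = s l ^ i 0 * g (s l)"
      unfolding g_def sum_distrib_left
    proof (intro sum.cong refl)
      fix k assume "k \<in> {..<Suc r}"
      then have "s l ^ i k = s l ^ i 0 * s l ^ d k" using ik[of k] by (metis lessThan_iff power_add)
      then show "c k * s l ^ i k = s l ^ i 0 * (c k * s l ^ d k)" by simp
    qed
    then show ?thesis using Suc.prems(3)[OF that] Suc.prems(4)[OF that] by simp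
  qed
  have deriv: "(g has_real_derivative g' x) (at x)" for x
  proof -
    have "(g has_real_derivative (\<Sum>k<Suc r. c k * (real (d k) * x ^ (d k - 1)))) (at x)"
      unfolding g_def by (auto intro!: derivative_eq_intros sum.cong)
    moreover have "(\<Sum>k<Suc r. c k * (real (d k) * x ^ (d k - 1))) = g' x"
      unfolding g'_def sum.lessThan_Suc_shift by (simp add: d_def mult.assoc)
    ultimately show ?thesis by simp
  qed
  have "\<exists>t. s l < t \<and> t < s (Suc l) \<and> g' t = 0" if "l < r" for l
  proof -
    have lt: "s l < s (Suc l)" using s that by simp
    obtain z where "s l < z" "z < s (Suc l)" "g (s (Suc l)) - g (s l) = (s (Suc l) - s l) * g' z"
      using MVT2[OF lt, of g g'] deriv by blast
    then show ?thesis using g0[of l] g0[of "Suc l"] that lt by auto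
  qed
  then obtain t where t: "\<And>l. l < r \<Longrightarrow> s l < t l \<and> t l < s (Suc l) \<and> g' (t l) = 0" by metis
  have tmono: "strict_mono_on {..<r} t"
  proof (intro strict_mono_onI)
    fix k l assume kl: "k \<in> {..<r}" "l \<in> {..<r}" "k < l"
    have "t k < s (Suc k)" using t kl by simp
    also have "s (Suc k) \<le> s l" using s[of "Suc k" l] kl by (cases "Suc k = l") auto
    also have "s l < t l" using t kl by simp
    finally show "t k < t l" .
  qed
  have dmono: "strict_mono_on {..<r} (\<lambda>k. d (Suc k) - 1)"
  proof (intro strict_mono_onI)
    fix k l assume kl: "k \<in> {..<r}" "l \<in> {..<r}" "k < l"
    then have "i 0 < i (Suc k)" "i (Suc k) < i (Suc l)" using i by auto
    then show "d (Suc k) - 1 < d (Suc l) - 1" by (simp add: d_def)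
  qed
  have "c (Suc k) * real (d (Suc k)) = 0" if "k < r" for k
    using Suc.IH[OF dmono tmono, of "\<lambda>k. c (Suc k) * real (d (Suc k))"] t Suc.prems(3) that
    unfolding g'_def by (meson less_SucI order.strict_trans)
  then have cS: "c (Suc k) = 0" if "k < r" for k using d_pos[OF that] that by fastforce
  have "c 0 * s 0 ^ i 0 = 0"
    using Suc.prems(4)[of 0] cS unfolding sum.lessThan_Suc_shift by simp
  then have "c 0 = 0" using Suc.prems(3)[of 0] by simp
  then show ?case using cS Suc.prems(5) by (cases k) auto
qed simp

lemma ldet_expand_last_column:
  "\<exists>C. C r = ldet r f \<and> (\<forall>v. ldet (Suc r) (\<lambda>k l. if l = r then v k else f k l) = (\<Sum>k<Suc r. C k * v k))"
proof -
  let ?A = "\<lambda>v. Matrix.mat (Suc r) (Suc r) (\<lambda>(k, l). if l = r then v k else f k l)"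
  define C where "C k = cofactor (?A (\<lambda>_. 0)) k r" for k
  have C: "cofactor (?A v) k r = C k" if "k < Suc r" for v k
    unfolding C_def cofactor_def
    by (rule arg_cong2[where f = "(*)"], simp, rule arg_cong[where f = Determinant.det], rule eq_matI)
       (auto simp: mat_delete_def that)
  have "ldet (Suc r) (\<lambda>k l. if l = r then v k else f k l) = (\<Sum>k<Suc r. C k * v k)" for v
    unfolding ldet_eq_det[symmetric]
    by (subst laplace_expansion_column[of _ "Suc r" r]) (auto simp: C mult.commute intro!: sum.cong)
  moreover have "C r = ldet r f"
  proof -
    have "mat_delete (?A (\<lambda>_. 0)) r r = Matrix.mat r r (\<lambda>(k, l). f k l)"
      by (rule eq_matI) (auto simp: mat_delete_def)
    then show ?thesis by (simp add: C_def cofactor_def ldet_eq_det)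
  qed
  ultimately show ?thesis by blast
qed

text \<open>As a function of the last argument the determinant is a polynomial with \<open>r + 1\<close> terms, whose leading
coefficient is positive by induction and which vanishes at the \<open>r\<close> smaller arguments. Were it not
positive at the last argument, it would have one more zero beyond, which is one too many.\<close>

theorem generalized_Vandermonde_pos:
  fixes s :: "nat \<Rightarrow> real" and i :: "nat \<Rightarrow> nat"
  assumes "strict_mono_on {..<r} i" "strict_mono_on {..<r} s" "\<And>l. l < r \<Longrightarrow> 0 < s l"
  shows "0 < ldet r (\<lambda>k l. s l ^ i k)"
  using assms
proof (induction r arbitrary: s i)
  case 0
  then show ?case by (simp add: ldet_def sgnr_def)
next
  case (Suc r)
  obtain C where Cr: "C r = ldet r (\<lambda>k l. s l ^ i k)"
    and exp: "\<And>v. ldet (Suc r) (\<lambda>k l. if l = r then v k else s l ^ i k) = (\<Sum>k<Suc r. C k * v k)"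
    using ldet_expand_last_column[of r "\<lambda>k l. s l ^ i k"] by blast
  have Cpos: "0 < C r" unfolding Cr
    using Suc.prems by (intro Suc.IH) (auto simp: strict_mono_on_def)
  define h where "h x = (\<Sum>k<Suc r. C k * x ^ i k)" for x :: real
  have hs: "ldet (Suc r) (\<lambda>k l. s l ^ i k) = h (s r)"
    unfolding h_def exp[symmetric] by (rule ldet_cong) auto
  have roots: "h (s l) = 0" if "l < r" for l
    unfolding h_def exp[symmetric]
    by (rule ldet_equal_columns[of l _ r]) (use that in auto)
  have "0 < h (s r)"
  proof (rule ccontr)
    assume neg: "\<not> 0 < h (s r)"
    \<comment> \<open>For large arguments the leading term dominates, so the polynomial is eventually positive.\<close>
    have lim: "((\<lambda>x. \<Sum>k<Suc r. C k * (x ^ i k / x ^ i r)) \<longlongrightarrow> (\<Sum>k<Suc r. C k * (if k = r then 1 else 0))) at_top"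
    proof (intro tendsto_intros)
      fix k assume k: "k \<in> {..<Suc r}"
      show "((\<lambda>x::real. x ^ i k / x ^ i r) \<longlongrightarrow> (if k = r then 1 else 0)) at_top"
      proof (cases "k = r")
        case True
        have "((\<lambda>x::real. x ^ i k / x ^ i r) \<longlongrightarrow> 1) at_top"
          by (rule tendsto_eventually, rule eventually_mono[OF eventually_gt_at_top[of 0]]) (simp add: True)
        then show ?thesis using True by simp
      next
        case False
        then have "i k < i r" using strict_mono_onD[OF Suc.prems(1), of k r] k by simp
        then obtain m where m: "i r = i k + Suc m" using less_imp_Suc_add[of "i k" "i r"] by auto
        have "((\<lambda>x::real. inverse x ^ Suc m) \<longlongrightarrow> 0 ^ Suc m) at_top"
          by (intro tendsto_intros tendsto_inverse_0_at_top filterlim_ident)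
        then have "((\<lambda>x::real. x ^ i k / x ^ i r) \<longlongrightarrow> 0 ^ Suc m) at_top"
          by (rule Lim_transform_eventually)
             (rule eventually_mono[OF eventually_gt_at_top[of 0]], simp add: m power_add field_simps)
        then show ?thesis using False by simp
      qed
    qed
    have "(\<Sum>k<Suc r. C k * (if k = r then 1 else 0)) = C r" by simp
    with lim have "((\<lambda>x. \<Sum>k<Suc r. C k * (x ^ i k / x ^ i r)) \<longlongrightarrow> C r) at_top" by metis
    from order_tendstoD(1)[OF this Cpos]
    have "eventually (\<lambda>x. 0 < (\<Sum>k<Suc r. C k * (x ^ i k / x ^ i r)) \<and> x > s r \<and> x > 0) at_top"
      by (intro eventually_conj eventually_gt_at_top)
    then obtain x where x: "0 < (\<Sum>k<Suc r. C k * (x ^ i k / x ^ i r))" "x > s r" "x > 0"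
      using eventually_happens'[OF trivial_limit_at_top_linorder] by (metis (no_types, lifting))
    have "(\<Sum>k<Suc r. C k * (x ^ i k / x ^ i r)) = h x / x ^ i r"
      by (simp only: h_def sum_divide_distrib times_divide_eq_right)
    then have hx: "0 < h x" using x by (simp add: zero_less_divide_iff)
    have "continuous_on {s r..x} h" unfolding h_def by (intro continuous_intros)
    then obtain z where z: "s r \<le> z" "z \<le> x" "h z = 0"
      using IVT'[of h "s r" 0 x] neg hx x by auto
    \<comment> \<open>The \<open>r + 1\<close> zeros contradict the bound on the number of zeros.\<close>
    define s' where "s' l = (if l = r then z else s l)" for l
    have "strict_mono_on {..<Suc r} s'"
    proof (intro strict_mono_onI)
      fix k l assume "k \<in> {..<Suc r}" "l \<in> {..<Suc r}" "k < l"
      then show "s' k < s' l"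
        using strict_mono_onD[OF Suc.prems(2), of k l] z(1) by (auto simp: s'_def)
    qed
    moreover have "0 < s' l" if "l < Suc r" for l
      using Suc.prems(3)[of l] Suc.prems(3)[of r] that z(1) by (auto simp: s'_def)
    moreover have "(\<Sum>k<Suc r. C k * s' l ^ i k) = 0" if "l < Suc r" for l
      using roots[of l] z(3) that unfolding s'_def h_def[symmetric] by auto
    ultimately have "C r = 0"
      using sparse_polynomial_few_roots[OF Suc.prems(1), of s' C r] by blast
    then show False using Cpos by simp
  qed
  then show ?case by (simp only: hs)
qed

lemma generalized_Vandermonde_nonneg:
  fixes s :: "nat \<Rightarrow> real" and i :: "nat \<Rightarrow> nat"
  assumes "strict_mono_on {..<r} i" "strict_mono_on {..<r} s" "\<And>l. l < r \<Longrightarrow> 0 \<le> s l"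
  shows "0 \<le> ldet r (\<lambda>k l. s l ^ i k)"
proof -
  have "(\<lambda>n. ldet r (\<lambda>k l. (s l + inverse (real (Suc n))) ^ i k)) \<longlonglongrightarrow> ldet r (\<lambda>k l. (s l + 0) ^ i k)"
    by (intro tendsto_intros LIMSEQ_inverse_real_of_nat)
  moreover have "0 \<le> ldet r (\<lambda>k l. (s l + inverse (real (Suc n))) ^ i k)" for n
    by (intro less_imp_le generalized_Vandermonde_pos assms(1))
       (use assms(2,3) in \<open>auto simp: strict_mono_on_def add_nonneg_pos\<close>)
  ultimately show ?thesis by (intro LIMSEQ_le_const) auto
qed

lemma integral_Andreief:
  fixes M :: "real measure"
  assumes "sigma_finite_measure M" and int: "\<And>k l. integrable M (\<lambda>s. A k s * B l s)"
  shows "integrable (Pi\<^sub>M {..<r} (\<lambda>_. M)) (\<lambda>s. ldet r (\<lambda>l k. A k (s l)) * ldet r (\<lambda>l k. B k (s l)))" (is ?I)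
    and "(\<integral>s. ldet r (\<lambda>l k. A k (s l)) * ldet r (\<lambda>l k. B k (s l)) \<partial>Pi\<^sub>M {..<r} (\<lambda>_. M))
      = fact r * ldet r (\<lambda>k l. \<integral>s. A k s * B l s \<partial>M)" (is ?E)
proof -
  interpret sigma_finite_measure M by fact
  interpret product_sigma_finite "\<lambda>_. M" by standard
  have eq: "ldet r (\<lambda>l k. A k (s l)) * ldet r (\<lambda>l k. B k (s l)) =
     (\<Sum>\<sigma> | \<sigma> permutes {..<r}. \<Sum>\<tau> | \<tau> permutes {..<r}.
         sgnr \<sigma> * sgnr \<tau> * (\<Prod>l<r. A (\<sigma> l) (s l) * B (\<tau> l) (s l)))" for s
    unfolding ldet_def sum_product by (intro sum.cong refl) (simp add: prod.distrib mult_ac)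
  have int2: "integrable (Pi\<^sub>M {..<r} (\<lambda>_. M)) (\<lambda>s. \<Prod>l<r. A (\<sigma> l) (s l) * B (\<tau> l) (s l))" for \<sigma> \<tau>
    by (rule product_integrable_prod) (auto intro: int)
  show ?I unfolding eq by (intro Bochner_Integration.integrable_sum integrable_mult_right int2)
  have "(\<integral>s. (\<Prod>l<r. A (\<sigma> l) (s l) * B (\<tau> l) (s l)) \<partial>Pi\<^sub>M {..<r} (\<lambda>_. M))
     = (\<Prod>l<r. \<integral>s. A (\<sigma> l) s * B (\<tau> l) s \<partial>M)" for \<sigma> \<tau>
    by (rule product_integral_prod) (auto intro: int)
  then show ?E
    unfolding eq
    by (simp add: Bochner_Integration.integral_sum int2 integrable_mult_right sum_permutation_pairs[symmetric])
qed

text \<open>By Andreief's identity a Gram minor is the integral of a product of two determinants over all \<open>r\<close>-tuples. Both determinants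
change sign together when the arguments are permuted, so the product is nonnegative, and it is
positive on increasing tuples, which have positive measure.\<close>

theorem gram_minor_pos:
  fixes M :: "real measure" and e :: "nat \<Rightarrow> real \<Rightarrow> real"
  assumes "sigma_finite_measure M" and sets: "sets M = sets borel"
    and AEpos: "AE s in M. 0 < s"
    and charge: "\<And>l::nat. 0 < emeasure M {real l<..<real l + 1}"
    and meas: "\<And>i. e i \<in> borel_measurable M"
    and int: "\<And>i j. integrable M (\<lambda>s. e i s * e j s)"
    and tp: "\<And>r I s. strict_mono_on {..<r} I \<Longrightarrow> strict_mono_on {..<r} s \<Longrightarrow> (\<And>l. l < r \<Longrightarrow> 0 < s l)
        \<Longrightarrow> 0 < ldet r (\<lambda>k l. e (I k) (s l))"
    and I: "strict_mono_on {..<r} I" and J: "strict_mono_on {..<r} J"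
  shows "0 < ldet r (\<lambda>k l. \<integral>s. e (I k) s * e (J l) s \<partial>M)"
proof -
  interpret sigma_finite_measure M by fact
  interpret product_sigma_finite "\<lambda>_. M" by standard
  \<comment> \<open>The cut-off makes the determinants vanish, rather than being of unknown sign, outside the positive orthant.\<close>
  define e' where "e' i s = (if 0 < s then e i s else 0)" for i s
  have e'AE: "AE s in M. e' i s * e' j s = e i s * e j s" for i j
    using AEpos by eventually_elim (simp add: e'_def)
  have m': "e' i \<in> borel_measurable M" for i
    unfolding e'_def using meas sets by measurable
  have int': "integrable M (\<lambda>s. e' i s * e' j s)" for i j
  proof (rule integrable_cong_AE_imp[OF int[of i j]])
    show "(\<lambda>s. e' i s * e' j s) \<in> borel_measurable M" using m' by measurable
    show "AE s in M. e i s * e j s = e' i s * e' j s" using e'AE[of i j] by eventually_elim simp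
  qed
  let ?P = "Pi\<^sub>M {..<r} (\<lambda>_. M)"
  define F where "F s = ldet r (\<lambda>l k. e' (I k) (s l)) * ldet r (\<lambda>l k. e' (J k) (s l))" for s
  have Fint: "integrable ?P F" and Fval: "integral\<^sup>L ?P F = fact r * ldet r (\<lambda>k l. \<integral>s. e' (I k) s * e' (J l) s \<partial>M)"
    unfolding F_def using integral_Andreief[OF \<open>sigma_finite_measure M\<close> int', of r I J] by simp_all
  have F_sorted: "0 < F s" if "strict_mono_on {..<r} s" "\<And>l. l < r \<Longrightarrow> 0 < s l" for s
  proof -
    have "ldet r (\<lambda>l k. e' (I k) (s l)) = ldet r (\<lambda>k l. e (I k) (s l))" for I
      using that ldet_transpose[of r "\<lambda>k l. e (I k) (s l)"] by (simp add: e'_def cong: ldet_cong)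
    then show ?thesis unfolding F_def using tp[OF I that] tp[OF J that] by simp
  qed
  have F0: "0 \<le> F s" for s
  proof (cases "inj_on s {..<r} \<and> (\<forall>l<r. 0 < s l)")
    case True
    then obtain \<tau> where t: "\<tau> permutes {..<r}" "strict_mono_on {..<r} (s \<circ> \<tau>)" using permutes_sorting by blast
    have "F (s \<circ> \<tau>) = F s"
      unfolding F_def o_def
      using ldet_permute_rows[OF t(1), where f = "\<lambda>l k. e' (I k) (s l)"]
        ldet_permute_rows[OF t(1), where f = "\<lambda>l k. e' (J k) (s l)"] by simp
    moreover have "0 < F (s \<circ> \<tau>)"
      by (rule F_sorted[OF t(2)]) (use True permutes_lessThan[OF t(1)] in auto)
    ultimately show ?thesis by simp
  next
    case False
    have "ldet r (\<lambda>l k. e' (I k) (s l)) = 0"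
    proof (cases "\<forall>l<r. 0 < s l")
      case True
      then obtain p q where "p < r" "q < r" "p \<noteq> q" "s p = s q" using False by (auto simp: inj_on_def)
      then have "ldet r (\<lambda>k l. e' (I k) (s l)) = 0" by (intro ldet_equal_columns[of p r q]) auto
      then show ?thesis using ldet_transpose[of r "\<lambda>k l. e' (I k) (s l)"] by simp
    next
      case False
      then show ?thesis by (auto simp: e'_def intro!: ldet_zero_row)
    qed
    then show ?thesis by (simp add: F_def)
  qed
  have "integral\<^sup>L ?P F \<noteq> 0"
  proof
    assume "integral\<^sup>L ?P F = 0"
    then have AE0: "AE s in ?P. F s = 0"
      using integral_nonneg_eq_0_iff_AE[OF Fint] F0 by auto
    \<comment> \<open>A box of positive measure that contains only increasing tuples.\<close>
    define Q where "Q = Pi\<^sub>E {..<r} (\<lambda>l. {real l<..<real l + 1})"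
    have Qs: "Q \<in> sets ?P" unfolding Q_def using sets by (intro sets_PiM_I_finite) auto
    have "F s \<noteq> 0" if "s \<in> Q" for s
    proof -
      have b: "real l < s l" "s l < real l + 1" if "l < r" for l
        using \<open>s \<in> Q\<close> that by (auto simp: Q_def PiE_iff)
      have "strict_mono_on {..<r} s"
      proof (intro strict_mono_onI)
        fix k l assume kl: "k \<in> {..<r}" "l \<in> {..<r}" "k < l"
        then have "real k + 1 \<le> real l" by simp
        then show "s k < s l" using b[of k] b[of l] kl by simp
      qed
      moreover have "0 < s l" if "l < r" for l using b[OF that] by (meson of_nat_0_le_iff order_le_less_trans)
      ultimately show ?thesis using F_sorted[of s] by simp
    qed
    then have "AE s in ?P. s \<notin> Q" using AE0 by (auto elim!: eventually_mono)
    then have "emeasure ?P Q = 0" using AE_iff_measurable[OF Qs, of "\<lambda>s. s \<notin> Q"] sets.sets_into_space[OF Qs] by auto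
    moreover have "emeasure ?P Q = (\<Prod>l<r. emeasure M {real l<..<real l + 1})"
      unfolding Q_def using sets by (intro emeasure_PiM) auto
    ultimately have "\<exists>l<r. emeasure M {real l<..<real l + 1} = 0" by auto
    then show False using charge by (metis less_irrefl)
  qed
  moreover have "0 \<le> integral\<^sup>L ?P F" using F0 by simp
  ultimately have "0 < integral\<^sup>L ?P F" by simp
  then have "0 < fact r * ldet r (\<lambda>k l. \<integral>s. e' (I k) s * e' (J l) s \<partial>M)" by (simp only: Fval)
  moreover have "(\<integral>s. e' i s * e' j s \<partial>M) = (\<integral>s. e i s * e j s \<partial>M)" for i j
    by (rule integral_cong_AE) (use m' meas e'AE in auto)
  ultimately show ?thesis by (simp add: zero_less_mult_iff)
qed

section \<open>Integral operators with a feature expansion\<close>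

lemma L2_measurable: "f \<in> L2 M \<Longrightarrow> f \<in> borel_measurable M"
  by (simp add: L2_def)

lemma L2_mult_integrable:
  assumes "f \<in> L2 M" "h \<in> L2 M"
  shows "integrable M (\<lambda>x. f x * h x)"
proof (rule Bochner_Integration.integrable_bound)
  show "integrable M (\<lambda>x. (cmod (f x))\<^sup>2 + (cmod (h x))\<^sup>2)"
    using assms by (simp add: L2_def)
  show "(\<lambda>x. f x * h x) \<in> borel_measurable M" using assms[THEN L2_measurable] by measurable
  have "cmod (f x * h x) \<le> (cmod (f x))\<^sup>2 + (cmod (h x))\<^sup>2" for x
    using sum_squares_bound[of "cmod (f x)" "cmod (h x)"] mult_nonneg_nonneg[of "cmod (f x)" "cmod (h x)"]
    unfolding norm_mult by (simp add: mult.assoc del: mult_nonneg_nonneg)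
  then show "AE x in M. norm (f x * h x) \<le> norm ((cmod (f x))\<^sup>2 + (cmod (h x))\<^sup>2)"
    by (intro AE_I2) (simp only: real_norm_def, simp)
qed

lemma L2_add:
  assumes "f \<in> L2 M" "h \<in> L2 M"
  shows "(\<lambda>x. f x + h x) \<in> L2 M"
proof -
  have "integrable M (\<lambda>x. (cmod (f x + h x))\<^sup>2)"
  proof (rule Bochner_Integration.integrable_bound)
    show "integrable M (\<lambda>x. 2 * (cmod (f x))\<^sup>2 + 2 * (cmod (h x))\<^sup>2)"
      using assms by (simp add: L2_def)
    show "(\<lambda>x. (cmod (f x + h x))\<^sup>2) \<in> borel_measurable M" using assms[THEN L2_measurable] by measurable
    have "(cmod (f x + h x))\<^sup>2 \<le> 2 * (cmod (f x))\<^sup>2 + 2 * (cmod (h x))\<^sup>2" for x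
    proof -
      have "(cmod (f x + h x))\<^sup>2 \<le> (cmod (f x) + cmod (h x))\<^sup>2"
        by (intro power_mono norm_triangle_ineq) simp
      also have "\<dots> \<le> 2 * (cmod (f x))\<^sup>2 + 2 * (cmod (h x))\<^sup>2"
        using sum_squares_bound[of "cmod (f x)" "cmod (h x)"] by (simp add: power2_sum)
      finally show ?thesis .
    qed
    then show "AE x in M. norm ((cmod (f x + h x))\<^sup>2) \<le> norm (2 * (cmod (f x))\<^sup>2 + 2 * (cmod (h x))\<^sup>2)"
      by (intro AE_I2) simp
  qed
  moreover have "(\<lambda>x. f x + h x) \<in> borel_measurable M" using assms[THEN L2_measurable] by measurable
  ultimately show ?thesis by (simp add: L2_def)
qed

lemma L2_cmult: "f \<in> L2 M \<Longrightarrow> (\<lambda>x. c * f x) \<in> L2 M"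
  by (auto simp: L2_def norm_mult power_mult_distrib)

lemma L2_diff: "f \<in> L2 M \<Longrightarrow> h \<in> L2 M \<Longrightarrow> (\<lambda>x. f x - h x) \<in> L2 M"
  using L2_add[of f M "\<lambda>x. (-1) * h x"] L2_cmult[of h M "-1"] by simp

lemma L2_cnj: "f \<in> L2 M \<Longrightarrow> (\<lambda>x. cnj (f x)) \<in> L2 M"
  by (auto simp: L2_def intro: borel_measurable_continuous_onI continuous_intros
      measurable_compose[OF _ borel_measurable_continuous_onI])

lemma L2_of_real:
  fixes p :: "'a \<Rightarrow> real"
  assumes "p \<in> borel_measurable M" "integrable M (\<lambda>x. (p x)\<^sup>2)"
  shows "(\<lambda>x. complex_of_real (p x)) \<in> L2 M"
  using assms by (simp add: L2_def)

lemma L2_cong_AE: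
  assumes "f \<in> L2 M" "g \<in> borel_measurable M" "AE x in M. f x = g x"
  shows "g \<in> L2 M"
proof -
  have "integrable M (\<lambda>x. (cmod (g x))\<^sup>2)"
  proof (rule integrable_cong_AE_imp)
    show "integrable M (\<lambda>x. (cmod (f x))\<^sup>2)" using assms by (simp add: L2_def)
    show "(\<lambda>x. (cmod (g x))\<^sup>2) \<in> borel_measurable M" using assms(2) by measurable
    show "AE x in M. (cmod (f x))\<^sup>2 = (cmod (g x))\<^sup>2" using assms(3) by eventually_elim simp
  qed
  then show ?thesis using assms(2) by (simp add: L2_def)
qed

lemma L2_zero: "(\<lambda>_. 0) \<in> L2 M"
  by (simp add: L2_def)

lemma L2_sum: "(\<And>n. n \<in> A \<Longrightarrow> f n \<in> L2 M) \<Longrightarrow> (\<lambda>t. \<Sum>n\<in>A. c n * f n t) \<in> L2 M"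
proof (induction A rule: infinite_finite_induct)
  case (insert n A)
  then have "(\<lambda>t. c n * f n t + (\<Sum>n\<in>A. c n * f n t)) \<in> L2 M" by (intro L2_add L2_cmult) auto
  then show ?case using insert by simp
qed (simp_all add: L2_zero)

lemma integral_mult_cnj:
  fixes f :: "'a \<Rightarrow> complex"
  shows "(LINT x|M. f x * cnj (f x)) = complex_of_real (LINT x|M. (cmod (f x))\<^sup>2)"
  by (subst integral_complex_of_real[symmetric]) (simp add: complex_norm_square[symmetric])

lemma integral_cmod_square_eq_0:
  assumes "f \<in> L2 M" "(LINT x|M. (cmod (f x))\<^sup>2) = 0"
  shows "AE x in M. f x = 0"
proof -
  have "AE x in M. (cmod (f x))\<^sup>2 = 0"
    using assms integral_nonneg_eq_0_iff_AE[of M "\<lambda>x. (cmod (f x))\<^sup>2"] by (auto simp: L2_def)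
  then show ?thesis by eventually_elim simp
qed

text \<open>The square-integrable weight \<open>W\<close> provides the dominating functions for all interchanges of sum and integral.
Completeness means that the moments determine an element of \<open>L2\<close>.\<close>

locale feature_kernel =
  fixes M :: "real measure" and e :: "nat \<Rightarrow> real \<Rightarrow> real" and k :: "real \<Rightarrow> real \<Rightarrow> real"
    and W :: "real \<Rightarrow> real" and q :: real
  assumes M_nonneg: "AE s in M. 0 \<le> s"
    and q: "0 < q" "q < 1"
    and e_meas: "e i \<in> borel_measurable M"
    and W_meas: "W \<in> borel_measurable M"
    and W_int: "integrable M (\<lambda>s. (W s)\<^sup>2)"
    and k_meas: "k s \<in> borel_measurable M"
    and e_le: "0 \<le> s \<Longrightarrow> \<bar>e i s\<bar> \<le> q ^ i * W s"
    and kernel_sums: "0 \<le> s \<Longrightarrow> 0 \<le> t \<Longrightarrow> (\<lambda>i. e i s * e i t) sums k s t"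
    and complete: "f \<in> L2 M \<Longrightarrow> (\<And>i. (LINT t|M. complex_of_real (e i t) * f t) = 0) \<Longrightarrow> AE t in M. f t = 0"
begin

abbreviation T :: "(real \<Rightarrow> complex) \<Rightarrow> real \<Rightarrow> complex" where
  "T \<equiv> integral_op M k"

definition moment :: "(real \<Rightarrow> complex) \<Rightarrow> nat \<Rightarrow> complex" where
  "moment f i = (LINT t|M. complex_of_real (e i t) * f t)"

lemma W_nonneg: "0 \<le> s \<Longrightarrow> 0 \<le> W s"
  using e_le[of s 0] by simp

lemma W_L2: "(\<lambda>s. complex_of_real (W s)) \<in> L2 M"
  using W_meas W_int by (rule L2_of_real)

lemma e_L2: "(\<lambda>s. complex_of_real (e i s)) \<in> L2 M"
proof (rule L2_of_real)
  show "e i \<in> borel_measurable M" by (rule e_meas)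
  show "integrable M (\<lambda>s. (e i s)\<^sup>2)"
  proof (rule Bochner_Integration.integrable_bound[OF W_int])
    show "(\<lambda>s. (e i s)\<^sup>2) \<in> borel_measurable M" using e_meas by simp
    show "AE s in M. norm ((e i s)\<^sup>2) \<le> norm ((W s)\<^sup>2)"
      using M_nonneg
    proof eventually_elim
      case (elim s)
      have "q ^ i * W s \<le> 1 * W s" using q W_nonneg[OF elim] by (intro mult_right_mono) (auto simp: power_le_one)
      then have "\<bar>e i s\<bar> \<le> W s" using e_le[OF elim, of i] by simp
      then have "\<bar>e i s\<bar>\<^sup>2 \<le> (W s)\<^sup>2" by (intro power_mono) auto
      then show ?case by simp
    qed
  qed
qed

definition weighted_mass :: "(real \<Rightarrow> complex) \<Rightarrow> real" where
  "weighted_mass f = (LINT t|M. \<bar>W t\<bar> * cmod (f t))"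

lemma W_mult_integrable: "f \<in> L2 M \<Longrightarrow> integrable M (\<lambda>t. \<bar>W t\<bar> * cmod (f t))"
  using integrable_norm[OF L2_mult_integrable[OF W_L2, of f]] by (simp add: norm_mult)

lemma e_mult_integrable: "f \<in> L2 M \<Longrightarrow> integrable M (\<lambda>t. complex_of_real (e i t) * f t)"
  by (rule L2_mult_integrable[OF e_L2])

lemma norm_e_mult_le:
  assumes "f \<in> L2 M"
  shows "(LINT t|M. norm (complex_of_real (e i t) * f t)) \<le> q ^ i * weighted_mass f"
proof -
  have "(LINT t|M. norm (complex_of_real (e i t) * f t)) \<le> (LINT t|M. q ^ i * (\<bar>W t\<bar> * cmod (f t)))"
  proof (rule integral_mono_AE)
    show "integrable M (\<lambda>t. norm (complex_of_real (e i t) * f t))"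
      using e_mult_integrable[OF assms] by (rule integrable_norm)
    show "integrable M (\<lambda>t. q ^ i * (\<bar>W t\<bar> * cmod (f t)))"
      using W_mult_integrable[OF assms] by (rule integrable_mult_right)
    show "AE t in M. norm (complex_of_real (e i t) * f t) \<le> q ^ i * (\<bar>W t\<bar> * cmod (f t))"
      using M_nonneg
    proof eventually_elim
      case (elim t)
      show ?case using mult_right_mono[OF e_le[OF elim, of i] norm_ge_zero[of "f t"]] W_nonneg[OF elim]
        by (simp add: norm_mult mult.assoc)
    qed
  qed
  then show ?thesis by (simp add: weighted_mass_def)
qed

lemma moment_le: "f \<in> L2 M \<Longrightarrow> cmod (moment f i) \<le> weighted_mass f * q ^ i"
  unfolding moment_def using order_trans[OF integral_norm_bound norm_e_mult_le[of f i]] by (simp add: mult.commute)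

definition expansion :: "(nat \<Rightarrow> complex) \<Rightarrow> real \<Rightarrow> complex" where
  "expansion x s = (\<Sum>i. x i * complex_of_real (e i s))"

lemma expansion_term_le:
  assumes x: "\<And>i. cmod (x i) \<le> B * q ^ i" and s: "0 \<le> s"
  shows "cmod (x i * complex_of_real (e i s)) \<le> B * W s * q ^ i"
proof -
  have B: "0 \<le> B" using order_trans[OF norm_ge_zero x[of 0]] by simp
  have "cmod (x i) * \<bar>e i s\<bar> \<le> (B * q ^ i) * (1 * W s)"
  proof (rule mult_mono[OF x])
    have "q ^ i * W s \<le> 1 * W s" using q W_nonneg[OF s] by (intro mult_right_mono) (auto simp: power_le_one)
    then show "\<bar>e i s\<bar> \<le> 1 * W s" using e_le[OF s, of i] by simp
  qed (use B q in auto)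
  then show ?thesis by (simp add: norm_mult mult_ac)
qed

lemma geometric_summable: "summable (\<lambda>i. c * q ^ i)"
  using q by (intro summable_mult summable_geometric) auto

lemma expansion_summable:
  assumes "\<And>i. cmod (x i) \<le> B * q ^ i" "0 \<le> s"
  shows "summable (\<lambda>i. norm (x i * complex_of_real (e i s)))"
  by (rule summable_comparison_test'[OF geometric_summable[of "B * W s"]]) (use expansion_term_le[OF assms] in simp)

lemma expansion_sums:
  assumes "\<And>i. cmod (x i) \<le> B * q ^ i" "0 \<le> s"
  shows "(\<lambda>i. x i * complex_of_real (e i s)) sums expansion x s"
  unfolding expansion_def using expansion_summable[OF assms] by (intro summable_sums) (rule summable_norm_cancel)

lemma expansion_L2:
  assumes "\<And>i. cmod (x i) \<le> B * q ^ i"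
  shows "expansion x \<in> L2 M"
proof -
  have m: "expansion x \<in> borel_measurable M" unfolding expansion_def using e_meas by measurable
  have "integrable M (\<lambda>s. (cmod (expansion x s))\<^sup>2)"
  proof (rule Bochner_Integration.integrable_bound)
    show "integrable M (\<lambda>s. (B / (1 - q))\<^sup>2 * (W s)\<^sup>2)" using W_int by simp
    show "(\<lambda>s. (cmod (expansion x s))\<^sup>2) \<in> borel_measurable M" using m by simp
    show "AE s in M. norm ((cmod (expansion x s))\<^sup>2) \<le> norm ((B / (1 - q))\<^sup>2 * (W s)\<^sup>2)"
      using M_nonneg
    proof eventually_elim
      case (elim s)
      have "cmod (expansion x s) \<le> (\<Sum>i. B * W s * q ^ i)"
        unfolding expansion_def by (rule norm_suminf_le[OF expansion_term_le[OF assms elim] geometric_summable])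
      also have "\<dots> = B / (1 - q) * W s"
        using q by (subst suminf_mult) (auto simp: suminf_geometric summable_geometric)
      finally have "(cmod (expansion x s))\<^sup>2 \<le> (B / (1 - q) * W s)\<^sup>2" by (intro power_mono) auto
      then show ?case by (simp only: power_mult_distrib real_norm_def abs_of_nonneg zero_le_power2 mult_nonneg_nonneg)
    qed
  qed
  then show ?thesis using m by (simp add: L2_def)
qed

lemma integral_expansion:
  assumes x: "\<And>i. cmod (x i) \<le> B * q ^ i" and h: "h \<in> L2 M"
  shows "(\<lambda>i. x i * moment h i) sums (LINT s|M. expansion x s * h s)"
proof -
  let ?f = "\<lambda>i s. x i * (complex_of_real (e i s) * h s)"
  have B: "0 \<le> B" using order_trans[OF norm_ge_zero x[of 0]] by simp
  have int: "integrable M (?f i)" for i by (intro integrable_mult_right e_mult_integrable h)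
  have sumb: "AE s in M. summable (\<lambda>i. norm (?f i s))"
    using M_nonneg
  proof eventually_elim
    case (elim s)
    show ?case using summable_mult2[OF expansion_summable[OF x elim], of "cmod (h s)"] by (simp add: norm_mult mult.assoc)
  qed
  have sumi: "summable (\<lambda>i. LINT s|M. norm (?f i s))"
  proof (rule summable_comparison_test'[OF geometric_summable[of "B * weighted_mass h"]])
    fix i
    have "(LINT s|M. norm (?f i s)) = cmod (x i) * (LINT s|M. norm (complex_of_real (e i s) * h s))"
      by (simp add: norm_mult)
    also have "\<dots> \<le> (B * 1) * (q ^ i * weighted_mass h)"
    proof (intro mult_mono norm_e_mult_le h)
      have "B * q ^ i \<le> B * 1" using B q by (intro mult_left_mono) (auto simp: power_le_one)
      then show "cmod (x i) \<le> B * 1" using x[of i] by linarith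
    qed (use B in auto)
    finally show "norm (LINT s|M. norm (?f i s)) \<le> B * weighted_mass h * q ^ i" by (simp add: mult_ac)
  qed
  have "(\<lambda>i. integral\<^sup>L M (?f i)) sums (LINT s|M. (\<Sum>i. ?f i s))"
    using int sumb sumi by (rule sums_integral)
  also have "(LINT s|M. (\<Sum>i. ?f i s)) = (LINT s|M. expansion x s * h s)"
  proof (rule integral_cong_AE)
    show "(\<lambda>s. \<Sum>i. ?f i s) \<in> borel_measurable M" using e_meas L2_measurable[OF h] by measurable
    show "(\<lambda>s. expansion x s * h s) \<in> borel_measurable M"
      using L2_measurable[OF expansion_L2[OF x]] L2_measurable[OF h] by measurable
    show "AE s in M. (\<Sum>i. ?f i s) = expansion x s * h s"
      using M_nonneg
    proof eventually_elim
      case (elim s)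
      show ?case using sums_unique[OF sums_mult2[OF expansion_sums[OF x elim], of "h s"]] by (simp add: mult.assoc)
    qed
  qed
  finally show ?thesis by (simp add: moment_def)
qed

text \<open>The operator factors through the sequence of moments.\<close>

lemma T_eq_expansion:
  assumes f: "f \<in> L2 M" and s: "0 \<le> s"
  shows "T f s = expansion (moment f) s"
proof -
  have "cmod (complex_of_real (e i s)) \<le> W s * q ^ i" for i
    using e_le[OF s, of i] by (simp add: mult.commute)
  from integral_expansion[OF this f] have "(\<lambda>i. complex_of_real (e i s) * moment f i) sums
      (LINT t|M. expansion (\<lambda>i. complex_of_real (e i s)) t * f t)" .
  also have "(LINT t|M. expansion (\<lambda>i. complex_of_real (e i s)) t * f t) = T f s"
    unfolding integral_op_def
  proof (rule integral_cong_AE)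
    have sy: "AE t in M. expansion (\<lambda>i. complex_of_real (e i s)) t = complex_of_real (k s t)"
      using M_nonneg
    proof eventually_elim
      case (elim t)
      show ?case unfolding expansion_def
        using sums_unique[OF sums_of_real[OF kernel_sums[OF s elim], where 'a = complex]] by simp
    qed
    then show "AE t in M. expansion (\<lambda>i. complex_of_real (e i s)) t * f t = complex_of_real (k s t) * f t"
      by eventually_elim simp
    show "(\<lambda>t. expansion (\<lambda>i. complex_of_real (e i s)) t * f t) \<in> borel_measurable M"
      using e_meas L2_measurable[OF f] unfolding expansion_def by measurable
    show "(\<lambda>t. complex_of_real (k s t) * f t) \<in> borel_measurable M"
      using k_meas[of s] L2_measurable[OF f] by measurable
  qed
  finally show ?thesis unfolding expansion_def by (simp add: sums_iff mult.commute)
qed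

lemma T_pairing:
  assumes f: "f \<in> L2 M" and h: "h \<in> L2 M"
  shows "(\<lambda>i. moment f i * moment h i) sums (LINT s|M. expansion (moment f) s * h s)"
  using integral_expansion[OF moment_le[OF f] h] .

text \<open>Symmetry of the operator, in the form in which it yields orthogonality of eigenfunctions: the pairing is
bilinear, without complex conjugation, since the eigenfunctions of interest are real.\<close>

lemma T_symmetric:
  assumes f: "f \<in> L2 M" and h: "h \<in> L2 M"
    and Tf: "AE s in M. T f s = w * f s" and Th: "AE s in M. T h s = z * h s"
  shows "w * (LINT s|M. f s * h s) = z * (LINT s|M. f s * h s)"
proof -
  have eig: "(LINT s|M. expansion (moment f) s * h s) = w * (LINT s|M. f s * h s)"
    if f: "f \<in> L2 M" and h: "h \<in> L2 M" and Tf: "AE s in M. T f s = w * f s" for f h w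
  proof -
    have "(LINT s|M. expansion (moment f) s * h s) = (LINT s|M. w * (f s * h s))"
    proof (rule integral_cong_AE)
      show "(\<lambda>s. expansion (moment f) s * h s) \<in> borel_measurable M"
        using L2_measurable[OF expansion_L2[OF moment_le[OF f]]] L2_measurable[OF h] by measurable
      show "(\<lambda>s. w * (f s * h s)) \<in> borel_measurable M"
        using L2_measurable[OF f] L2_measurable[OF h] by measurable
      show "AE s in M. expansion (moment f) s * h s = w * (f s * h s)"
        using Tf M_nonneg by eventually_elim (simp add: T_eq_expansion[OF f])
    qed
    then show ?thesis by simp
  qed
  have "(LINT s|M. expansion (moment f) s * h s) = (LINT s|M. expansion (moment h) s * f s)"
    using sums_unique2[OF T_pairing[OF f h]] T_pairing[OF h f] by (simp add: mult.commute)
  then show ?thesis using eig[OF f h Tf] eig[OF h f Th] by (simp add: mult.commute)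
qed

lemma moment_cnj: "moment (\<lambda>t. cnj (f t)) i = cnj (moment f i)"
  unfolding moment_def by (simp flip: Bochner_Integration.integral_cnj)

lemma moment_linear:
  assumes "f \<in> L2 M" "h \<in> L2 M"
  shows "moment (\<lambda>t. f t - c * h t) i = moment f i - c * moment h i"
proof -
  have "(LINT t|M. complex_of_real (e i t) * (f t - c * h t))
    = (LINT t|M. complex_of_real (e i t) * f t - c * (complex_of_real (e i t) * h t))"
    by (simp add: algebra_simps)
  also have "\<dots> = (LINT t|M. complex_of_real (e i t) * f t) - c * (LINT t|M. complex_of_real (e i t) * h t)"
    using e_mult_integrable assms by simp
  finally show ?thesis by (simp add: moment_def)
qed

text \<open>Pairing \<open>T f = 0\<close> with the conjugate of \<open>f\<close> gives \<open>(\<Sum>i. \<bar>moment f i\<bar>\<^sup>2) = 0\<close>.\<close>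

lemma kernel_trivial:
  assumes f: "f \<in> L2 M" and Tf: "AE s in M. T f s = 0"
  shows "AE s in M. f s = 0"
proof (rule complete[OF f])
  have "(LINT s|M. expansion (moment f) s * cnj (f s)) = (LINT s|M. 0)"
  proof (rule integral_cong_AE)
    show "(\<lambda>s. expansion (moment f) s * cnj (f s)) \<in> borel_measurable M"
      using L2_measurable[OF expansion_L2[OF moment_le[OF f]]] L2_measurable[OF L2_cnj[OF f]] by measurable
    show "AE s in M. expansion (moment f) s * cnj (f s) = 0"
      using Tf M_nonneg by eventually_elim (simp add: T_eq_expansion[OF f])
  qed simp
  then have "(\<lambda>i. moment f i * cnj (moment f i)) sums 0"
    using T_pairing[OF f L2_cnj[OF f]] by (simp add: moment_cnj)
  then have "(\<lambda>i. complex_of_real ((cmod (moment f i))\<^sup>2)) sums complex_of_real 0"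
    unfolding complex_norm_square by simp
  then have s: "(\<lambda>i. (cmod (moment f i))\<^sup>2) sums 0" by (simp only: sums_of_real_iff)
  then have "(\<Sum>i. (cmod (moment f i))\<^sup>2) = 0" "summable (\<lambda>i. (cmod (moment f i))\<^sup>2)"
    by (simp_all add: sums_iff)
  then have "(cmod (moment f i))\<^sup>2 = 0" for i using suminf_eq_zero_iff[of "\<lambda>i. (cmod (moment f i))\<^sup>2"] by simp
  then show "(LINT t|M. complex_of_real (e i t) * f t) = 0" for i by (simp add: moment_def)
qed

lemma T_diff:
  assumes "f \<in> L2 M" "h \<in> L2 M" "0 \<le> s"
  shows "T (\<lambda>t. f t - c * h t) s = T f s - c * T h s"
proof -
  have d: "(\<lambda>t. f t - c * h t) \<in> L2 M" using assms by (intro L2_diff L2_cmult)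
  have "(\<lambda>i. (moment f i - c * moment h i) * complex_of_real (e i s)) sums (expansion (moment f) s - c * expansion (moment h) s)"
    using sums_diff[OF expansion_sums[OF moment_le[OF assms(1)] assms(3)] sums_mult[OF expansion_sums[OF moment_le[OF assms(2)] assms(3)], of c]]
    by (simp add: algebra_simps)
  then show ?thesis unfolding T_eq_expansion[OF d assms(3)] T_eq_expansion[OF assms(1,3)] T_eq_expansion[OF assms(2,3)]
    unfolding expansion_def[of "moment (\<lambda>t. f t - c * h t)"] moment_linear[OF assms(1,2)] by (simp add: sums_iff)
qed

lemma T_sum:
  assumes "\<And>n. f n \<in> L2 M" "0 \<le> s"
  shows "T (\<lambda>t. \<Sum>n<(N::nat). c n * f n t) s = (\<Sum>n<N. c n * T (f n) s)"
proof (induction N)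
  case 0
  then show ?case by (simp add: integral_op_def)
next
  case (Suc N)
  have "T (\<lambda>t. (\<Sum>n<N. c n * f n t) - (- c N) * f N t) s = T (\<lambda>t. \<Sum>n<N. c n * f n t) s - (- c N) * T (f N) s"
    by (intro T_diff L2_sum assms)
  then show ?case using Suc by simp
qed

theorem T_injective: "injective_on_L2 M T"
  unfolding injective_on_L2_def
proof (intro ballI impI)
  fix f g assume fg: "f \<in> L2 M" "g \<in> L2 M" and eq: "AE x in M. T f x = T g x"
  have "AE x in M. T (\<lambda>t. f t - 1 * g t) x = 0"
    using eq M_nonneg by eventually_elim (simp only: T_diff[OF fg], simp)
  then have "AE x in M. f x - 1 * g x = 0"
    by (rule kernel_trivial[rotated]) (use L2_diff[OF fg] in simp)
  then show "AE x in M. f x = g x" by eventually_elim simp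
qed

text \<open>A total family of eigenfunctions with distinct eigenvalues exhausts the spectrum: an
eigenfunction for another eigenvalue would be orthogonal to the whole family, and subtracting from an eigenfunction
its component along \<open>\<phi> n\<close> leaves one that is orthogonal to the whole family. Totality is only required
for eigenfunctions with nonzero eigenvalue.\<close>

theorem eigen_classification:
  fixes \<phi> :: "nat \<Rightarrow> real \<Rightarrow> complex" and ev :: "nat \<Rightarrow> real"
  assumes eig: "\<And>n. is_eigenfunction M T (complex_of_real (ev n)) (\<phi> n)"
    and norm: "\<And>n. (LINT s|M. \<phi> n s * \<phi> n s) \<noteq> 0"
    and inj: "inj ev"
    and total: "\<And>f z. f \<in> L2 M \<Longrightarrow> AE s in M. T f s = z * f s \<Longrightarrow> z \<noteq> 0
        \<Longrightarrow> (\<And>n. (LINT s|M. f s * \<phi> n s) = 0) \<Longrightarrow> AE s in M. f s = 0"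
  shows "bij_betw (\<lambda>n. complex_of_real (ev n)) UNIV {z. is_eigenvalue M T z}"
    and "is_simple_eigenvalue M T (complex_of_real (ev n))"
proof -
  have phi: "\<phi> n \<in> L2 M" "AE s in M. T (\<phi> n) s = complex_of_real (ev n) * \<phi> n s" for n
    using eig[of n] by (simp_all add: is_eigenfunction_def)
  have nonzero: "z \<noteq> 0" if f: "is_eigenfunction M T z f" for z f
    using kernel_trivial[of f] f by (auto simp: is_eigenfunction_def)
  have orth: "(LINT s|M. f s * \<phi> n s) = 0"
    if f: "f \<in> L2 M" "AE s in M. T f s = z * f s" and z: "z \<noteq> complex_of_real (ev n)" for f z n
    using T_symmetric[OF f(1) phi(1)[of n] f(2) phi(2)[of n]] z by simp
  have main: "\<exists>n. z = complex_of_real (ev n)" if f: "is_eigenfunction M T z f" for z f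
  proof (rule ccontr)
    assume "\<nexists>n. z = complex_of_real (ev n)"
    then have "AE s in M. f s = 0"
      using f orth[of f z] nonzero[OF f] by (intro total[of f z]) (auto simp: is_eigenfunction_def)
    then show False using f by (simp add: is_eigenfunction_def)
  qed
  show "bij_betw (\<lambda>n. complex_of_real (ev n)) UNIV {z. is_eigenvalue M T z}"
  proof (rule bij_betw_imageI)
    show "inj (\<lambda>n. complex_of_real (ev n))" using inj by (auto simp: inj_def)
    show "range (\<lambda>n. complex_of_real (ev n)) = {z. is_eigenvalue M T z}"
    proof (intro equalityI subsetI)
      fix z assume "z \<in> {z. is_eigenvalue M T z}"
      then obtain f where "is_eigenfunction M T z f" by (auto simp: is_eigenvalue_def)
      then show "z \<in> range (\<lambda>n. complex_of_real (ev n))" using main by blast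
    qed (use eig in \<open>auto simp: is_eigenvalue_def\<close>)
  qed
  show "is_simple_eigenvalue M T (complex_of_real (ev n))"
    unfolding is_simple_eigenvalue_def
  proof (intro exI[of _ "\<phi> n"] conjI allI impI eig)
    fix g assume g: "is_eigenfunction M T (complex_of_real (ev n)) g"
    then have gL: "g \<in> L2 M" and Tg: "AE s in M. T g s = complex_of_real (ev n) * g s"
      by (simp_all add: is_eigenfunction_def)
    define c where "c = (LINT s|M. g s * \<phi> n s) / (LINT s|M. \<phi> n s * \<phi> n s)"
    define f where "f s = g s - c * \<phi> n s" for s
    have fL: "f \<in> L2 M" unfolding f_def by (intro L2_diff L2_cmult gL phi)
    have Tf: "AE s in M. T f s = complex_of_real (ev n) * f s"
      using Tg phi(2)[of n] M_nonneg unfolding f_def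
      by eventually_elim (simp add: T_diff[OF gL phi(1)] algebra_simps)
    have "(LINT s|M. f s * \<phi> m s) = 0" for m
    proof (cases "m = n")
      case True
      have "(LINT s|M. f s * \<phi> n s) = (LINT s|M. g s * \<phi> n s - c * (\<phi> n s * \<phi> n s))"
        by (simp add: f_def algebra_simps)
      also have "\<dots> = (LINT s|M. g s * \<phi> n s) - c * (LINT s|M. \<phi> n s * \<phi> n s)"
        using L2_mult_integrable[OF gL phi(1)] L2_mult_integrable[OF phi(1) phi(1)] by simp
      also have "\<dots> = 0" using norm[of n] by (simp add: c_def)
      finally show ?thesis using True by simp
    next
      case False
      then have "complex_of_real (ev n) \<noteq> complex_of_real (ev m)" using inj by (auto dest: injD)
      then show ?thesis by (rule orth[OF fL Tf])
    qed
    then have "AE s in M. f s = 0" using total[OF fL Tf nonzero[OF g]] by blast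
    then have "AE s in M. g s = c * \<phi> n s" by eventually_elim (simp add: f_def)
    then show "\<exists>c. AE s in M. g s = c * \<phi> n s" by blast
  qed
qed

end

section \<open>Eigenfunctions of totally positive kernels\<close>

text \<open>In Andreief's identity every tuple of \<open>N + 1\<close> indices below \<open>N\<close> has a repetition.\<close>

lemma ldet_low_rank:
  "ldet (Suc N) (\<lambda>i j. \<Sum>k<N. A i k * B j k) = 0"
proof -
  have "ldet (Suc N) (\<lambda>l k. A k (J l)) = 0" if J: "J \<in> tuples (Suc N) N" for J
  proof -
    have "\<not> inj_on J {..<Suc N}"
    proof
      assume "inj_on J {..<Suc N}"
      then have "card {..<Suc N} \<le> card {..<N}"
        by (rule card_inj_on_le) (use J in auto)
      then show False by simp
    qed
    then obtain p r where pr: "p < Suc N" "r < Suc N" "p \<noteq> r" "J p = J r" by (auto simp: inj_on_def)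
    then have "ldet (Suc N) (\<lambda>k l. A k (J l)) = 0" by (intro ldet_equal_columns[of p _ r]) auto
    then show ?thesis using ldet_transpose[of "Suc N" "\<lambda>k l. A k (J l)"] by simp
  qed
  then have "fact (Suc N) * ldet (Suc N) (\<lambda>i j. \<Sum>k<N. A i k * B j k) = 0"
    unfolding finite_Andreief[symmetric] by simp
  then show ?thesis by (simp del: fact_Suc)
qed

text \<open>Passing from \<open>\<phi> k\<close> to \<open>\<eta> k * \<phi> k\<close> multiplies the determinant of order \<open>r\<close> by \<open>\<eta> 0 \<dots> \<eta> (r - 1)\<close>, and these products can be
prescribed arbitrarily.\<close>

lemma sign_pattern_exists:
  fixes sg :: "nat \<Rightarrow> real"
  assumes "\<And>r. sg r = 1 \<or> sg r = -1" "sg 0 = 1"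
  obtains \<eta> where "\<And>k. \<eta> k = 1 \<or> \<eta> k = (-1::real)"
    "\<And>r. (\<Prod>k<r. \<eta> k) = sg r * (-1) ^ (r * (r - 1) div 2)"
proof -
  define P where "P r = sg r * (-1) ^ (r * (r - 1) div 2)" for r
  define \<eta> where "\<eta> k = P k * P (Suc k)" for k
  have P: "P r = 1 \<or> P r = -1" for r
    using assms(1)[of r] by (cases "even (r * (r - 1) div 2)") (auto simp: P_def)
  have "(\<Prod>k<r. \<eta> k) = P r" for r
  proof (induction r)
    case 0 then show ?case by (simp add: P_def assms(2))
  next
    case (Suc r) then show ?case using P[of r] by (auto simp: \<eta>_def)
  qed
  then have "(\<Prod>k<r. \<eta> k) = sg r * (-1) ^ (r * (r - 1) div 2)" for r unfolding P_def .
  moreover have "\<eta> k = 1 \<or> \<eta> k = -1" for k using P[of k] P[of "Suc k"] by (auto simp: \<eta>_def)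
  ultimately show ?thesis using that by blast
qed

text \<open>A matrix of finite rank has vanishing minors, so positive minors imply infinite rank. The wedges have
constant sign, and the signs of the eigenvectors are chosen to turn it into the sign of the oscillation property.\<close>

theorem oscillating_spectral_decomposition:
  assumes G: "decaying_psd G C q"
    and minors: "\<And>r I J. strict_mono_on {..<r} I \<Longrightarrow> strict_mono_on {..<r} J \<Longrightarrow> 0 < ldet r (\<lambda>k l. G (I k) (J l))"
  obtains \<delta> :: "nat \<Rightarrow> real" and a :: "nat \<Rightarrow> nat \<Rightarrow> real" where
    "\<And>k. 0 < \<delta> k" "\<And>k. \<delta> (Suc k) < \<delta> k" "\<delta> \<longlonglongrightarrow> 0"
    "\<And>k i. \<bar>a k i\<bar> \<le> C / (1 - q) / \<delta> k * q ^ i"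
    "\<And>k. (\<lambda>i. (a k i)\<^sup>2) sums 1"
    "\<And>k i. (\<lambda>j. G i j * a k j) sums (\<delta> k * a k i)"
    "\<And>N n x. bilin G n x x \<le> (\<Sum>k<N. \<delta> k * (\<Sum>i<n. a k i * x i)\<^sup>2) + \<delta> N * (\<Sum>i<n. (x i)\<^sup>2)"
    "\<And>r J. strict_mono_on {..<r} J \<Longrightarrow> 0 \<le> (-1) ^ (r * (r - 1) div 2) * ldet r (\<lambda>k l. a k (J l))"
proof -
  interpret decaying_psd G C q by (rule G)
  interpret infinite_rank_psd G C q
  proof
    fix N :: nat and d a
    show "\<exists>i j. G i j \<noteq> (\<Sum>k<N. d k * a k i * a k j)"
    proof (rule ccontr)
      assume "\<nexists>i j. G i j \<noteq> (\<Sum>k<N. d k * a k i * a k j)"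
      then have "G = (\<lambda>i j. \<Sum>k<N. (d k * a k i) * a k j)" by (auto simp: fun_eq_iff)
      then have "ldet (Suc N) G = 0" using ldet_low_rank[of N "\<lambda>i k. d k * a k i" "\<lambda>j k. a k j"] by simp
      moreover have "strict_mono_on {..<Suc N} (\<lambda>k::nat. k)" by (simp add: strict_mono_on_def)
      ultimately show False using minors[of "Suc N" "\<lambda>k. k" "\<lambda>k. k"] by simp
    qed
  qed
  obtain \<delta> a where pos: "\<And>k. 0 < \<delta> k" and dec: "decseq \<delta>" and lim: "\<delta> \<longlonglongrightarrow> 0" and ball: "\<And>k. a k \<in> ell2_ball"
    and orth: "\<And>k l. (\<lambda>n. \<Sum>i<n. a k i * a l i) \<longlonglongrightarrow> (if k = l then 1 else 0)"
    and eig: "\<And>k i. (\<lambda>j. G i j * a k j) sums (\<delta> k * a k i)"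
    and expand: "\<And>i j. (\<lambda>N. \<Sum>k<N. \<delta> k * a k i * a k j) \<longlonglongrightarrow> G i j"
    and qform: "\<And>N n x. bilin G n x x \<le> (\<Sum>k<N. \<delta> k * (\<Sum>i<n. a k i * x i)\<^sup>2) + \<delta> N * (\<Sum>i<n. (x i)\<^sup>2)"
    using spectral_decomposition by blast
  have coord: "\<bar>a k i\<bar> \<le> 1" for k i using ell2_ball_coord[OF ball] .
  interpret totally_positive_spectrum G \<delta> a
  proof
    fix k l
    have "(\<lambda>n. (bilin G n (a k) (a l) - (\<Sum>i<n. a k i * (\<delta> l * a l i))) + \<delta> l * (\<Sum>i<n. a k i * a l i))
        \<longlonglongrightarrow> 0 + \<delta> l * (if k = l then 1 else 0)"
      by (intro tendsto_add tendsto_mult_left orth bilin_limit[OF coord coord eig])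
    then have "(\<lambda>n. bilin G n (a k) (a l)) \<longlonglongrightarrow> \<delta> l * (if k = l then 1 else 0)"
      by (simp add: sum_distrib_left mult_ac)
    then show "(\<lambda>n. bilin G n (a k) (a l)) \<longlonglongrightarrow> (if k = l then \<delta> k else 0)" by (cases "k = l") auto
  qed (use pos dec orth expand minors in auto)
  have "\<forall>r. \<exists>s::real. (s = 1 \<or> s = -1) \<and> (\<forall>J. strict_mono_on {..<r} J \<longrightarrow> 0 \<le> s * ldet r (\<lambda>k l. a k (J l)))"
    using wedge_constant_sign by metis
  then obtain sg :: "nat \<Rightarrow> real" where sg: "\<And>r. sg r = 1 \<or> sg r = -1"
    and sgn: "\<And>r J. strict_mono_on {..<r} J \<Longrightarrow> 0 \<le> sg r * ldet r (\<lambda>k l. a k (J l))" by metis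
  have "strict_mono_on {..<0::nat} (\<lambda>k::nat. k)" by (simp add: strict_mono_on_def)
  then have "sg 0 = 1" using sgn[of 0 "\<lambda>k. k"] sg[of 0] by (auto simp: ldet_def sgnr_def)
  then obtain \<eta> where eta: "\<And>k. \<eta> k = 1 \<or> \<eta> k = (-1::real)"
    and eta_prod: "\<And>r. (\<Prod>k<r. \<eta> k) = sg r * (-1) ^ (r * (r - 1) div 2)"
    using sign_pattern_exists[of sg] sg by blast
  define b where "b k i = \<eta> k * a k i" for k i
  have eta2: "(\<eta> k)\<^sup>2 = 1" "\<bar>\<eta> k\<bar> = 1" for k using eta[of k] by auto
  show ?thesis
  proof (rule that[of \<delta> b])
    show "0 < \<delta> k" "\<delta> (Suc k) < \<delta> k" for k by (rule pos, rule spectrum_strictly_decreasing)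
    show "\<delta> \<longlonglongrightarrow> 0" by (rule lim)
    show "\<bar>b k i\<bar> \<le> C / (1 - q) / \<delta> k * q ^ i" for k i
    proof -
      have "\<delta> k * \<bar>a k i\<bar> \<le> C / (1 - q) * q ^ i"
        using row_tail_le[OF coord eig, of k i 0] pos[of k] by (simp add: abs_mult mult_ac)
      then have "\<bar>a k i\<bar> \<le> (C / (1 - q) * q ^ i) / \<delta> k"
        using pos[of k] by (simp only: pos_le_divide_eq mult.commute)
      then show ?thesis by (simp add: b_def abs_mult eta2)
    qed
    show "(\<lambda>i. (b k i)\<^sup>2) sums 1" for k
      using orth[of k k] unfolding b_def power_mult_distrib eta2 by (simp add: sums_def power2_eq_square)
    show "(\<lambda>j. G i j * b k j) sums (\<delta> k * b k i)" for k i
      using sums_mult[OF eig[of i k], of "\<eta> k"] by (simp add: b_def mult_ac)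
    show "bilin G n x x \<le> (\<Sum>k<N. \<delta> k * (\<Sum>i<n. b k i * x i)\<^sup>2) + \<delta> N * (\<Sum>i<n. (x i)\<^sup>2)" for N n x
    proof -
      have "(\<Sum>i<n. b k i * x i)\<^sup>2 = (\<Sum>i<n. a k i * x i)\<^sup>2" for k
        using eta2(1)[of k] by (simp add: b_def mult.assoc sum_distrib_left[symmetric] power_mult_distrib)
      then show ?thesis using qform[where N = N and n = n and x = x] by simp
    qed
    show "0 \<le> (-1) ^ (r * (r - 1) div 2) * ldet r (\<lambda>k l. b k (J l))" if "strict_mono_on {..<r} J" for r J
    proof -
      have "ldet r (\<lambda>k l. b k (J l)) = (\<Prod>k<r. \<eta> k) * ldet r (\<lambda>k l. a k (J l))"
        using ldet_scale[of r \<eta> "\<lambda>_. 1" "\<lambda>k l. a k (J l)"] by (simp add: b_def)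
      then have "(-1) ^ (r * (r - 1) div 2) * ldet r (\<lambda>k l. b k (J l)) = sg r * ldet r (\<lambda>k l. a k (J l))"
        by (simp add: eta_prod power_mult_distrib[symmetric] mult.assoc[symmetric])
      then show ?thesis using sgn[OF that] by simp
    qed
  qed
qed

text \<open>The inequality for the minors of the features is not strict, so that the argument \<open>0\<close>, at which features may
vanish, is included.\<close>

locale totally_positive_kernel = feature_kernel +
  assumes W_cont: "continuous_on {0..} W" and W_pos: "0 \<le> s \<Longrightarrow> 0 < W s"
    and e_cont: "continuous_on {0..} (e i)"
    and gram_pos: "strict_mono_on {..<r} I \<Longrightarrow> strict_mono_on {..<r} J
        \<Longrightarrow> 0 < ldet r (\<lambda>k l. \<integral>s. e (I k) s * e (J l) s \<partial>M)"
    and feature_minors: "strict_mono_on {..<r} I \<Longrightarrow> strict_mono_on {..<r} t \<Longrightarrow> (\<And>l. l < r \<Longrightarrow> 0 \<le> t l)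
        \<Longrightarrow> 0 \<le> ldet r (\<lambda>k l. e (I k) (t l))"
begin

definition gram :: "nat \<Rightarrow> nat \<Rightarrow> real" where
  "gram i j = (\<integral>s. e i s * e j s \<partial>M)"

lemma e_e_integrable: "integrable M (\<lambda>s. e i s * e j s)"
proof -
  have "integrable M (\<lambda>s. Re (complex_of_real (e i s) * complex_of_real (e j s)))"
    by (intro integrable_Re L2_mult_integrable e_L2)
  then show ?thesis by simp
qed

lemma moment_e: "moment (\<lambda>t. complex_of_real (e j t)) i = complex_of_real (gram i j)"
  unfolding moment_def gram_def of_real_mult[symmetric] by (rule integral_complex_of_real)

lemma gram_decaying_psd: "decaying_psd gram (\<integral>s. (W s)\<^sup>2 \<partial>M) q"
proof
  show "gram i j = gram j i" for i j by (simp add: gram_def mult.commute)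
  show "0 \<le> bilin gram n x x" for n x
  proof -
    have "bilin gram n x x = (\<integral>s. (\<Sum>i<n. \<Sum>j<n. x i * (e i s * e j s) * x j) \<partial>M)"
      unfolding bilin_def gram_def
      by (simp add: Bochner_Integration.integral_sum e_e_integrable)
    also have "(\<lambda>s. \<Sum>i<n. \<Sum>j<n. x i * (e i s * e j s) * x j) = (\<lambda>s. (\<Sum>i<n. x i * e i s)\<^sup>2)"
      by (simp add: power2_eq_square sum_product mult_ac)
    finally show ?thesis by simp
  qed
  show "gram i i \<le> (\<integral>s. (W s)\<^sup>2 \<partial>M) * q ^ (2 * i)" for i
  proof -
    have "gram i i \<le> (\<integral>s. q ^ (2 * i) * (W s)\<^sup>2 \<partial>M)"
      unfolding gram_def
    proof (rule integral_mono_AE)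
      show "integrable M (\<lambda>s. e i s * e i s)" by (rule e_e_integrable)
      show "integrable M (\<lambda>s. q ^ (2 * i) * (W s)\<^sup>2)" using W_int by simp
      show "AE s in M. e i s * e i s \<le> q ^ (2 * i) * (W s)\<^sup>2"
        using M_nonneg
      proof eventually_elim
        case (elim s)
        have "\<bar>e i s\<bar>\<^sup>2 \<le> (q ^ i * W s)\<^sup>2" by (intro power_mono e_le elim) simp
        then show ?case unfolding power_even_eq by (simp add: power2_eq_square mult_ac)
      qed
    qed
    then show ?thesis by (simp add: mult.commute)
  qed
qed (use q in auto)

text \<open>If \<open>G u = p u\<close> and \<open>u\<close> is orthogonal to all eigenvectors \<open>a k\<close>, then the form at \<open>u\<close> is both \<open>p \<bar>u\<bar>\<^sup>2\<close> and at most
\<open>\<delta> N \<bar>u\<bar>\<^sup>2\<close> for every \<open>N\<close>; as it is also nonnegative, it is \<open>0\<close>.\<close>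

lemma sequence_total:
  fixes u :: "nat \<Rightarrow> real"
  assumes lim: "\<delta> \<longlonglongrightarrow> 0"
    and form: "\<And>N n x. bilin gram n x x \<le> (\<Sum>k<N. \<delta> k * (\<Sum>i<n. a k i * x i)\<^sup>2) + \<delta> N * (\<Sum>i<n. (x i)\<^sup>2)"
    and u: "\<And>i. \<bar>u i\<bar> \<le> B * q ^ i" and eig: "\<And>i. (\<lambda>j. gram i j * u j) sums (p * u i)"
    and orth: "\<And>k. (\<lambda>i. a k i * u i) sums 0" and p: "p \<noteq> 0"
  shows "u i = 0"
proof -
  interpret G: decaying_psd gram "\<integral>s. (W s)\<^sup>2 \<partial>M" q by (rule gram_decaying_psd)
  have B: "0 \<le> B" using order_trans[OF abs_ge_zero u[of 0]] by simp
  have b1: "\<bar>u i\<bar> \<le> B" for i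
  proof -
    have "B * q ^ i \<le> B * 1" using B q by (intro mult_left_mono) (auto simp: power_le_one)
    then show ?thesis using u[of i] by simp
  qed
  have sm: "summable (\<lambda>i. (u i)\<^sup>2)"
  proof (rule summable_comparison_test'[OF geometric_summable[of "B * B"]])
    fix i show "norm ((u i)\<^sup>2) \<le> B * B * q ^ i"
      using mult_mono[OF b1[of i] u[of i]] B by (simp add: power2_eq_square abs_mult mult_ac)
  qed
  define S where "S = (\<Sum>i. (u i)\<^sup>2)"
  have S: "(\<lambda>n. \<Sum>i<n. (u i)\<^sup>2) \<longlonglongrightarrow> S" unfolding S_def using summable_LIMSEQ[OF sm] .
  have bl: "(\<lambda>n. bilin gram n u u) \<longlonglongrightarrow> p * S"
  proof -
    have "(\<lambda>n. (bilin gram n u u - (\<Sum>i<n. u i * (p * u i))) + p * (\<Sum>i<n. (u i)\<^sup>2)) \<longlonglongrightarrow> 0 + p * S"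
      by (intro tendsto_add tendsto_mult_left S G.bilin_limit[OF b1 b1 eig])
    then show ?thesis by (simp add: sum_distrib_left power2_eq_square mult_ac)
  qed
  have "p * S \<le> \<delta> N * S" for N
  proof (rule LIMSEQ_le[OF bl])
    have "(\<lambda>n. (\<Sum>k<N. \<delta> k * (\<Sum>i<n. a k i * u i)\<^sup>2) + \<delta> N * (\<Sum>i<n. (u i)\<^sup>2))
      \<longlonglongrightarrow> (\<Sum>k<N. \<delta> k * 0\<^sup>2) + \<delta> N * S"
      using orth unfolding sums_def by (intro tendsto_intros S)
    then show "(\<lambda>n. (\<Sum>k<N. \<delta> k * (\<Sum>i<n. a k i * u i)\<^sup>2) + \<delta> N * (\<Sum>i<n. (u i)\<^sup>2)) \<longlonglongrightarrow> \<delta> N * S" by simp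
  qed (use form in blast)
  then have "p * S \<le> 0 * S"
    using tendsto_mult_right[OF lim, of S] by (intro LIMSEQ_le_const) auto
  moreover have "0 \<le> p * S" using bl G.psd by (intro LIMSEQ_le_const) auto
  ultimately have "S = 0" using p by simp
  then have "(u i)\<^sup>2 = 0" using suminf_eq_zero_iff[OF sm] by (simp add: S_def)
  then show ?thesis by simp
qed

text \<open>The eigenvectors \<open>a n\<close> of the Gram matrix become the eigenfunctions \<open>(\<Sum>i. a n i * e i)\<close> of the operator.
Conversely the moments of an eigenfunction of the operator form an eigenvector of the Gram matrix, which
is how \<open>sequence_total\<close> gives totality.\<close>

theorem oscillating_eigenfunctions:
  obtains \<delta> :: "nat \<Rightarrow> real" and \<phi> :: "nat \<Rightarrow> real \<Rightarrow> real" where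
    "\<And>n. 0 < \<delta> n" "\<And>n. \<delta> (Suc n) < \<delta> n"
    "bij_betw (\<lambda>n. complex_of_real (\<delta> n)) UNIV {z. is_eigenvalue M T z}"
    "\<And>n. is_simple_eigenvalue M T (complex_of_real (\<delta> n))"
    "\<And>n. is_eigenfunction M T (complex_of_real (\<delta> n)) (\<lambda>s. complex_of_real (\<phi> n s))"
    "\<And>n. continuous_on {0..} (\<phi> n)"
    "oscillation_property \<phi>"
proof -
  define C where "C = (\<integral>s. (W s)\<^sup>2 \<partial>M)"
  have Gdec: "decaying_psd gram C q" unfolding C_def by (rule gram_decaying_psd)
  have minors: "0 < ldet r (\<lambda>k l. gram (I k) (J l))" if "strict_mono_on {..<r} I" "strict_mono_on {..<r} J" for r I J
    unfolding gram_def using gram_pos[OF that] .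
  obtain \<delta> a where pos: "\<And>k. 0 < \<delta> k" and dec: "\<And>k. \<delta> (Suc k) < \<delta> k" and lim: "\<delta> \<longlonglongrightarrow> 0"
    and decay: "\<And>k i. \<bar>a k i\<bar> \<le> C / (1 - q) / \<delta> k * q ^ i"
    and norm1: "\<And>k. (\<lambda>i. (a k i)\<^sup>2) sums 1"
    and eig: "\<And>k i. (\<lambda>j. gram i j * a k j) sums (\<delta> k * a k i)"
    and form: "\<And>N n x. bilin gram n x x \<le> (\<Sum>k<N. \<delta> k * (\<Sum>i<n. a k i * x i)\<^sup>2) + \<delta> N * (\<Sum>i<n. (x i)\<^sup>2)"
    and signs: "\<And>r J. strict_mono_on {..<r} J \<Longrightarrow> 0 \<le> (-1) ^ (r * (r - 1) div 2) * ldet r (\<lambda>k l. a k (J l))"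
    using oscillating_spectral_decomposition[OF Gdec minors] by blast
  define B where "B n = C / (1 - q) / \<delta> n" for n
  have xb: "cmod (complex_of_real (a n i)) \<le> B n * q ^ i" for n i using decay by (simp add: B_def)
  define \<phi> where "\<phi> n s = (\<Sum>i. a n i * e i s)" for n s
  have phi_sums: "(\<lambda>i. a n i * e i s) sums \<phi> n s" if "0 \<le> s" for n s
  proof -
    have "summable (\<lambda>i. norm (complex_of_real (a n i) * complex_of_real (e i s)))"
      using expansion_summable[OF xb that] .
    then have "summable (\<lambda>i. norm (a n i * e i s))" by (simp add: norm_mult abs_mult)
    then show ?thesis unfolding \<phi>_def by (intro summable_sums) (rule summable_norm_cancel)
  qed
  have phi_expansion: "expansion (\<lambda>i. complex_of_real (a n i)) s = complex_of_real (\<phi> n s)" if "0 \<le> s" for n s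
    using expansion_sums[OF xb that] sums_of_real[OF phi_sums[OF that], where 'a = complex, of n]
    by (auto simp: sums_iff)
  have phi_L2: "(\<lambda>s. complex_of_real (\<phi> n s)) \<in> L2 M" for n
  proof (rule L2_cong_AE[OF expansion_L2[OF xb]])
    show "(\<lambda>s. complex_of_real (\<phi> n s)) \<in> borel_measurable M"
      unfolding \<phi>_def using e_meas by measurable
    show "AE s in M. expansion (\<lambda>i. complex_of_real (a n i)) s = complex_of_real (\<phi> n s)"
      using M_nonneg by eventually_elim (rule phi_expansion)
  qed
  have phi_pairing: "(\<lambda>i. complex_of_real (a n i) * moment h i) sums (LINT s|M. complex_of_real (\<phi> n s) * h s)"
    if h: "h \<in> L2 M" for n h
  proof -
    have "(LINT s|M. expansion (\<lambda>i. complex_of_real (a n i)) s * h s) = (LINT s|M. complex_of_real (\<phi> n s) * h s)"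
    proof (rule integral_cong_AE)
      show "(\<lambda>s. expansion (\<lambda>i. complex_of_real (a n i)) s * h s) \<in> borel_measurable M"
        using L2_measurable[OF expansion_L2[OF xb]] L2_measurable[OF h] by measurable
      show "(\<lambda>s. complex_of_real (\<phi> n s) * h s) \<in> borel_measurable M"
        using L2_measurable[OF phi_L2] L2_measurable[OF h] by measurable
      show "AE s in M. expansion (\<lambda>i. complex_of_real (a n i)) s * h s = complex_of_real (\<phi> n s) * h s"
        using M_nonneg by eventually_elim (simp add: phi_expansion)
    qed
    then show ?thesis using integral_expansion[OF xb[of n] h] by simp
  qed
  have moment_phi: "moment (\<lambda>s. complex_of_real (\<phi> n s)) j = complex_of_real (\<delta> n * a n j)" for n j
  proof -
    have "(\<lambda>i. complex_of_real (a n i) * complex_of_real (gram i j)) sums moment (\<lambda>s. complex_of_real (\<phi> n s)) j"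
      using phi_pairing[OF e_L2, of n j] by (simp add: moment_e moment_def mult.commute)
    moreover have "(\<lambda>i. complex_of_real (gram j i * a n i)) sums complex_of_real (\<delta> n * a n j)"
      using eig[of j n] by (rule sums_of_real)
    moreover have "gram j i = gram i j" for i by (simp add: gram_def mult.commute)
    ultimately show ?thesis using sums_unique2 by (fastforce simp: mult.commute)
  qed
  have T_phi: "T (\<lambda>s. complex_of_real (\<phi> n s)) s = complex_of_real (\<delta> n) * complex_of_real (\<phi> n s)" if "0 \<le> s" for n s
    unfolding T_eq_expansion[OF phi_L2 that] expansion_def moment_phi
    using sums_mult[OF sums_of_real[OF phi_sums[OF that, of n], where 'a = complex], of "complex_of_real (\<delta> n)"]
    by (simp add: sums_iff mult.assoc)
  have phi_norm: "(LINT s|M. complex_of_real (\<phi> n s) * complex_of_real (\<phi> n s)) = complex_of_real (\<delta> n)" for n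
  proof -
    have "(\<lambda>i. complex_of_real (a n i) * complex_of_real (\<delta> n * a n i)) sums
      (LINT s|M. complex_of_real (\<phi> n s) * complex_of_real (\<phi> n s))"
      using phi_pairing[OF phi_L2, of n n] by (simp only: moment_phi)
    moreover have "(\<lambda>i. complex_of_real (\<delta> n * (a n i)\<^sup>2)) sums complex_of_real (\<delta> n * 1)"
      by (intro sums_of_real sums_mult norm1)
    ultimately show ?thesis using sums_unique2 by (fastforce simp: power2_eq_square mult_ac)
  qed
  have phi_eig: "is_eigenfunction M T (complex_of_real (\<delta> n)) (\<lambda>s. complex_of_real (\<phi> n s))" for n
    unfolding is_eigenfunction_def
  proof (intro conjI phi_L2 notI)
    assume "AE s in M. complex_of_real (\<phi> n s) = 0"
    then have "AE s in M. complex_of_real (\<phi> n s) * complex_of_real (\<phi> n s) = 0" by eventually_elim simp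
    then have "(LINT s|M. complex_of_real (\<phi> n s) * complex_of_real (\<phi> n s)) = 0" by (rule integral_eq_zero_AE)
    then show False using pos[of n] by (simp add: phi_norm)
  next
    show "AE s in M. T (\<lambda>s. complex_of_real (\<phi> n s)) s = complex_of_real (\<delta> n) * complex_of_real (\<phi> n s)"
      using M_nonneg by eventually_elim (rule T_phi)
  qed
  have total: "AE s in M. f s = 0"
    if f: "f \<in> L2 M" and Tf: "AE s in M. T f s = z * f s" and z: "z \<noteq> 0"
      and orth: "\<And>n. (LINT s|M. f s * complex_of_real (\<phi> n s)) = 0" for f z
  proof -
    define x where "x = moment f"
    have xle: "cmod (x i) \<le> weighted_mass f * q ^ i" for i unfolding x_def by (rule moment_le[OF f])
    have pair_eq: "(LINT s|M. expansion x s * h s) = z * (LINT s|M. f s * h s)" if h: "h \<in> L2 M" for h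
    proof -
      have "(LINT s|M. expansion x s * h s) = (LINT s|M. z * (f s * h s))"
      proof (rule integral_cong_AE)
        show "(\<lambda>s. expansion x s * h s) \<in> borel_measurable M"
          using L2_measurable[OF expansion_L2[OF xle]] L2_measurable[OF h] by measurable
        show "(\<lambda>s. z * (f s * h s)) \<in> borel_measurable M"
          using L2_measurable[OF f] L2_measurable[OF h] by measurable
        show "AE s in M. expansion x s * h s = z * (f s * h s)"
          using Tf M_nonneg by eventually_elim (simp add: T_eq_expansion[OF f] x_def)
      qed
      then show ?thesis by simp
    qed
    show ?thesis
    proof (cases "(LINT s|M. (cmod (f s))\<^sup>2) = 0")
      case True
      then show ?thesis by (rule integral_cmod_square_eq_0[OF f])
    next
      case False
      have "(\<lambda>i. x i * moment (\<lambda>s. cnj (f s)) i) sums (z * (LINT s|M. f s * cnj (f s)))"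
        using integral_expansion[OF xle L2_cnj[OF f]] pair_eq[OF L2_cnj[OF f]] by simp
      then have "(\<lambda>i. complex_of_real ((cmod (x i))\<^sup>2)) sums (z * complex_of_real (LINT s|M. (cmod (f s))\<^sup>2))"
        unfolding integral_mult_cnj moment_cnj complex_norm_square by (simp add: x_def)
      \<comment> \<open>The eigenvalue is real, so real and imaginary parts of the moments can be treated separately.\<close>
      then have "Im (z * complex_of_real (LINT s|M. (cmod (f s))\<^sup>2)) = 0"
        using sums_Im by (fastforce simp: sums_iff)
      then have "Im z = 0" using False by simp
      then obtain p where p: "z = complex_of_real p" by (metis complex_is_Real_iff Reals_cases)
      then have p0: "p \<noteq> 0" using z by auto
      have xeig: "(\<lambda>j. complex_of_real (gram i j) * x j) sums (complex_of_real p * x i)" for i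
      proof -
        have "(\<lambda>j. x j * complex_of_real (gram j i)) sums (LINT s|M. expansion x s * complex_of_real (e i s))"
          using integral_expansion[OF xle e_L2, of i] by (simp add: moment_e)
        moreover have "(LINT s|M. expansion x s * complex_of_real (e i s)) = complex_of_real p * x i"
          using pair_eq[OF e_L2, of i] by (simp add: x_def moment_def p mult.commute)
        moreover have "gram j i = gram i j" for j by (simp add: gram_def mult.commute)
        ultimately show ?thesis by (simp add: mult.commute)
      qed
      have xorth: "(\<lambda>i. complex_of_real (a n i) * x i) sums 0" for n
        using phi_pairing[OF f, of n] orth[of n] by (simp add: x_def mult.commute)
      have "Re (x i) = 0" for i
      proof (rule sequence_total[OF lim form])
        show "\<bar>Re (x i)\<bar> \<le> weighted_mass f * q ^ i" for i using abs_Re_le_cmod[of "x i"] xle[of i] by linarith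
        show "(\<lambda>j. gram i j * Re (x j)) sums (p * Re (x i))" for i using sums_Re[OF xeig[of i]] by simp
        show "(\<lambda>i. a n i * Re (x i)) sums 0" for n using sums_Re[OF xorth[of n]] by simp
      qed (rule p0)
      moreover have "Im (x i) = 0" for i
      proof (rule sequence_total[OF lim form])
        show "\<bar>Im (x i)\<bar> \<le> weighted_mass f * q ^ i" for i using abs_Im_le_cmod[of "x i"] xle[of i] by linarith
        show "(\<lambda>j. gram i j * Im (x j)) sums (p * Im (x i))" for i using sums_Im[OF xeig[of i]] by simp
        show "(\<lambda>i. a n i * Im (x i)) sums 0" for n using sums_Im[OF xorth[of n]] by simp
      qed (rule p0)
      ultimately have "x i = 0" for i by (simp add: complex_eq_iff)
      then show ?thesis using complete[OF f] by (simp add: x_def moment_def)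
    qed
  qed
  have anti: "\<delta> m < \<delta> n" if "n < m" for n m using that
  proof (induction m)
    case (Suc m) then show ?case using dec[of m] by (cases "n = m") auto
  qed simp
  then have inj: "inj \<delta>" by (intro injI) (metis linorder_neqE_nat order_less_irrefl)
  have norm_nz: "(LINT s|M. complex_of_real (\<phi> n s) * complex_of_real (\<phi> n s)) \<noteq> 0" for n
    using pos[of n] by (simp add: phi_norm)
  note classified = eigen_classification[of \<delta> "\<lambda>n s. complex_of_real (\<phi> n s)", OF phi_eig norm_nz inj total]
  have cont: "continuous_on {0..} (\<phi> n)" for n
  proof -
    \<comment> \<open>Division by the weight makes the convergence uniform on the whole half-line.\<close>
    have ul: "uniform_limit {0..} (\<lambda>m s. \<Sum>i<m. a n i * e i s / W s) (\<lambda>s. \<Sum>i. a n i * e i s / W s) sequentially"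
    proof (rule Weierstrass_m_test)
      fix i and s :: real assume s: "s \<in> {0..}"
      have "\<bar>a n i\<bar> * \<bar>e i s\<bar> \<le> (B n * q ^ i) * (1 * W s)"
      proof (rule mult_mono)
        show "\<bar>a n i\<bar> \<le> B n * q ^ i" using decay by (simp add: B_def)
        then show "0 \<le> B n * q ^ i" using abs_ge_zero order_trans by blast
        have "q ^ i * W s \<le> 1 * W s" using q s W_nonneg[of s] by (intro mult_right_mono) (auto simp: power_le_one)
        then show "\<bar>e i s\<bar> \<le> 1 * W s" using e_le[of s i] s by simp
      qed simp
      then show "norm (a n i * e i s / W s) \<le> B n * q ^ i"
        using W_pos[of s] s by (simp add: abs_mult field_simps)
    qed (rule geometric_summable)
    have "continuous_on {0..} (\<lambda>s. \<Sum>i. a n i * e i s / W s)"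
      by (rule uniform_limit_theorem[OF always_eventually ul])
         (auto intro!: continuous_intros e_cont W_cont simp: less_imp_neq[OF W_pos, symmetric])
    then have "continuous_on {0..} (\<lambda>s. (\<Sum>i. a n i * e i s / W s) * W s)"
      by (intro continuous_intros W_cont)
    moreover have "(\<Sum>i. a n i * e i s / W s) * W s = \<phi> n s" if "s \<in> {0..}" for s
      using sums_divide[OF phi_sums[of s n], of "W s"] W_pos[of s] that by (simp add: sums_iff)
    ultimately show ?thesis by (rule continuous_on_eq)
  qed
  have osc: "oscillation_property \<phi>"
    unfolding oscillation_property_def ldet_eq_det
  proof (intro allI impI, elim conjE)
    fix r and s :: "nat \<Rightarrow> real"
    assume s: "strict_mono_on {..<r} s" "\<forall>j<r. 0 \<le> s j"
    define sg :: real where "sg = (-1) ^ (r * (r - 1) div 2)"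
    have "(\<lambda>n. sg * ldet r (\<lambda>k l. \<Sum>j<n. a k j * (if l < r then e j (s l) else 0)))
       \<longlonglongrightarrow> sg * ldet r (\<lambda>k l. if l < r then \<phi> k (s l) else 0)"
    proof (intro tendsto_intros)
      fix k l
      show "(\<lambda>n. \<Sum>j<n. a k j * (if l < r then e j (s l) else 0)) \<longlonglongrightarrow> (if l < r then \<phi> k (s l) else 0)"
        using phi_sums[of "s l" k] s(2) by (cases "l < r") (auto simp: sums_def)
    qed
    moreover have "0 \<le> sg * ldet r (\<lambda>k l. \<Sum>j<n. a k j * (if l < r then e j (s l) else 0))" for n
    proof -
      define A where "A J = ldet r (\<lambda>l k. a k (J l))" for J
      define E where "E J = ldet r (\<lambda>l k. if k < r then e (J l) (s k) else 0)" for J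
      have Aalt: "A (J \<circ> \<tau>) = sgnr \<tau> * A J" if "\<tau> permutes {..<r}" for \<tau> J
        unfolding A_def o_def using ldet_permute_rows[OF that, where f = "\<lambda>l k. a k (J l)"] by simp
      have Ealt: "E (J \<circ> \<tau>) = sgnr \<tau> * E J" if "\<tau> permutes {..<r}" for \<tau> J
        unfolding E_def o_def
        using ldet_permute_rows[OF that, where f = "\<lambda>l k. if k < r then e (J l) (s k) else 0"] by simp
      have sorted: "0 \<le> sg * (A J * E J)" if J: "strict_mono_on {..<r} J" for J
      proof -
        have "0 \<le> sg * A J"
          using signs[OF J] ldet_transpose[of r "\<lambda>k l. a k (J l)"] by (simp add: A_def sg_def)
        moreover have "E J = ldet r (\<lambda>k l. e (J k) (s l))" unfolding E_def by (rule ldet_cong) simp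
        then have "0 \<le> E J" using feature_minors[OF J s(1)] s(2) by simp
        ultimately show ?thesis by (simp add: mult.assoc[symmetric])
      qed
      have "0 \<le> sg * (A J * E J)" for J
      proof (cases "inj_on J {..<r}")
        case True
        then obtain \<tau> where t: "\<tau> permutes {..<r}" "strict_mono_on {..<r} (J \<circ> \<tau>)" using permutes_sorting by blast
        show ?thesis using sorted[OF t(2)] by (simp add: Aalt[OF t(1)] Ealt[OF t(1)] mult_ac)
      next
        case False
        have "A J = 0" by (rule alternating_eq_0[OF Aalt False])
        then show ?thesis by simp
      qed
      then have "0 \<le> (\<Sum>J\<in>tuples r n. sg * (A J * E J))" by (intro sum_nonneg)
      also have "\<dots> = fact r * (sg * ldet r (\<lambda>k l. \<Sum>j<n. a k j * (if l < r then e j (s l) else 0)))"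
        unfolding sum_distrib_left[symmetric] A_def E_def
        by (subst finite_Andreief[where A = a and B = "\<lambda>l j. if l < r then e j (s l) else 0"]) simp
      finally show ?thesis by (intro mult_left_le_imp_le[of "fact r" 0]) simp_all
    qed
    ultimately have "0 \<le> sg * ldet r (\<lambda>k l. if l < r then \<phi> k (s l) else 0)"
      by (intro LIMSEQ_le_const) auto
    also have "ldet r (\<lambda>k l. if l < r then \<phi> k (s l) else 0) = ldet r (\<lambda>k l. \<phi> k (s l))"
      by (rule ldet_cong) simp
    finally show "0 \<le> (-1) ^ (r * (r - 1) div 2) * ldet r (\<lambda>k l. \<phi> k (s l))" by (simp add: sg_def)
  qed
  show ?thesis by (rule that[OF pos dec classified phi_eig cont osc])
qed

end

section \<open>Determinacy of exponentially decaying moment problems\<close>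

lemma power_le_fact_exp:
  fixes x :: real
  assumes "0 \<le> x"
  shows "x ^ n \<le> fact n * exp x"
proof -
  have s: "(\<lambda>k. x ^ k / fact k) sums exp x"
    using exp_converges[of x] by (simp add: scaleR_conv_of_real divide_inverse mult.commute)
  have "x ^ n / fact n \<le> (\<Sum>k. x ^ k / fact k)"
    using sum_le_suminf[of "\<lambda>k. x ^ k / fact k" "{n}"] s assms by (auto simp: sums_iff)
  then show ?thesis using s by (simp add: sums_iff field_simps)
qed

text \<open>The factor \<open>2\<close> in the exponent leaves room for polynomial factors next to \<open>exp (c * \<bar>t\<bar>)\<close>.\<close>

locale exponentially_decaying =
  fixes M :: "real measure" and h :: "real \<Rightarrow> real" and c :: real
  assumes sigma: "sigma_finite_measure M" and sets_M [measurable_cong]: "sets M = sets borel"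
    and h_meas [measurable]: "h \<in> borel_measurable M"
    and c: "0 < c" and exp_int: "integrable M (\<lambda>t. h t * exp (2 * c * \<bar>t\<bar>))"
    and moments: "(\<integral>t. h t * t ^ n \<partial>M) = 0"
begin

lemma weighted_integrable: "integrable M (\<lambda>t. \<bar>h t\<bar> * \<bar>t\<bar> ^ n * exp (c * \<bar>t\<bar>))"
proof (rule Bochner_Integration.integrable_bound)
  show "integrable M (\<lambda>t. fact n / c ^ n * (h t * exp (2 * c * \<bar>t\<bar>)))" using exp_int by simp
  show "(\<lambda>t. \<bar>h t\<bar> * \<bar>t\<bar> ^ n * exp (c * \<bar>t\<bar>)) \<in> borel_measurable M" by measurable
  show "AE t in M. norm (\<bar>h t\<bar> * \<bar>t\<bar> ^ n * exp (c * \<bar>t\<bar>)) \<le> norm (fact n / c ^ n * (h t * exp (2 * c * \<bar>t\<bar>)))"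
  proof (intro AE_I2)
    fix t
    have "(c * \<bar>t\<bar>) ^ n \<le> fact n * exp (c * \<bar>t\<bar>)" using c by (intro power_le_fact_exp) simp
    then have "\<bar>t\<bar> ^ n \<le> fact n / c ^ n * exp (c * \<bar>t\<bar>)"
      using c by (simp add: power_mult_distrib field_simps)
    then have "\<bar>t\<bar> ^ n * exp (c * \<bar>t\<bar>) \<le> fact n / c ^ n * exp (c * \<bar>t\<bar>) * exp (c * \<bar>t\<bar>)"
      by (rule mult_right_mono) simp
    also have "\<dots> = fact n / c ^ n * exp (2 * c * \<bar>t\<bar>)"
      by (simp add: mult.assoc exp_add[symmetric] flip: mult_2)
    finally have "\<bar>h t\<bar> * (\<bar>t\<bar> ^ n * exp (c * \<bar>t\<bar>)) \<le> \<bar>h t\<bar> * (fact n / c ^ n * exp (2 * c * \<bar>t\<bar>))"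
      by (rule mult_left_mono) simp
    then show "norm (\<bar>h t\<bar> * \<bar>t\<bar> ^ n * exp (c * \<bar>t\<bar>)) \<le> norm (fact n / c ^ n * (h t * exp (2 * c * \<bar>t\<bar>)))"
      using c by (simp add: abs_mult mult_ac)
  qed
qed

lemma char_integrable: "integrable M (\<lambda>t. complex_of_real (h t * t ^ n) * exp (\<i> * complex_of_real (u * t)))"
proof (rule Bochner_Integration.integrable_bound[OF weighted_integrable[of n]])
  show "(\<lambda>t. complex_of_real (h t * t ^ n) * exp (\<i> * complex_of_real (u * t))) \<in> borel_measurable M" by measurable
  show "AE t in M. norm (complex_of_real (h t * t ^ n) * exp (\<i> * complex_of_real (u * t)))
      \<le> norm (\<bar>h t\<bar> * \<bar>t\<bar> ^ n * exp (c * \<bar>t\<bar>))"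
  proof (intro AE_I2)
    fix t
    have "\<bar>h t\<bar> * \<bar>t\<bar> ^ n * 1 \<le> \<bar>h t\<bar> * \<bar>t\<bar> ^ n * exp (c * \<bar>t\<bar>)"
      using c by (intro mult_left_mono) auto
    then show "norm (complex_of_real (h t * t ^ n) * exp (\<i> * complex_of_real (u * t)))
      \<le> norm (\<bar>h t\<bar> * \<bar>t\<bar> ^ n * exp (c * \<bar>t\<bar>))"
      by (simp add: norm_mult norm_power abs_mult power_abs)
  qed
qed

text \<open>The Fourier transform of \<open>h\<close> and all its derivatives vanish at \<open>u\<close>, and the Taylor series at \<open>u\<close> converges to it
up to distance \<open>c\<close>, whatever \<open>u\<close> is. So the zero set propagates in steps of length \<open>c\<close>.\<close>

lemma char_step:
  assumes zero: "\<And>n. (\<integral>t. complex_of_real (h t * t ^ n) * exp (\<i> * complex_of_real (u * t)) \<partial>M) = 0"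
    and v: "\<bar>v\<bar> \<le> c"
  shows "(\<integral>t. complex_of_real (h t * t ^ n) * exp (\<i> * complex_of_real ((u + v) * t)) \<partial>M) = 0"
proof -
  let ?f = "\<lambda>m t. (\<i> * complex_of_real v) ^ m / fact m * (complex_of_real (h t * t ^ (n + m)) * exp (\<i> * complex_of_real (u * t)))"
  have expand: "(\<lambda>m. ?f m t) sums (complex_of_real (h t * t ^ n) * exp (\<i> * complex_of_real ((u + v) * t)))" for t
  proof -
    have "(\<lambda>m. (\<i> * complex_of_real (v * t)) ^ m /\<^sub>R fact m) sums exp (\<i> * complex_of_real (v * t))"
      by (rule exp_converges)
    then have "(\<lambda>m. (complex_of_real (h t * t ^ n) * exp (\<i> * complex_of_real (u * t))) * ((\<i> * complex_of_real (v * t)) ^ m /\<^sub>R fact m))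
      sums ((complex_of_real (h t * t ^ n) * exp (\<i> * complex_of_real (u * t))) * exp (\<i> * complex_of_real (v * t)))"
      by (rule sums_mult)
    moreover have "(complex_of_real (h t * t ^ n) * exp (\<i> * complex_of_real (u * t))) * ((\<i> * complex_of_real (v * t)) ^ m /\<^sub>R fact m) = ?f m t" for m
      by (simp add: scaleR_conv_of_real power_mult_distrib power_add field_simps)
    moreover have "exp (\<i> * complex_of_real (u * t)) * exp (\<i> * complex_of_real (v * t)) = exp (\<i> * complex_of_real ((u + v) * t))"
      by (simp add: exp_add[symmetric] algebra_simps)
    ultimately show ?thesis by (simp add: mult.assoc)
  qed
  have norm_f: "norm (?f m t) = \<bar>h t\<bar> * \<bar>t\<bar> ^ n * ((\<bar>v\<bar> * \<bar>t\<bar>) ^ m / fact m)" for m t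
    by (simp add: norm_mult norm_divide norm_power abs_mult power_abs power_add power_mult_distrib)
  have int: "integrable M (?f m)" for m by (intro integrable_mult_right char_integrable)
  have exps: "(\<lambda>m. norm (?f m t)) sums (\<bar>h t\<bar> * \<bar>t\<bar> ^ n * exp (\<bar>v\<bar> * \<bar>t\<bar>))" for t
    unfolding norm_f using exp_converges[of "\<bar>v\<bar> * \<bar>t\<bar>"]
    by (intro sums_mult) (simp add: scaleR_conv_of_real divide_inverse mult.commute)
  have "summable (\<lambda>m. \<integral>t. norm (?f m t) \<partial>M)"
  proof (rule summableI_nonneg_bounded)
    fix N
    have "(\<Sum>m<N. \<integral>t. norm (?f m t) \<partial>M) = (\<integral>t. (\<Sum>m<N. norm (?f m t)) \<partial>M)"
      by (rule Bochner_Integration.integral_sum[symmetric]) (intro integrable_norm int)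
    also have "\<dots> \<le> (\<integral>t. \<bar>h t\<bar> * \<bar>t\<bar> ^ n * exp (c * \<bar>t\<bar>) \<partial>M)"
    proof (rule integral_mono[OF _ weighted_integrable])
      show "integrable M (\<lambda>t. \<Sum>m<N. norm (?f m t))" by (intro Bochner_Integration.integrable_sum integrable_norm int)
      fix t
      have "(\<Sum>m<N. norm (?f m t)) \<le> \<bar>h t\<bar> * \<bar>t\<bar> ^ n * exp (\<bar>v\<bar> * \<bar>t\<bar>)"
        using exps[of t] sum_le_suminf[of "\<lambda>m. norm (?f m t)" "{..<N}"] by (simp add: sums_iff)
      also have "\<dots> \<le> \<bar>h t\<bar> * \<bar>t\<bar> ^ n * exp (c * \<bar>t\<bar>)"
        using v by (intro mult_left_mono) (auto intro: mult_right_mono)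
      finally show "(\<Sum>m<N. norm (?f m t)) \<le> \<bar>h t\<bar> * \<bar>t\<bar> ^ n * exp (c * \<bar>t\<bar>)" .
    qed
    finally show "(\<Sum>m<N. \<integral>t. norm (?f m t) \<partial>M) \<le> (\<integral>t. \<bar>h t\<bar> * \<bar>t\<bar> ^ n * exp (c * \<bar>t\<bar>) \<partial>M)" .
  qed simp
  then have S: "(\<lambda>m. integral\<^sup>L M (?f m)) sums (\<integral>t. (\<Sum>m. ?f m t) \<partial>M)"
    using exps by (intro sums_integral int AE_I2) (blast intro: sums_summable)
  have Z: "integral\<^sup>L M (?f m) = 0" for m by (subst integral_mult_right_zero) (simp only: zero mult_zero_right)
  have "(\<lambda>m. 0) sums (\<integral>t. (\<Sum>m. ?f m t) \<partial>M)" using S by (simp only: Z)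
  then have "(\<integral>t. (\<Sum>m. ?f m t) \<partial>M) = 0" by (rule sums_unique2[OF _ sums_zero])
  moreover have "(\<Sum>m. ?f m t) = complex_of_real (h t * t ^ n) * exp (\<i> * complex_of_real ((u + v) * t))" for t
    using expand[of t] by (rule sums_unique[symmetric])
  ultimately show ?thesis by simp
qed

lemma char_zero: "(\<integral>t. complex_of_real (h t * t ^ n) * exp (\<i> * complex_of_real (u * t)) \<partial>M) = 0"
proof -
  obtain N :: nat where N: "\<bar>u\<bar> / c \<le> real N" using real_arch_simple by blast
  \<comment> \<open>\<open>N + 1\<close> steps of length at most \<open>c\<close> lead from \<open>0\<close> to \<open>u\<close>.\<close>
  define v where "v = u / real (Suc N)"
  have "\<bar>u\<bar> \<le> c * real N" using N c by (simp add: field_simps)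
  also have "\<dots> \<le> c * real (Suc N)" using c by (intro mult_left_mono) auto
  finally have "\<bar>u\<bar> / real (Suc N) \<le> c" by (subst pos_divide_le_eq) auto
  moreover have "\<bar>v\<bar> = \<bar>u\<bar> / real (Suc N)" unfolding v_def abs_divide abs_of_nat ..
  ultimately have v: "\<bar>v\<bar> \<le> c" by (simp only:)
  have "(\<integral>t. complex_of_real (h t * t ^ n) * exp (\<i> * complex_of_real (real m * v * t)) \<partial>M) = 0" for m n
  proof (induction m arbitrary: n)
    case 0
    have "(\<integral>t. complex_of_real (h t * t ^ n) \<partial>M) = complex_of_real (\<integral>t. h t * t ^ n \<partial>M)"
      by (rule integral_complex_of_real)
    then show ?case by (simp add: moments)
  next
    case (Suc m)
    have "real (Suc m) * v = real m * v + v" by (simp add: algebra_simps)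
    then show ?case using char_step[OF Suc v] by (simp only:)
  qed
  from this[of n "Suc N"] show ?thesis by (simp add: v_def)
qed

text \<open>The positive and the negative part of \<open>h\<close> define, after normalisation, probability measures with the same
characteristic function, so they agree by Levy's uniqueness theorem.\<close>

theorem vanishes: "AE t in M. h t = 0"
proof -
  interpret sigma_finite_measure M by (rule sigma)
  define hp hm where "hp t = max 0 (h t)" and "hm t = max 0 (- h t)" for t
  have [measurable]: "hp \<in> borel_measurable M" "hm \<in> borel_measurable M" unfolding hp_def hm_def by measurable
  have diff: "hp t - hm t = h t" for t by (simp add: hp_def hm_def max_def)
  have h_int: "integrable M h"
    by (rule Bochner_Integration.integrable_bound[OF weighted_integrable[of 0]])
       (use c in \<open>auto intro!: AE_I2 mult_le_cancel_left1[THEN iffD2] simp: abs_mult\<close>)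
  have pm_int: "integrable M hp" "integrable M hm" unfolding hp_def hm_def using h_int by auto
  define m where "m = integral\<^sup>L M hp"
  have "integral\<^sup>L M hp - integral\<^sup>L M hm = integral\<^sup>L M h"
    by (subst Bochner_Integration.integral_diff[symmetric]) (simp_all add: pm_int diff)
  also have "\<dots> = 0" using moments[of 0] by simp
  finally have m2: "integral\<^sup>L M hm = m" by (simp add: m_def)
  have m0: "0 \<le> m" unfolding m_def by (rule integral_nonneg_AE) (simp add: hp_def)
  show ?thesis
  proof (cases "m = 0")
    case True
    have "AE t in M. hp t = 0" "AE t in M. hm t = 0"
      using True m2 pm_int integral_nonneg_eq_0_iff_AE[of M hp] integral_nonneg_eq_0_iff_AE[of M hm]
      by (simp_all add: m_def hp_def hm_def)
    then show ?thesis by eventually_elim (simp add: diff[symmetric])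
  next
    case False
    then have m: "0 < m" using m0 by simp
    define D where "D g = density M (\<lambda>t. ennreal (g t / m))" for g :: "real \<Rightarrow> real"
    have dist: "real_distribution (D g)"
      if [measurable]: "g \<in> borel_measurable M" and "\<And>t. 0 \<le> g t" "integrable M g" "integral\<^sup>L M g = m" for g
    proof -
      have "(\<integral>\<^sup>+t. ennreal (g t / m) \<partial>M) = ennreal (\<integral>t. g t / m \<partial>M)"
        using that m by (intro nn_integral_eq_integral) auto
      also have "\<dots> = 1" using that m by simp
      finally have "prob_space (D g)"
        unfolding D_def by (intro prob_spaceI) (simp add: emeasure_density cong: nn_integral_cong)
      then show ?thesis unfolding real_distribution_def real_distribution_axioms_def
        by (simp add: D_def sets_M)
    qed
    have chars: "char (D g) u = (\<integral>t. complex_of_real (g t) * exp (\<i> * complex_of_real (u * t)) \<partial>M) / complex_of_real m"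
      if [measurable]: "g \<in> borel_measurable M" and "\<And>t. 0 \<le> g t" for g u
    proof -
      have "char (D g) u = (\<integral>t. (g t / m) *\<^sub>R exp (\<i> * complex_of_real (u * t)) \<partial>M)"
        unfolding char_def D_def using that m by (subst integral_density) auto
      also have "\<dots> = (\<integral>t. (complex_of_real (g t) * exp (\<i> * complex_of_real (u * t))) / complex_of_real m \<partial>M)"
        by (simp add: scaleR_conv_of_real)
      finally show ?thesis by simp
    qed
    have cint: "integrable M (\<lambda>t. complex_of_real (g t) * exp (\<i> * complex_of_real (u * t)))"
      if [measurable]: "g \<in> borel_measurable M" and "integrable M g" for g u
      by (rule Bochner_Integration.integrable_bound[OF that(2)]) (auto simp: norm_mult)
    have "char (D hp) = char (D hm)"
    proof
      fix u
      have "(\<integral>t. complex_of_real (hp t) * exp (\<i> * complex_of_real (u * t)) \<partial>M)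
        - (\<integral>t. complex_of_real (hm t) * exp (\<i> * complex_of_real (u * t)) \<partial>M)
        = (\<integral>t. complex_of_real (hp t - hm t) * exp (\<i> * complex_of_real (u * t)) \<partial>M)"
        unfolding of_real_diff left_diff_distrib
        by (rule Bochner_Integration.integral_diff[symmetric]; intro cint pm_int; measurable)
      also have "\<dots> = 0" using char_zero[of 0 u] by (simp add: diff)
      finally show "char (D hp) u = char (D hm) u"
        by (simp add: chars hp_def hm_def)
    qed
    then have "D hp = D hm"
      using m2 pm_int by (intro Levy_uniqueness dist) (auto simp: hp_def hm_def m_def)
    then have "AE t in M. ennreal (hp t / m) = ennreal (hm t / m)"
      unfolding D_def by (intro density_unique) auto
    then show ?thesis
    proof eventually_elim
      case (elim t)
      then have "hp t / m = hm t / m"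
        using m by (subst (asm) ennreal_inj) (auto simp: hp_def hm_def)
      then show ?case using m diff[of t] by simp
    qed
  qed
qed

end

section \<open>The gamma distribution and the two kernels\<close>

definition gamma_dens :: "real \<Rightarrow> real \<Rightarrow> real" where
  "gamma_dens a x = (if 0 < x then x powr (a - 1) * exp (- x) / Gamma a else 0)"

lemma gamma_measure_eq: "gamma_measure a = density lborel (\<lambda>x. ennreal (gamma_dens a x))"
  by (simp add: gamma_measure_def gamma_dens_def)

lemma gamma_dens_measurable [measurable]: "gamma_dens a \<in> borel_measurable borel"
  unfolding gamma_dens_def by measurable

lemma sets_gamma_measure [measurable_cong, simp]: "sets (gamma_measure a) = sets borel"
  by (simp add: gamma_measure_def)

lemma Gamma_nn_integral_scaled:
  fixes a b :: real
  assumes a: "0 < a" and b: "0 < b"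
  shows "(\<integral>\<^sup>+t. ennreal (if 0 < t then t powr (a - 1) * exp (- (b * t)) else 0) \<partial>lborel) = ennreal (Gamma a / b powr a)"
proof -
  let ?g = "\<lambda>b t. ennreal (if 0 < t then t powr (a - 1) * exp (- (b * t)) else (0::real))"
  have "(\<integral>\<^sup>+t. ennreal (indicator {0..} t * (t powr (a - 1) / exp t)) \<partial>lborel) = ennreal (Gamma a)"
    using nn_integral_has_integral_lebesgue[OF _ Gamma_integral_real[OF a]] by simp
  also have "(\<integral>\<^sup>+t. ennreal (indicator {0..} t * (t powr (a - 1) / exp t)) \<partial>lborel) = (\<integral>\<^sup>+t. ?g 1 t \<partial>lborel)"
    by (intro nn_integral_cong) (auto simp: indicator_def exp_minus divide_inverse)
  finally have 1: "(\<integral>\<^sup>+t. ?g 1 t \<partial>lborel) = ennreal (Gamma a)" .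
  have "(\<integral>\<^sup>+t. ?g 1 t \<partial>lborel) = \<bar>b\<bar> * (\<integral>\<^sup>+t. ?g 1 (0 + b * t) \<partial>lborel)"
    by (rule nn_integral_real_affine) (use b in auto)
  also have "(\<lambda>t. ?g 1 (0 + b * t)) = (\<lambda>t. ennreal (b powr (a - 1)) * ?g b t)"
    using b by (auto simp: fun_eq_iff powr_mult zero_less_mult_iff ennreal_mult' mult.assoc)
  also have "\<bar>b\<bar> * (\<integral>\<^sup>+t. ennreal (b powr (a - 1)) * ?g b t \<partial>lborel) = ennreal (b powr a) * (\<integral>\<^sup>+t. ?g b t \<partial>lborel)"
    using b by (subst nn_integral_cmult) (auto simp: mult.assoc[symmetric] ennreal_mult'[symmetric] powr_diff)
  finally have 2: "ennreal (b powr a) * (\<integral>\<^sup>+t. ?g b t \<partial>lborel) = ennreal (Gamma a)" using 1 by simp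
  have "(\<integral>\<^sup>+t. ?g b t \<partial>lborel) = ennreal (1 / b powr a) * (ennreal (b powr a) * (\<integral>\<^sup>+t. ?g b t \<partial>lborel))"
    using b by (simp add: mult.assoc[symmetric] ennreal_mult'[symmetric])
  also have "\<dots> = ennreal (Gamma a / b powr a)"
    unfolding 2 using b by (simp add: ennreal_mult'[symmetric])
  finally show ?thesis .
qed

lemma gamma_moment:
  fixes a l :: real
  assumes a: "0 < a" and l: "-1 < l"
  shows gamma_moment_integrable: "integrable (gamma_measure a) (\<lambda>t. t ^ n * exp (- (l * t)))"
    and gamma_moment_value: "(\<integral>t. t ^ n * exp (- (l * t)) \<partial>gamma_measure a) = pochhammer a n / (1 + l) powr (a + real n)"
proof -
  let ?g = "\<lambda>t. if 0 < t then t powr (a + real n - 1) * exp (- ((1 + l) * t)) else (0::real)"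
  have dens: "gamma_dens a t *\<^sub>R (t ^ n * exp (- (l * t))) = ?g t / Gamma a" for t
    by (auto simp: gamma_dens_def powr_add powr_diff powr_realpow exp_add[symmetric] algebra_simps exp_diff exp_minus divide_simps)
  have "has_bochner_integral lborel ?g (Gamma (a + real n) / (1 + l) powr (a + real n))"
    using Gamma_nn_integral_scaled[of "a + real n" "1 + l"] a l Gamma_real_pos[of "a + real n"]
    by (intro has_bochner_integral_nn_integral) auto
  from has_bochner_integral_divide_zero[OF this, of "Gamma a"]
  have hb: "has_bochner_integral lborel (\<lambda>t. gamma_dens a t *\<^sub>R (t ^ n * exp (- (l * t))))
      (Gamma (a + real n) / (1 + l) powr (a + real n) / Gamma a)"
    unfolding dens .
  have nn: "AE t in lborel. 0 \<le> gamma_dens a t"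
    using Gamma_real_pos[OF a] by (intro AE_I2) (simp add: gamma_dens_def)
  show "integrable (gamma_measure a) (\<lambda>t. t ^ n * exp (- (l * t)))"
    unfolding gamma_measure_eq using hb nn by (subst integrable_density) (auto simp: has_bochner_integral_iff)
  have "(\<integral>t. t ^ n * exp (- (l * t)) \<partial>gamma_measure a) = Gamma (a + real n) / (1 + l) powr (a + real n) / Gamma a"
    unfolding gamma_measure_eq using hb nn by (subst integral_density) (auto simp: has_bochner_integral_iff)
  also have "\<dots> = pochhammer a n / (1 + l) powr (a + real n)"
    using a by (subst pochhammer_Gamma) (auto simp: nonpos_Ints_def)
  finally show "(\<integral>t. t ^ n * exp (- (l * t)) \<partial>gamma_measure a) = pochhammer a n / (1 + l) powr (a + real n)" .
qed

lemma AE_gamma_pos: "AE t in gamma_measure a. 0 < t"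
  unfolding gamma_measure_eq by (subst AE_density) (auto simp: gamma_dens_def)

lemma sigma_finite_gamma:
  assumes "0 < a"
  shows "sigma_finite_measure (gamma_measure a)"
proof -
  have "integrable (gamma_measure a) (\<lambda>t. 1::real)" using gamma_moment_integrable[OF assms, of 0 0] by simp
  then have "finite_measure (gamma_measure a)"
    by (intro finite_measureI) (auto simp: integrable_iff_bounded less_top[symmetric])
  then show ?thesis by (simp add: finite_measure_def)
qed

lemma gamma_charges_intervals:
  assumes "0 < a"
  shows "0 < emeasure (gamma_measure a) {real l<..<real l + 1}"
proof (rule ccontr)
  assume "\<not> 0 < emeasure (gamma_measure a) {real l<..<real l + 1}"
  then have "emeasure (gamma_measure a) {real l<..<real l + 1} = 0" by simp
  then have "(\<integral>\<^sup>+x. ennreal (gamma_dens a x) * indicator {real l<..<real l + 1} x \<partial>lborel) = 0"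
    by (simp add: gamma_measure_eq emeasure_density)
  then have "AE x in lborel. ennreal (gamma_dens a x) * indicator {real l<..<real l + 1} x = 0"
    by (subst (asm) nn_integral_0_iff_AE) auto
  then have "AE x in lborel. x \<notin> {real l<..<real l + 1}"
  proof eventually_elim
    case (elim x)
    show ?case
    proof
      assume x: "x \<in> {real l<..<real l + 1}"
      then have "0 < x" by (auto intro: order_le_less_trans[of 0 "real l"])
      then have "0 < gamma_dens a x" using Gamma_real_pos[OF assms] by (simp add: gamma_dens_def)
      then show False using elim x by (simp add: indicator_def)
    qed
  qed
  moreover have "{x \<in> space lborel. \<not> x \<notin> {real l<..<real l + 1}} = {real l<..<real l + 1}" by auto
  ultimately have "emeasure lborel {real l<..<real l + 1} = 0"
    using AE_iff_measurable[of "{real l<..<real l + 1}" lborel "\<lambda>x. x \<notin> {real l<..<real l + 1}"] by simp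
  moreover have "emeasure lborel {real l<..<real l + 1} = 1" by (subst emeasure_lborel_Ioo) auto
  ultimately show False by simp
qed

text \<open>The functions \<open>t ^ n * exp (- (l * t))\<close> have square-integrable products with \<open>exp (c * \<bar>t\<bar>)\<close> for \<open>c < 1/2\<close>, because
the density decays like \<open>exp (- t)\<close>. Hence \<open>t ^ p * exp (- (l * t)) * f t\<close> satisfies the hypotheses of the
moment problem. Discarding the first \<open>p\<close> monomials is harmless since \<open>t ^ p\<close> has no positive zero.\<close>

theorem gamma_exponential_monomials_complete:
  assumes a: "0 < a" and l: "0 \<le> l" and f: "f \<in> L2 (gamma_measure a)"
    and zero: "\<And>n. p \<le> n \<Longrightarrow> (LINT t|gamma_measure a. complex_of_real (t ^ n * exp (- (l * t))) * f t) = 0"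
  shows "AE t in gamma_measure a. f t = 0"
proof -
  let ?M = "gamma_measure a"
  have f_meas [measurable]: "f \<in> borel_measurable ?M" using f by (rule L2_measurable)
  have wL2: "(\<lambda>t. complex_of_real (t ^ n * exp (- (l * t)) * exp (c * \<bar>t\<bar>))) \<in> L2 ?M" if c: "c < 1/2" for n c
  proof (rule L2_of_real)
    show "(\<lambda>t. t ^ n * exp (- (l * t)) * exp (c * \<bar>t\<bar>)) \<in> borel_measurable ?M" by measurable
    show "integrable ?M (\<lambda>t. (t ^ n * exp (- (l * t)) * exp (c * \<bar>t\<bar>))\<^sup>2)"
    proof (rule integrable_cong_AE_imp)
      show "integrable ?M (\<lambda>t. t ^ (2 * n) * exp (- ((2 * l - 2 * c) * t)))"
        using c l by (intro gamma_moment_integrable[OF a]) auto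
      show "AE t in ?M. t ^ (2 * n) * exp (- ((2 * l - 2 * c) * t)) = (t ^ n * exp (- (l * t)) * exp (c * \<bar>t\<bar>))\<^sup>2"
        using AE_gamma_pos[of a]
      proof eventually_elim
        case (elim t)
        have "exp (- ((2 * l - 2 * c) * t)) = (exp (- (l * t)) * exp (c * \<bar>t\<bar>))\<^sup>2"
          using elim by (simp add: power2_eq_square exp_add[symmetric] algebra_simps)
        then show ?case by (simp add: power_mult_distrib power_even_eq)
      qed
    qed measurable
  qed
  have fw: "integrable ?M (\<lambda>t. complex_of_real (t ^ n * exp (- (l * t)) * exp (c * \<bar>t\<bar>)) * f t)" if "c < 1/2" for n c
    using L2_mult_integrable[OF wL2[OF that] f] .
  have main: "AE t in ?M. g t = 0"
    if g_meas [measurable]: "g \<in> borel_measurable ?M"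
      and g_int: "\<And>n c. c < 1/2 \<Longrightarrow> integrable ?M (\<lambda>t. t ^ n * exp (- (l * t)) * exp (c * \<bar>t\<bar>) * g t)"
      and g_zero: "\<And>n. p \<le> n \<Longrightarrow> (\<integral>t. t ^ n * exp (- (l * t)) * g t \<partial>?M) = 0" for g :: "real \<Rightarrow> real"
  proof -
    have m: "(\<lambda>t. t ^ p * exp (- (l * t)) * g t) \<in> borel_measurable ?M" by measurable
    have e: "integrable ?M (\<lambda>t. t ^ p * exp (- (l * t)) * g t * exp (2 * (1/8) * \<bar>t\<bar>))"
      using g_int[of "1/4" p] by (simp add: mult_ac)
    have z: "(\<integral>t. t ^ p * exp (- (l * t)) * g t * t ^ n \<partial>?M) = 0" for n
      using g_zero[of "p + n"] by (simp add: power_add mult_ac)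
    interpret exponentially_decaying ?M "\<lambda>t. t ^ p * exp (- (l * t)) * g t" "1/8"
      by (rule exponentially_decaying.intro[OF sigma_finite_gamma[OF a] sets_gamma_measure m _ e z]) simp
    show ?thesis using vanishes AE_gamma_pos[of a] by eventually_elim simp
  qed
  have "AE t in ?M. Re (f t) = 0"
  proof (rule main)
    show "integrable ?M (\<lambda>t. t ^ n * exp (- (l * t)) * exp (c * \<bar>t\<bar>) * Re (f t))" if "c < 1/2" for n c
      using integrable_Re[OF fw[OF that, of n]] by simp
    show "(\<integral>t. t ^ n * exp (- (l * t)) * Re (f t) \<partial>?M) = 0" if "p \<le> n" for n
      using integral_Re[OF fw[of 0 n]] zero[OF that] by simp
  qed measurable
  moreover have "AE t in ?M. Im (f t) = 0"
  proof (rule main)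
    show "integrable ?M (\<lambda>t. t ^ n * exp (- (l * t)) * exp (c * \<bar>t\<bar>) * Im (f t))" if "c < 1/2" for n c
      using integrable_Im[OF fw[OF that, of n]] by simp
    show "(\<integral>t. t ^ n * exp (- (l * t)) * Im (f t) \<partial>?M) = 0" if "p \<le> n" for n
      using integral_Im[OF fw[of 0 n]] zero[OF that] by simp
  qed measurable
  ultimately show ?thesis by eventually_elim (simp add: complex_eq_iff)
qed

definition gamma_feature :: "real \<Rightarrow> nat \<Rightarrow> real \<Rightarrow> real" where
  "gamma_feature a j s = sqrt (1 / (fact j * pochhammer a j)) * (s / a) ^ j * exp (- (s / a))"

lemma gamma_feature_mult:
  assumes "0 < a"
  shows "gamma_feature a j s * gamma_feature a j t = (s * t / a\<^sup>2) ^ j / (fact j * pochhammer a j) * exp (- (s + t) / a)"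
proof -
  have "sqrt (1 / (fact j * pochhammer a j)) * sqrt (1 / (fact j * pochhammer a j)) = 1 / (fact j * pochhammer a j)"
    using pochhammer_pos[OF assms, of j] by simp
  then have "gamma_feature a j s * gamma_feature a j t = 1 / (fact j * pochhammer a j) * ((s / a) ^ j * (t / a) ^ j) * (exp (- (s / a)) * exp (- (t / a)))"
    unfolding gamma_feature_def by (simp add: mult_ac)
  also have "(s / a) ^ j * (t / a) ^ j = (s * t / a\<^sup>2) ^ j"
    by (simp add: power_mult_distrib[symmetric] power2_eq_square)
  also have "exp (- (s / a)) * exp (- (t / a)) = exp (- (s + t) / a)"
    by (simp add: exp_add[symmetric] diff_divide_distrib)
  finally show ?thesis by simp
qed

lemma fact_pochhammer_ge:
  assumes "(1/2 :: real) \<le> a"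
  shows "fact (2 * j) / 4 ^ j \<le> fact j * pochhammer a j"
proof -
  have "pochhammer (1/2) j \<le> pochhammer a j"
    unfolding pochhammer_prod using assms by (intro prod_mono) auto
  then have "fact j * pochhammer (1/2) j \<le> fact j * pochhammer a j" by simp
  moreover have "fact (2 * j) / 4 ^ j = fact j * pochhammer (1/2 :: real) j"
    by (simp add: fact_double power_mult)
  ultimately show ?thesis by simp
qed

text \<open>The bound comes from \<open>j! (a)\<^sub>j \<ge> (2j)!/4\<^bsup>j\<^esup>\<close> and \<open>x\<^bsup>n\<^esup>/n! \<le> exp x\<close>, applied with \<open>x = 2hs/a\<close> where \<open>h = 1 + a/8\<close>. Any
\<open>h > 1\<close> produces the geometric factor; the growth \<open>exp ((h - 1) s / a) = exp (s/8)\<close> that it costs stays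
square-integrable for the gamma distribution.\<close>

lemma gamma_feature_le:
  assumes a: "1/2 \<le> a" and s: "0 \<le> s"
  shows "\<bar>gamma_feature a j s\<bar> \<le> (1 / (1 + a/8)) ^ j * exp (s / 8)"
proof (rule power2_le_imp_le)
  define h where "h = 1 + a/8"
  have h: "0 < h" "0 < a" using a by (simp_all add: h_def)
  have "(s * s / a\<^sup>2) ^ j = (s / a) ^ (2 * j)" by (simp add: power_mult power_divide power2_eq_square)
  then have "\<bar>gamma_feature a j s\<bar>\<^sup>2 = (s / a) ^ (2 * j) / (fact j * pochhammer a j) * exp (- (2 * s / a))"
    using gamma_feature_mult[of a j s s] h by (simp add: power2_eq_square)
  also have "\<dots> \<le> (s / a) ^ (2 * j) / (fact (2 * j) / 4 ^ j) * exp (- (2 * s / a))"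
    using fact_pochhammer_ge[OF a, of j] s h
      pochhammer_pos[OF h(2), of j]
    by (intro mult_right_mono divide_left_mono) auto
  also have "\<dots> = (1 / h) ^ (2 * j) * ((2 * h * s / a) ^ (2 * j) / fact (2 * j)) * exp (- (2 * s / a))"
    using h by (simp add: power_mult_distrib power_divide power_mult)
  also have "\<dots> \<le> (1 / h) ^ (2 * j) * exp (2 * h * s / a) * exp (- (2 * s / a))"
    using power_le_fact_exp[of "2 * h * s / a" "2 * j"] s h
    by (intro mult_right_mono mult_left_mono) (simp_all add: field_simps)
  also have "\<dots> = (1 / h) ^ (2 * j) * exp (2 * h * s / a - 2 * s / a)"
    by (simp add: exp_diff exp_minus divide_inverse)
  also have "2 * h * s / a - 2 * s / a = s / 4"
    using h by (simp add: h_def field_simps)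
  also have "(1 / h) ^ (2 * j) * exp (s / 4) = ((1 / h) ^ j * exp (s / 8))\<^sup>2"
    by (simp add: power_mult_distrib power_even_eq power2_eq_square exp_add[symmetric])
  finally show "\<bar>gamma_feature a j s\<bar>\<^sup>2 \<le> ((1 / (1 + a/8)) ^ j * exp (s / 8))\<^sup>2" by (simp add: h_def)
  show "0 \<le> (1 / (1 + a/8)) ^ j * exp (s / 8)" using h by (simp add: h_def)
qed

text \<open>With \<open>\<nu> = a - 1\<close> and argument \<open>2 * sqrt x\<close> the fractional powers cancel against the prefactor and an
ordinary power series remains.\<close>

lemma bessel_I_scaled_sums:
  assumes a: "1/2 \<le> a" and x: "0 \<le> x"
  shows "(\<lambda>j. x ^ j / (fact j * pochhammer a j)) sums (Gamma a * bessel_I_scaled a x)"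
proof -
  have a0: "0 < a" using a by simp
  have G: "0 < Gamma a" using Gamma_real_pos[OF a0] .
  have summ: "summable (\<lambda>j. x ^ j / (fact j * pochhammer a j))"
  proof (rule summable_comparison_test')
    show "summable (\<lambda>j. (2 * x) ^ j /\<^sub>R fact j)" by (rule summable_exp_generic)
    fix j
    have "(1/2) ^ j \<le> pochhammer a j"
    proof (induction j)
      case (Suc j)
      have "(1/2) ^ j * (1/2) \<le> pochhammer a j * (a + real j)"
        using Suc a by (intro mult_mono) (auto intro!: pochhammer_nonneg)
      then show ?case by (simp add: pochhammer_Suc mult.commute)
    qed simp
    then have "x ^ j / (fact j * pochhammer a j) \<le> x ^ j / (fact j * (1/2) ^ j)"
      using x by (intro divide_left_mono mult_left_mono mult_pos_pos pochhammer_pos a0) auto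
    also have "\<dots> = (2 * x) ^ j /\<^sub>R fact j"
      by (simp add: power_mult_distrib power_divide divide_simps)
    finally show "norm (x ^ j / (fact j * pochhammer a j)) \<le> (2 * x) ^ j /\<^sub>R fact j"
      using x pochhammer_pos[OF a0, of j] by simp
  qed
  show ?thesis
  proof (cases "x = 0")
    case True
    have "(\<lambda>j. x ^ j / (fact j * pochhammer a j)) = (\<lambda>j. if j = 0 then 1 else 0)"
      using True by (auto simp: fun_eq_iff power_0_left)
    then have "(\<lambda>j. x ^ j / (fact j * pochhammer a j)) sums 1"
      using sums_single[of 0 "\<lambda>_. 1::real"] by simp
    then show ?thesis using True G by (simp add: bessel_I_scaled_def)
  next
    case False
    then have x: "0 < x" using x by simp
    have Gj: "Gamma (a + real j) = Gamma a * pochhammer a j" for j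
    proof -
      have "a \<notin> \<int>\<^sub>\<le>\<^sub>0" using a0 by (auto simp: nonpos_Ints_def)
      then have "pochhammer a j = Gamma (a + real j) / Gamma a" by (rule pochhammer_Gamma)
      then show ?thesis using G by (metis less_irrefl nonzero_mult_div_cancel_left times_divide_eq_right)
    qed
    have terms: "1 / (fact j * Gamma (a - 1 + 1 + real j)) * (2 * sqrt x / 2) powr (2 * real j + (a - 1))
      = x powr ((a - 1) / 2) / Gamma a * (x ^ j / (fact j * pochhammer a j))" for j
    proof -
      have "(2 * sqrt x / 2) powr (2 * real j + (a - 1)) = x powr (real j + (a - 1) / 2)"
        using x by (simp add: powr_half_sqrt[symmetric] powr_powr algebra_simps add_divide_distrib diff_divide_distrib)
      also have "\<dots> = x ^ j * x powr ((a - 1) / 2)" using x by (simp add: powr_add powr_realpow)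
      finally show ?thesis using Gj[of j] by (simp add: mult_ac)
    qed
    have "bessel_I (a - 1) (2 * sqrt x) = x powr ((a - 1) / 2) / Gamma a * (\<Sum>j. x ^ j / (fact j * pochhammer a j))"
      unfolding bessel_I_def terms using summ by (rule suminf_mult)
    moreover have "x powr ((1 - a) / 2) * x powr ((a - 1) / 2) = 1"
      using x by (simp add: powr_add[symmetric] add_divide_distrib[symmetric])
    ultimately have "Gamma a * bessel_I_scaled a x = (\<Sum>j. x ^ j / (fact j * pochhammer a j))"
      using G False by (simp add: bessel_I_scaled_def mult.assoc[symmetric])
    then show ?thesis using summ by (simp add: summable_sums)
  qed
qed

lemma K0_sums:
  assumes a: "1/2 \<le> a" and "0 \<le> s" "0 \<le> t"
  shows "(\<lambda>j. gamma_feature a j s * gamma_feature a j t) sums K0_kernel a s t"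
proof -
  have "0 < a" using a by simp
  have "(\<lambda>j. (s * t / a\<^sup>2) ^ j / (fact j * pochhammer a j)) sums (Gamma a * bessel_I_scaled a (s * t / a\<^sup>2))"
    using assms by (intro bessel_I_scaled_sums) auto
  from sums_mult2[OF this, of "exp (- (s + t) / a)"] show ?thesis
    unfolding gamma_feature_mult[OF \<open>0 < a\<close>] K0_kernel_def by (simp only: mult_ac)
qed

lemma K_sums:
  assumes a: "1/2 \<le> a" and "0 \<le> s" "0 \<le> t"
  shows "(\<lambda>j. gamma_feature a (j + 2) s * gamma_feature a (j + 2) t) sums K_kernel a s t"
proof -
  have a0: "0 < a" using a by simp
  have "(\<Sum>j<2. gamma_feature a j s * gamma_feature a j t) = exp (- (s + t) / a) * (s * t / a ^ 3 + 1)"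
    unfolding gamma_feature_mult[OF a0] using a0
    by (simp add: numeral_2_eq_2 power2_eq_square power3_eq_cube algebra_simps)
  then show ?thesis
    using K0_sums[OF assms] sums_iff_shift[of "\<lambda>j. gamma_feature a j s * gamma_feature a j t" 2 "K_kernel a s t"]
    by (simp add: K_kernel_def)
qed

lemma K0_measurable [measurable]: "K0_kernel a s \<in> borel_measurable borel"
  unfolding K0_kernel_def bessel_I_scaled_def bessel_I_def by measurable

lemma K_measurable [measurable]: "K_kernel a s \<in> borel_measurable borel"
  unfolding K_kernel_def by measurable

lemma gamma_feature_measurable [measurable]: "gamma_feature a j \<in> borel_measurable borel"
  unfolding gamma_feature_def by measurable

definition feature_weight :: "real \<Rightarrow> nat \<Rightarrow> real" where
  "feature_weight a j = sqrt (1 / (fact j * pochhammer a j)) / a ^ j"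

lemma gamma_feature_eq_weight: "gamma_feature a j s = feature_weight a j * (s ^ j * exp (- (1 / a * s)))"
  by (simp add: gamma_feature_def feature_weight_def power_divide)

lemma feature_weight_pos: "0 < a \<Longrightarrow> 0 < feature_weight a j"
  by (simp add: feature_weight_def pochhammer_pos)

lemma ldet_gamma_feature:
  "ldet r (\<lambda>k l. gamma_feature a (I k + p) (s l)) =
    (\<Prod>k<r. feature_weight a (I k + p)) * (\<Prod>l<r. exp (- (1 / a * s l))) * ldet r (\<lambda>k l. s l ^ (I k + p))"
  unfolding ldet_scale[symmetric] gamma_feature_eq_weight by (simp add: mult_ac)

lemma strict_mono_on_shift: "strict_mono_on A I \<Longrightarrow> strict_mono_on A (\<lambda>k. I k + (p::nat))"
  by (simp add: strict_mono_on_def)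

theorem gamma_totally_positive_kernel:
  assumes a: "1/2 \<le> a"
    and k: "\<And>s t. 0 \<le> s \<Longrightarrow> 0 \<le> t \<Longrightarrow> (\<lambda>i. gamma_feature a (i + p) s * gamma_feature a (i + p) t) sums k s t"
    and km: "\<And>s. k s \<in> borel_measurable borel"
  shows "totally_positive_kernel (gamma_measure a) (\<lambda>i. gamma_feature a (i + p)) k (\<lambda>s. exp (s / 8)) (1 / (1 + a / 8))"
proof -
  let ?M = "gamma_measure a"
  have a0: "0 < a" using a by simp
  have q: "0 < 1 / (1 + a / 8)" "1 / (1 + a / 8) < 1" using a0 by simp_all
  have fk: "feature_kernel ?M (\<lambda>i. gamma_feature a (i + p)) k (\<lambda>s. exp (s / 8)) (1 / (1 + a / 8))"
  proof
    show "AE s in ?M. 0 \<le> s" using AE_gamma_pos[of a] by eventually_elim simp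
    show "gamma_feature a (i + p) \<in> borel_measurable ?M" for i by measurable
    show "(\<lambda>s. exp (s / 8)) \<in> borel_measurable ?M" by measurable
    show "integrable ?M (\<lambda>s. (exp (s / 8))\<^sup>2)"
      using gamma_moment_integrable[OF a0, of "-1/4" 0] by (simp add: power2_eq_square exp_add[symmetric])
    show "k s \<in> borel_measurable ?M" for s using km[of s] by measurable
    show "\<bar>gamma_feature a (i + p) s\<bar> \<le> (1 / (1 + a / 8)) ^ i * exp (s / 8)" if "0 \<le> s" for s i
    proof -
      have "(1 / (1 + a / 8)) ^ (i + p) \<le> (1 / (1 + a / 8)) ^ i"
        using q by (intro power_decreasing) auto
      then have "(1 / (1 + a / 8)) ^ (i + p) * exp (s / 8) \<le> (1 / (1 + a / 8)) ^ i * exp (s / 8)"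
        by (intro mult_right_mono) auto
      then show ?thesis using gamma_feature_le[OF a that, of "i + p"] by linarith
    qed
    show "AE t in ?M. f t = 0"
      if f: "f \<in> L2 ?M" and z: "\<And>i. (LINT t|?M. complex_of_real (gamma_feature a (i + p) t) * f t) = 0" for f
    proof (rule gamma_exponential_monomials_complete[OF a0 _ f])
      show "0 \<le> 1 / a" using a0 by simp
      fix n assume "p \<le> n"
      then have "(LINT t|?M. complex_of_real (gamma_feature a n t) * f t) = 0" using z[of "n - p"] by simp
      moreover have "(LINT t|?M. complex_of_real (gamma_feature a n t) * f t)
        = complex_of_real (feature_weight a n) * (LINT t|?M. complex_of_real (t ^ n * exp (- (1 / a * t))) * f t)"
        unfolding gamma_feature_eq_weight of_real_mult[of "feature_weight a n"] mult.assoc by (rule integral_mult_right_zero)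
      ultimately show "(LINT t|?M. complex_of_real (t ^ n * exp (- (1 / a * t))) * f t) = 0"
        using feature_weight_pos[OF a0, of n] by simp
    qed
  qed (use q k in auto)
  interpret feature_kernel ?M "\<lambda>i. gamma_feature a (i + p)" k "\<lambda>s. exp (s / 8)" "1 / (1 + a / 8)" by (rule fk)
  have pos: "0 < ldet r (\<lambda>k l. gamma_feature a (I k + p) (s l))"
    if "strict_mono_on {..<r} I" "strict_mono_on {..<r} s" "\<And>l. l < r \<Longrightarrow> 0 < s l" for r I s
    unfolding ldet_gamma_feature using that
    by (intro mult_pos_pos prod_pos ballI feature_weight_pos a0 generalized_Vandermonde_pos strict_mono_on_shift) auto
  show ?thesis
  proof (intro totally_positive_kernel.intro fk totally_positive_kernel_axioms.intro)
    show "continuous_on {0..} (\<lambda>s::real. exp (s / 8))" by (intro continuous_intros) auto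
    show "continuous_on {0..} (gamma_feature a (i + p))" for i
      unfolding gamma_feature_def using a0 by (intro continuous_intros) auto
    show "0 < ldet r (\<lambda>k l. \<integral>s. gamma_feature a (I k + p) s * gamma_feature a (J l + p) s \<partial>?M)"
      if "strict_mono_on {..<r} I" "strict_mono_on {..<r} J" for r I J
    proof (rule gram_minor_pos[where e = "\<lambda>i. gamma_feature a (i + p)", OF sigma_finite_gamma[OF a0] sets_gamma_measure AE_gamma_pos
          gamma_charges_intervals[OF a0] e_meas _ pos that])
      have "integrable ?M (\<lambda>s. Re (complex_of_real (gamma_feature a (i + p) s) * complex_of_real (gamma_feature a (j + p) s)))" for i j
        by (intro integrable_Re L2_mult_integrable e_L2)
      then show "integrable ?M (\<lambda>s. gamma_feature a (i + p) s * gamma_feature a (j + p) s)" for i j by simp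
    qed
    show "0 \<le> ldet r (\<lambda>k l. gamma_feature a (I k + p) (t l))"
      if "strict_mono_on {..<r} I" "strict_mono_on {..<r} t" "\<And>l. l < r \<Longrightarrow> 0 \<le> t l" for r I t
      unfolding ldet_gamma_feature using that
      by (intro mult_nonneg_nonneg prod_nonneg ballI less_imp_le[OF feature_weight_pos[OF a0]]
          generalized_Vandermonde_nonneg strict_mono_on_shift) auto
  qed simp
qed

section \<open>Laguerre eigenfunctions\<close>

text \<open>Kummer's identity \<open>\<^sub>1F\<^sub>1(a+n; a; y) = exp y \<^sub>1F\<^sub>1(-n; a; -y)\<close> without division by Pochhammer
symbols. Both sides satisfy the recursion \<open>P a (n+1) = (a+n) P a n + y P (a+1) n\<close>, which for the series is
the splitting \<open>(a+i)\<^bsub>n+1\<^esub> = (a+n) (a+i)\<^sub>n + i (a+i)\<^sub>n\<close>.\<close>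

lemma Kummer_transformation:
  fixes a y :: real
  shows "(\<lambda>i. y ^ i / fact i * pochhammer (a + real i) n) sums
    (exp y * (\<Sum>m\<le>n. real (n choose m) * pochhammer (a + real m) (n - m) * y ^ m))"
proof (induction n arbitrary: a)
  case 0
  then show ?case using exp_converges[of y] by (simp add: scaleR_conv_of_real divide_inverse mult.commute)
next
  case (Suc n)
  define P where "P a n = (\<Sum>m\<le>n. real (n choose m) * pochhammer (a + real m) (n - m) * y ^ m)" for a :: real and n
  have IH: "(\<lambda>i. y ^ i / fact i * pochhammer (a + real i) n) sums (exp y * P a n)" for a
    unfolding P_def by (rule Suc)
  have "(\<lambda>i. y * (y ^ i / fact i * pochhammer ((a + 1) + real i) n)) sums (y * (exp y * P (a + 1) n))"
    by (intro sums_mult IH)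
  moreover have "y * (y ^ i / fact i * pochhammer ((a + 1) + real i) n)
      = real (Suc i) * (y ^ Suc i / fact (Suc i) * pochhammer (a + real (Suc i)) n)" for i
  proof -
    have e: "real (Suc i) / fact (Suc i) = 1 / fact i" by (subst fact_Suc) (simp del: of_nat_Suc)
    have arg: "a + real (Suc i) = (a + 1) + real i" by simp
    have "real (Suc i) * (y ^ Suc i / fact (Suc i) * p) = (real (Suc i) / fact (Suc i)) * (y * y ^ i * p)" for p :: real
      by simp
    then show ?thesis unfolding arg e by simp
  qed
  ultimately have "(\<lambda>i. real (Suc i) * (y ^ Suc i / fact (Suc i) * pochhammer (a + real (Suc i)) n)) sums (y * (exp y * P (a + 1) n))"
    by (simp only:)
  from sums_Suc[where f = "\<lambda>i. real i * (y ^ i / fact i * pochhammer (a + real i) n)", OF this]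
  have "(\<lambda>i. real i * (y ^ i / fact i * pochhammer (a + real i) n)) sums (y * (exp y * P (a + 1) n))"
    by simp
  moreover have "(\<lambda>i. (a + real n) * (y ^ i / fact i * pochhammer (a + real i) n)) sums ((a + real n) * (exp y * P a n))"
    by (intro sums_mult IH)
  ultimately have "(\<lambda>i. (a + real n) * (y ^ i / fact i * pochhammer (a + real i) n) + real i * (y ^ i / fact i * pochhammer (a + real i) n))
      sums ((a + real n) * (exp y * P a n) + y * (exp y * P (a + 1) n))"
    by (rule sums_add[rotated])
  moreover have "(a + real n) * (y ^ i / fact i * pochhammer (a + real i) n) + real i * (y ^ i / fact i * pochhammer (a + real i) n)
      = y ^ i / fact i * pochhammer (a + real i) (Suc n)" for i
    by (simp add: pochhammer_Suc algebra_simps add_divide_distrib)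
  moreover have "(a + real n) * P a n + y * P (a + 1) n = P a (Suc n)"
  proof -
    have 1: "(a + real n) * P a n = (\<Sum>m\<le>n. real (n choose m) * pochhammer (a + real m) (Suc n - m) * y ^ m)"
      unfolding P_def sum_distrib_left
    proof (intro sum.cong refl)
      fix m assume "m \<in> {..n}"
      then have "pochhammer (a + real m) (Suc n - m) = pochhammer (a + real m) (n - m) * (a + real n)"
        by (simp add: Suc_diff_le pochhammer_Suc of_nat_diff)
      then show "(a + real n) * (real (n choose m) * pochhammer (a + real m) (n - m) * y ^ m)
        = real (n choose m) * pochhammer (a + real m) (Suc n - m) * y ^ m" by simp
    qed
    have 2: "y * P (a + 1) n = (\<Sum>m\<le>n. real (n choose m) * pochhammer (a + real (Suc m)) (n - m) * y ^ Suc m)"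
      unfolding P_def sum_distrib_left by (intro sum.cong refl) (simp add: algebra_simps)
    have "P a (Suc n) = pochhammer a (Suc n) + (\<Sum>m\<le>n. real (Suc n choose Suc m) * pochhammer (a + real (Suc m)) (n - m) * y ^ Suc m)"
      unfolding P_def by (subst sum.atMost_Suc_shift) simp
    also have "\<dots> = (pochhammer a (Suc n) + (\<Sum>m\<le>n. real (n choose Suc m) * pochhammer (a + real (Suc m)) (n - m) * y ^ Suc m))
       + (\<Sum>m\<le>n. real (n choose m) * pochhammer (a + real (Suc m)) (n - m) * y ^ Suc m)"
      by (simp add: sum.distrib[symmetric] algebra_simps)
    also have "pochhammer a (Suc n) + (\<Sum>m\<le>n. real (n choose Suc m) * pochhammer (a + real (Suc m)) (n - m) * y ^ Suc m)
       = (\<Sum>m\<le>Suc n. real (n choose m) * pochhammer (a + real m) (Suc n - m) * y ^ m)"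
      by (subst sum.atMost_Suc_shift) simp
    also have "\<dots> = (\<Sum>m\<le>n. real (n choose m) * pochhammer (a + real m) (Suc n - m) * y ^ m)" by simp
    finally show ?thesis using 1 2 by simp
  qed
  then have "(a + real n) * (exp y * P a n) + y * (exp y * P (a + 1) n) = exp y * P a (Suc n)"
    by (metis (no_types, opaque_lifting) distrib_left mult.left_commute)
  ultimately show ?case by (simp only: P_def)
qed

lemma sum_triangle_swap: "(\<Sum>n\<le>k. \<Sum>m\<le>n. F n m) = (\<Sum>m\<le>k. \<Sum>n=m..k. (F n m :: real))" for k :: nat
proof -
  have "(\<Sum>n\<le>k. \<Sum>m\<le>n. F n m) = (\<Sum>n\<le>k. \<Sum>m\<le>k. if m \<le> n then F n m else 0)"
    by (intro sum.cong refl sum.mono_neutral_cong_left) auto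
  also have "\<dots> = (\<Sum>m\<le>k. \<Sum>n\<le>k. if m \<le> n then F n m else 0)" by (rule sum.swap)
  also have "\<dots> = (\<Sum>m\<le>k. \<Sum>n=m..k. F n m)"
    by (intro sum.cong refl sum.mono_neutral_cong_right) auto
  finally show ?thesis .
qed

text \<open>Substituting the images of the monomials into a Laguerre polynomial reproduces a Laguerre polynomial:
after exchanging the sums the inner one is the binomial expansion of \<open>(1 + z) ^ (k - m)\<close>.\<close>

lemma Laguerre_coefficient_identity:
  fixes a z y :: real
  shows "(\<Sum>n\<le>k. pochhammer (a + real n) (k - n) / fact (k - n) * (z ^ n / fact n)
            * (\<Sum>m\<le>n. real (n choose m) * pochhammer (a + real m) (n - m) * y ^ m))
      = (\<Sum>m\<le>k. pochhammer (a + real m) (k - m) / fact (k - m) * (1 + z) ^ (k - m) * ((z * y) ^ m / fact m))"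
proof -
  have "(\<Sum>n\<le>k. pochhammer (a + real n) (k - n) / fact (k - n) * (z ^ n / fact n)
            * (\<Sum>m\<le>n. real (n choose m) * pochhammer (a + real m) (n - m) * y ^ m))
     = (\<Sum>n\<le>k. \<Sum>m\<le>n. pochhammer (a + real m) (k - m) * y ^ m / fact m * (z ^ n / (fact (k - n) * fact (n - m))))"
    unfolding sum_distrib_left
  proof (intro sum.cong refl)
    fix n m assume nm: "n \<in> {..k}" "m \<in> {..n}"
    have "pochhammer (a + real m) (k - m) = pochhammer (a + real m) (n - m) * pochhammer (a + real n) (k - n)"
      using pochhammer_product[of "n - m" "k - m" "a + real m"] nm by (simp add: of_nat_diff)
    moreover have "real (n choose m) = fact n / (fact m * fact (n - m))" using nm by (simp add: binomial_fact)
    ultimately show "pochhammer (a + real n) (k - n) / fact (k - n) * (z ^ n / fact n)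
            * (real (n choose m) * pochhammer (a + real m) (n - m) * y ^ m)
        = pochhammer (a + real m) (k - m) * y ^ m / fact m * (z ^ n / (fact (k - n) * fact (n - m)))"
      by (simp add: field_simps)
  qed
  also have "\<dots> = (\<Sum>m\<le>k. \<Sum>n=m..k. pochhammer (a + real m) (k - m) * y ^ m / fact m * (z ^ n / (fact (k - n) * fact (n - m))))"
    by (rule sum_triangle_swap)
  also have "\<dots> = (\<Sum>m\<le>k. pochhammer (a + real m) (k - m) / fact (k - m) * (1 + z) ^ (k - m) * ((z * y) ^ m / fact m))"
  proof (intro sum.cong refl)
    fix m assume m: "m \<in> {..k}"
    have "(\<Sum>n=m..k. z ^ n / (fact (k - n) * fact (n - m))) = (\<Sum>l\<le>k - m. z ^ (l + m) / (fact (k - m - l) * fact l))"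
      using m by (intro sum.reindex_bij_witness[where i = "\<lambda>l. l + m" and j = "\<lambda>n. n - m"]) auto
    also have "\<dots> = (\<Sum>l\<le>k - m. z ^ m / fact (k - m) * (real (k - m choose l) * z ^ l * 1 ^ (k - m - l)))"
      by (intro sum.cong refl) (simp add: binomial_fact power_add field_simps)
    also have "\<dots> = z ^ m / fact (k - m) * (1 + z) ^ (k - m)"
      unfolding sum_distrib_left[symmetric] binomial_ring[symmetric] by (simp add: add.commute)
    finally show "(\<Sum>n=m..k. pochhammer (a + real m) (k - m) * y ^ m / fact m * (z ^ n / (fact (k - n) * fact (n - m))))
       = pochhammer (a + real m) (k - m) / fact (k - m) * (1 + z) ^ (k - m) * ((z * y) ^ m / fact m)"
      unfolding sum_distrib_left[symmetric] by (simp add: power_mult_distrib mult_ac)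
  qed
  finally show ?thesis .
qed

text \<open>The square of \<open>b_coeff\<close>. It is the root less than \<open>1\<close> of \<open>(1 - x)\<^sup>2 = a x\<close>, and the eigenvalues of \<open>S0_op\<close> form a
geometric sequence with ratio \<open>(contraction a)\<^sup>2\<close>.\<close>

definition contraction :: "real \<Rightarrow> real" where
  "contraction a = 1 + a * (1 - beta_coeff a) / 2"

lemma spectral_parameters:
  assumes "0 < a"
  shows beta_gt_1: "1 < beta_coeff a"
    and contraction_pos: "0 < contraction a" and contraction_less_1: "contraction a < 1"
    and contraction_eq: "(1 - contraction a)\<^sup>2 = a * contraction a"
    and contraction_beta: "a * beta_coeff a * contraction a = 1 - (contraction a)\<^sup>2"
    and contraction_rate: "1 + (1 / a + (beta_coeff a - 1) / 2) = 1 / (a * contraction a)"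
proof -
  define \<beta> where "\<beta> = beta_coeff a"
  define x where "x = contraction a"
  have b2: "a * \<beta>\<^sup>2 = a + 4" using assms by (simp add: \<beta>_def beta_coeff_def field_simps)
  have b1: "1 < \<beta>" unfolding \<beta>_def beta_coeff_def using assms by (simp add: field_simps)
  have x2: "2 * x = 2 + a - a * \<beta>" by (simp add: x_def contraction_def \<beta>_def field_simps)
  have "(a * \<beta>)\<^sup>2 = a * (a + 4)" using b2 by (simp add: power2_eq_square mult_ac)
  also have "\<dots> < (a + 2)\<^sup>2" by (simp add: power2_eq_square algebra_simps)
  finally have "a * \<beta> < a + 2" using assms by (intro power2_less_imp_less[of "a * \<beta>"]) auto
  then have x0: "0 < x" using x2 by simp
  have "a * 1 < a * \<beta>" by (rule mult_strict_left_mono[OF b1 assms])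
  then have x1: "x < 1" using x2 by linarith
  have "4 * (1 - x)\<^sup>2 = (a * \<beta> - a)\<^sup>2"
  proof -
    have "2 * (1 - x) = a * \<beta> - a" using x2 by simp
    then have "(2 * (1 - x))\<^sup>2 = (a * \<beta> - a)\<^sup>2" by simp
    moreover have "(2 * (1 - x))\<^sup>2 = 2\<^sup>2 * (1 - x)\<^sup>2" by (rule power_mult_distrib)
    ultimately show ?thesis by simp
  qed
  also have "\<dots> = a * (a * \<beta>\<^sup>2) - 2 * a * a * \<beta> + a * a" by (simp add: power2_eq_square algebra_simps)
  also have "\<dots> = 2 * a * (2 + a - a * \<beta>)" unfolding b2 by (simp add: algebra_simps)
  also have "\<dots> = 4 * (a * x)" unfolding x2[symmetric] by simp
  finally have eq: "(1 - x)\<^sup>2 = a * x" by simp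
  have "a * \<beta> = 2 + a - 2 * x" using x2 by simp
  then have "a * \<beta> * x = (2 + a - 2 * x) * x" by simp
  also have "\<dots> = 1 - x\<^sup>2" using eq by (simp add: power2_eq_square algebra_simps)
  finally have bx: "a * \<beta> * x = 1 - x\<^sup>2" .
  have "(1 + (1 / a + (\<beta> - 1) / 2)) * (a * x) = a * x + x + (a * \<beta> * x - a * x) / 2"
    using assms by (simp add: field_simps)
  also have "\<dots> = 1" unfolding bx using eq by (simp add: power2_eq_square field_simps)
  finally have "1 + (1 / a + (\<beta> - 1) / 2) = 1 / (a * x)"
    using assms x0 by (simp add: eq_divide_eq)
  then show "1 < beta_coeff a" "0 < contraction a" "contraction a < 1" "(1 - contraction a)\<^sup>2 = a * contraction a"
    "a * beta_coeff a * contraction a = 1 - (contraction a)\<^sup>2"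
    "1 + (1 / a + (beta_coeff a - 1) / 2) = 1 / (a * contraction a)"
    using b1 x0 x1 eq bx by (simp_all add: \<beta>_def x_def)
qed

lemma b_coeff_eq: "b_coeff a = sqrt (contraction a)"
  by (simp add: b_coeff_def contraction_def)

lemma rho_eq:
  assumes "0 < a"
  shows "rho a k = (a * contraction a) powr a * (contraction a ^ k)\<^sup>2"
proof -
  have x: "0 < contraction a" using contraction_pos[OF assms] .
  have "b_coeff a powr (4 * real k + 2 * a) = contraction a powr (real (2 * k) + a)"
    unfolding b_coeff_eq using x by (simp add: powr_half_sqrt[symmetric] powr_powr algebra_simps)
  also have "\<dots> = contraction a ^ (2 * k) * contraction a powr a"
    using x unfolding powr_add by (subst powr_realpow) auto
  also have "contraction a ^ (2 * k) = (contraction a ^ k)\<^sup>2" by (rule power_even_eq)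
  finally show ?thesis using assms x by (simp add: rho_def powr_mult mult_ac)
qed

lemma rho_pos: "0 < a \<Longrightarrow> 0 < rho a k"
  using contraction_pos[of a] by (simp add: rho_eq)

lemma inj_rho:
  assumes "0 < a"
  shows "inj (rho a)"
proof -
  have "rho a m < rho a n" if "n < m" for n m
  proof -
    have "contraction a ^ m < contraction a ^ n"
      using contraction_pos[OF assms] contraction_less_1[OF assms] that by (intro power_strict_decreasing)
    then have "(contraction a ^ m)\<^sup>2 < (contraction a ^ n)\<^sup>2"
      using contraction_pos[OF assms] by (intro power_strict_mono) auto
    then show ?thesis using contraction_pos[OF assms] assms by (simp add: rho_eq)
  qed
  then show ?thesis by (intro injI) (metis linorder_neqE_nat order_less_irrefl)
qed

text \<open>The rate of the exponential factor \<open>exp ((1 - \<beta>) s / 2)\<close> of the Laguerre eigenfunctions.\<close>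

definition damping :: "real \<Rightarrow> real" where
  "damping a = (beta_coeff a - 1) / 2"

definition lag_scale :: "real \<Rightarrow> nat \<Rightarrow> real" where
  "lag_scale a k = beta_coeff a powr (a / 2) * sqrt (fact k / pochhammer a k)"

definition lag_coeff :: "real \<Rightarrow> nat \<Rightarrow> nat \<Rightarrow> real" where
  "lag_coeff a k n = (if n \<le> k then pochhammer (a + real n) (k - n) / fact (k - n) * ((- beta_coeff a) ^ n / fact n) else 0)"

lemma laguerre_eigenfun_eq:
  "laguerre_eigenfun a k s = lag_scale a k * (\<Sum>n\<le>k. lag_coeff a k n * (s ^ n * exp (- (damping a * s))))"
proof -
  have "laguerre (a - 1) k (beta_coeff a * s) = (\<Sum>n\<le>k. lag_coeff a k n * s ^ n)"
    unfolding laguerre_def atLeast0AtMost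
    by (intro sum.cong refl) (simp add: lag_coeff_def power_mult_distrib[symmetric])
  moreover have "exp ((1 - beta_coeff a) * s / 2) = exp (- (damping a * s))"
    by (simp add: damping_def field_simps)
  ultimately show ?thesis
    by (simp add: laguerre_eigenfun_def lag_scale_def sum_distrib_left sum_distrib_right mult_ac)
qed

lemma laguerre_eigenfun_poly:
  "laguerre_eigenfun a k s = lag_scale a k * exp (- (damping a * s)) * (\<Sum>n\<le>k. lag_coeff a k n * s ^ n)"
  by (simp add: laguerre_eigenfun_eq sum_distrib_left mult_ac)

lemma lag_scale_pos: "0 < a \<Longrightarrow> 0 < lag_scale a k"
  using beta_gt_1[of a] by (simp add: lag_scale_def pochhammer_pos)

lemma lag_coeff_diag: "lag_coeff a k k = (- beta_coeff a) ^ k / fact k"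
  by (simp add: lag_coeff_def)

text \<open>The polynomials have degree exactly \<open>k\<close>, so the determinant is the product of the leading coefficients and a
Vandermonde determinant. The leading coefficient has sign \<open>(-1)\<^bsup>k\<^esup>\<close>, and \<open>0 + \<dots> + (r - 1) = r (r - 1) / 2\<close>.\<close>

theorem laguerre_oscillation:
  assumes "0 < a"
  shows "oscillation_property (laguerre_eigenfun a)"
  unfolding oscillation_property_def ldet_eq_det
proof (intro allI impI, elim conjE)
  fix r and s :: "nat \<Rightarrow> real"
  assume s: "strict_mono_on {..<r} s" "\<forall>j<r. 0 \<le> s j"
  have "laguerre_eigenfun a k (s l) = lag_scale a k * exp (- (damping a * s l)) * (\<Sum>n<r. lag_coeff a k n * s l ^ n)"
    if "k < r" for k l
  proof -
    have "(\<Sum>n\<le>k. lag_coeff a k n * s l ^ n) = (\<Sum>n<r. lag_coeff a k n * s l ^ n)"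
      using that by (intro sum.mono_neutral_left) (auto simp: lag_coeff_def)
    then show ?thesis by (simp add: laguerre_eigenfun_poly)
  qed
  then have "ldet r (\<lambda>k l. laguerre_eigenfun a k (s l))
    = ldet r (\<lambda>k l. lag_scale a k * exp (- (damping a * s l)) * (\<Sum>n<r. lag_coeff a k n * s l ^ n))"
    by (intro ldet_cong)
  also have "\<dots> = (\<Prod>k<r. lag_scale a k) * (\<Prod>l<r. exp (- (damping a * s l))) * ((\<Prod>k<r. lag_coeff a k k) * ldet r (\<lambda>n l. s l ^ n))"
    unfolding ldet_scale ldet_mult by (subst ldet_lower_triangular) (auto simp: lag_coeff_def)
  finally have eq: "ldet r (\<lambda>k l. laguerre_eigenfun a k (s l))
     = (\<Prod>k<r. lag_scale a k) * (\<Prod>l<r. exp (- (damping a * s l))) * ((\<Prod>k<r. lag_coeff a k k) * ldet r (\<lambda>n l. s l ^ n))" .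
  have "(\<Prod>k<r. lag_coeff a k k) = (-1) ^ (\<Sum>k<r. k) * (\<Prod>k<r. beta_coeff a ^ k / fact k)"
  proof -
    have "lag_coeff a k k = (-1) ^ k * (beta_coeff a ^ k / fact k)" for k
      unfolding lag_coeff_diag by (subst power_minus) simp
    then show ?thesis by (simp only: prod.distrib power_sum)
  qed
  also have "(\<Sum>k<r. k) = r * (r - 1) div 2" using gauss_sum_nat[of "r - 1"]
    by (cases r) (auto simp: lessThan_Suc_atMost atLeast0AtMost mult.commute)
  finally have "(\<Prod>k<r. beta_coeff a ^ k / fact k) = (-1) ^ (r * (r - 1) div 2) * (\<Prod>k<r. lag_coeff a k k)"
    by (simp add: mult.assoc[symmetric] power_mult_distrib[symmetric])
  then have "(-1) ^ (r * (r - 1) div 2) * ldet r (\<lambda>k l. laguerre_eigenfun a k (s l))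
     = (\<Prod>k<r. lag_scale a k) * (\<Prod>l<r. exp (- (damping a * s l))) * ((\<Prod>k<r. beta_coeff a ^ k / fact k) * ldet r (\<lambda>n l. s l ^ n))"
    unfolding eq by (simp only: mult_ac)
  moreover have "0 \<le> ldet r (\<lambda>n l. s l ^ n)"
    using generalized_Vandermonde_nonneg[of r "\<lambda>n. n" s] s by (simp add: strict_mono_on_def)
  ultimately show "0 \<le> (-1) ^ (r * (r - 1) div 2) * ldet r (\<lambda>k l. laguerre_eigenfun a k (s l))"
    using lag_scale_pos[OF assms] beta_gt_1[OF assms]
    by (auto intro!: mult_nonneg_nonneg prod_nonneg less_imp_le[OF lag_scale_pos[OF assms]])
qed

lemma laguerre_eigenfun_not_null:
  assumes "0 < a"
  shows "\<not> (AE s in gamma_measure a. laguerre_eigenfun a k s = 0)"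
proof
  assume AE0: "AE s in gamma_measure a. laguerre_eigenfun a k s = 0"
  have "\<exists>s. real l < s \<and> s < real l + 1 \<and> laguerre_eigenfun a k s = 0" for l
  proof (rule ccontr)
    assume "\<nexists>s. real l < s \<and> s < real l + 1 \<and> laguerre_eigenfun a k s = 0"
    then have AEl: "AE s in gamma_measure a. s \<notin> {real l<..<real l + 1}"
      using AE0 by (auto elim!: eventually_mono)
    have "emeasure (gamma_measure a) {real l<..<real l + 1} = 0"
    proof -
      have "{x \<in> space (gamma_measure a). \<not> x \<notin> {real l<..<real l + 1}} = {real l<..<real l + 1}"
        by (auto simp: gamma_measure_def)
      then show ?thesis
        using AE_iff_measurable[of "{real l<..<real l + 1}" "gamma_measure a" "\<lambda>s. s \<notin> {real l<..<real l + 1}"] AEl by simp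
    qed
    then show False using gamma_charges_intervals[OF assms, of l] by simp
  qed
  then obtain s where s: "\<And>l. real l < s l" "\<And>l. s l < real l + 1" "\<And>l. laguerre_eigenfun a k (s l) = 0" by metis
  have spos: "0 < s l" for l using s(1)[of l] by (meson of_nat_0_le_iff order_le_less_trans)
  have mono: "strict_mono_on {..<Suc k} s"
  proof (intro strict_mono_onI)
    fix i j :: nat assume "i < j"
    then have "real i + 1 \<le> real j" by simp
    then show "s i < s j" using s(1)[of j] s(2)[of i] by simp
  qed
  have "(\<Sum>n<Suc k. lag_coeff a k n * s l ^ n) = 0" for l
    using s(3)[of l] lag_scale_pos[OF assms, of k] by (simp add: laguerre_eigenfun_poly lessThan_Suc_atMost)
  then have "lag_coeff a k k = 0"
    by (intro sparse_polynomial_few_roots[of "Suc k" "\<lambda>n. n" s "lag_coeff a k" k])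
       (use mono spos in \<open>auto simp: strict_mono_on_def\<close>)
  then show False using beta_gt_1[OF assms] by (simp add: lag_coeff_diag)
qed

definition damped_monomial :: "real \<Rightarrow> nat \<Rightarrow> real \<Rightarrow> real" where
  "damped_monomial a n s = s ^ n * exp (- (damping a * s))"

lemma damping_nonneg: "0 < a \<Longrightarrow> 0 \<le> damping a"
  using beta_gt_1[of a] by (simp add: damping_def)

lemma damped_monomial_L2:
  assumes "0 < a"
  shows "(\<lambda>t. complex_of_real (damped_monomial a n t)) \<in> L2 (gamma_measure a)"
proof (rule L2_of_real)
  show "damped_monomial a n \<in> borel_measurable (gamma_measure a)" unfolding damped_monomial_def by measurable
  have "(damped_monomial a n t)\<^sup>2 = t ^ (2 * n) * exp (- (2 * damping a * t))" for t
    unfolding damped_monomial_def power_mult_distrib power_even_eq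
    by (simp add: power2_eq_square exp_add[symmetric])
  then show "integrable (gamma_measure a) (\<lambda>t. (damped_monomial a n t)\<^sup>2)"
    using gamma_moment_integrable[OF assms, of "2 * damping a" "2 * n"] damping_nonneg[OF assms] by simp
qed

lemma laguerre_eigenfun_combination:
  "complex_of_real (laguerre_eigenfun a k s)
    = (\<Sum>n<Suc k. complex_of_real (lag_scale a k * lag_coeff a k n) * complex_of_real (damped_monomial a n s))"
  by (simp add: laguerre_eigenfun_eq damped_monomial_def lessThan_Suc_atMost sum_distrib_left mult.assoc
      flip: of_real_mult of_real_sum)

lemma laguerre_eigenfun_L2:
  assumes "0 < a"
  shows "(\<lambda>s. complex_of_real (laguerre_eigenfun a k s)) \<in> L2 (gamma_measure a)"
  unfolding laguerre_eigenfun_combination by (intro L2_sum damped_monomial_L2 assms)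

text \<open>The total exponential rate, including that of the density, is the reciprocal of \<open>a * contraction a\<close> by the choice of \<open>\<beta>\<close>.\<close>

lemma feature_integral:
  assumes a: "0 < a"
  shows "(\<integral>t. gamma_feature a i t * damped_monomial a n t \<partial>gamma_measure a)
    = feature_weight a i * pochhammer a (i + n) * ((a * contraction a) powr a * (a * contraction a) ^ (i + n))"
proof -
  define k where "k = a * contraction a"
  have k: "0 < k" using a contraction_pos[OF a] by (simp add: k_def)
  have l: "-1 < 1 / a + damping a" using damping_nonneg[OF a] a by (simp add: add_nonneg_nonneg less_le_trans[of _ 0])
  have "(\<integral>t. gamma_feature a i t * damped_monomial a n t \<partial>gamma_measure a)
    = (\<integral>t. feature_weight a i * (t ^ (i + n) * exp (- ((1 / a + damping a) * t))) \<partial>gamma_measure a)"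
  proof (intro Bochner_Integration.integral_cong refl)
    fix t
    have "exp (- ((1 / a + damping a) * t)) = exp (- (1 / a * t)) * exp (- (damping a * t))"
      by (simp add: exp_add[symmetric] algebra_simps)
    then show "gamma_feature a i t * damped_monomial a n t = feature_weight a i * (t ^ (i + n) * exp (- ((1 / a + damping a) * t)))"
      by (simp only: gamma_feature_eq_weight damped_monomial_def power_add mult_ac)
  qed
  also have "\<dots> = feature_weight a i * (pochhammer a (i + n) / (1 + (1 / a + damping a)) powr (a + real (i + n)))"
    by (simp only: integral_mult_right_zero gamma_moment_value[OF a l])
  also have "1 + (1 / a + damping a) = 1 / k"
    using contraction_rate[OF a] by (simp add: damping_def k_def)
  also have "(1 / k) powr (a + real (i + n)) = 1 / (k powr a * k ^ (i + n))"
    using k by (simp add: powr_divide powr_add powr_realpow[symmetric])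
  finally show ?thesis by (simp add: k_def)
qed

text \<open>The operator maps a damped monomial to a damped polynomial of the same degree in \<open>y = s * contraction a / a\<close>: the exponent
\<open>-s/a\<close> of the features and the factor \<open>exp y\<close> of Kummer's transformation combine to the same damping. With
\<open>z = - \<beta> a X\<close> and \<open>X = contraction a\<close> one has \<open>1 + z = X\<^sup>2\<close> and \<open>z y = - \<beta> X\<^sup>2 s\<close>, so the coefficient identity returns the
polynomial times \<open>X\<^bsup>2k\<^esup>\<close>.\<close>

theorem laguerre_eigen_equation:
  assumes a: "1/2 \<le> a" and s: "0 \<le> s"
  shows "S0_op a (\<lambda>t. complex_of_real (laguerre_eigenfun a k t)) s
    = complex_of_real (rho a k) * complex_of_real (laguerre_eigenfun a k s)"
proof -
  let ?M = "gamma_measure a"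
  have a0: "0 < a" using a by simp
  interpret totally_positive_kernel ?M "gamma_feature a" "K0_kernel a" "\<lambda>s. exp (s / 8)" "1 / (1 + a / 8)"
    using gamma_totally_positive_kernel[OF a, of 0 "K0_kernel a"] K0_sums[OF a] by simp
  define X where "X = contraction a"
  define A where "A = (a * X) powr a"
  define y where "y = s * X / a"
  have X: "0 < X" unfolding X_def by (rule contraction_pos[OF a0])
  have ey: "exp (- (s / a)) * exp y = exp (- (damping a * s))"
  proof -
    have "- (s / a) + y = - (damping a * s)"
      using a0 by (simp add: y_def X_def contraction_def damping_def field_simps)
    then show ?thesis by (simp add: exp_add[symmetric])
  qed
  have moment_mono: "moment (\<lambda>t. complex_of_real (damped_monomial a n t)) i
      = complex_of_real (feature_weight a i * pochhammer a (i + n) * (A * (a * X) ^ (i + n)))" for n i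
    unfolding moment_def A_def X_def feature_integral[OF a0, symmetric] of_real_mult[symmetric]
    by (rule integral_complex_of_real)
  have T_mono: "T (\<lambda>t. complex_of_real (damped_monomial a n t)) s
    = complex_of_real (A * (a * X) ^ n * exp (- (damping a * s))
        * (\<Sum>m\<le>n. real (n choose m) * pochhammer (a + real m) (n - m) * y ^ m))" for n
  proof -
    have terms: "feature_weight a i * pochhammer a (i + n) * (A * (a * X) ^ (i + n)) * gamma_feature a i s
      = A * (a * X) ^ n * exp (- (s / a)) * (y ^ i / fact i * pochhammer (a + real i) n)" for i
    proof -
      have p: "pochhammer a i > 0" by (rule pochhammer_pos[OF a0])
      have w: "feature_weight a i * feature_weight a i = 1 / (fact i * pochhammer a i) / (a ^ i * a ^ i)"
        using p by (simp add: feature_weight_def)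
      have "feature_weight a i * pochhammer a (i + n) * (A * (a * X) ^ (i + n)) * gamma_feature a i s
        = (feature_weight a i * feature_weight a i) * pochhammer a (i + n) * (A * (a * X) ^ n * (a ^ i * X ^ i)) * (s ^ i * exp (- (s / a)))"
        by (simp add: gamma_feature_eq_weight power_add power_mult_distrib mult_ac)
      also have "\<dots> = A * (a * X) ^ n * exp (- (s / a)) * (y ^ i / fact i * pochhammer (a + real i) n)"
        unfolding w pochhammer_product'[of a i n] y_def
        using p a0 by (simp add: power_mult_distrib power_divide field_simps)
      finally show ?thesis .
    qed
    have "(\<lambda>i. feature_weight a i * pochhammer a (i + n) * (A * (a * X) ^ (i + n)) * gamma_feature a i s) sums
      (A * (a * X) ^ n * exp (- (s / a)) * (exp y * (\<Sum>m\<le>n. real (n choose m) * pochhammer (a + real m) (n - m) * y ^ m)))"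
      unfolding terms by (intro sums_mult Kummer_transformation)
    also have "A * (a * X) ^ n * exp (- (s / a)) * (exp y * (\<Sum>m\<le>n. real (n choose m) * pochhammer (a + real m) (n - m) * y ^ m))
      = A * (a * X) ^ n * exp (- (damping a * s)) * (\<Sum>m\<le>n. real (n choose m) * pochhammer (a + real m) (n - m) * y ^ m)"
      unfolding ey[symmetric] by (simp add: mult_ac)
    finally have S: "(\<lambda>i. feature_weight a i * pochhammer a (i + n) * (A * (a * X) ^ (i + n)) * gamma_feature a i s) sums
      (A * (a * X) ^ n * exp (- (damping a * s)) * (\<Sum>m\<le>n. real (n choose m) * pochhammer (a + real m) (n - m) * y ^ m))" .
    show ?thesis
      unfolding T_eq_expansion[OF damped_monomial_L2[OF a0] s] expansion_def moment_mono of_real_mult[symmetric]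
      by (rule sums_unique[OF sums_of_real[OF S], symmetric])
  qed
  have z: "1 + (- beta_coeff a * (a * X)) = X\<^sup>2" "(- beta_coeff a * (a * X)) * y = X\<^sup>2 * (- beta_coeff a * s)"
    using contraction_beta[OF a0] a0 by (simp_all add: X_def[symmetric] y_def power2_eq_square field_simps)
  have "S0_op a (\<lambda>t. complex_of_real (laguerre_eigenfun a k t)) s
    = (\<Sum>n<Suc k. complex_of_real (lag_scale a k * lag_coeff a k n) * T (\<lambda>t. complex_of_real (damped_monomial a n t)) s)"
    unfolding S0_op_def laguerre_eigenfun_combination by (rule T_sum[OF damped_monomial_L2[OF a0] s])
  also have "\<dots> = complex_of_real (lag_scale a k * (A * exp (- (damping a * s))) *
      (\<Sum>n\<le>k. pochhammer (a + real n) (k - n) / fact (k - n) * ((- beta_coeff a * (a * X)) ^ n / fact n)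
            * (\<Sum>m\<le>n. real (n choose m) * pochhammer (a + real m) (n - m) * y ^ m)))"
    unfolding T_mono of_real_mult[symmetric] of_real_sum[symmetric] lessThan_Suc_atMost sum_distrib_left[of "lag_scale a k * (A * exp (- (damping a * s)))"]
  proof (intro arg_cong[where f = complex_of_real] sum.cong refl)
    fix n assume "n \<in> {..k}"
    then have c: "lag_coeff a k n = pochhammer (a + real n) (k - n) / fact (k - n) * ((- beta_coeff a) ^ n / fact n)"
      by (simp add: lag_coeff_def)
    have p: "(- beta_coeff a * (a * X)) ^ n = (- beta_coeff a) ^ n * (a * X) ^ n" by (rule power_mult_distrib)
    show "lag_scale a k * lag_coeff a k n * (A * (a * X) ^ n * exp (- (damping a * s)) *
          (\<Sum>m\<le>n. real (n choose m) * pochhammer (a + real m) (n - m) * y ^ m))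
      = lag_scale a k * (A * exp (- (damping a * s))) * (pochhammer (a + real n) (k - n) / fact (k - n) * ((- beta_coeff a * (a * X)) ^ n / fact n)
            * (\<Sum>m\<le>n. real (n choose m) * pochhammer (a + real m) (n - m) * y ^ m))"
      unfolding c p by (simp only: divide_inverse mult_ac)
  qed
  also have "(\<Sum>n\<le>k. pochhammer (a + real n) (k - n) / fact (k - n) * ((- beta_coeff a * (a * X)) ^ n / fact n)
            * (\<Sum>m\<le>n. real (n choose m) * pochhammer (a + real m) (n - m) * y ^ m))
      = (X ^ k)\<^sup>2 * (\<Sum>m\<le>k. lag_coeff a k m * s ^ m)"
    unfolding Laguerre_coefficient_identity z unfolding sum_distrib_left
  proof (intro sum.cong refl)
    fix m assume m: "m \<in> {..k}"
    have "(X\<^sup>2) ^ (k - m) * (X\<^sup>2) ^ m = (X\<^sup>2) ^ (k - m + m)" by (rule power_add[symmetric])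
    also have "\<dots> = (X ^ k)\<^sup>2" using m by (simp add: power_mult[symmetric] mult.commute)
    finally have X2: "(X\<^sup>2) ^ (k - m) * (X\<^sup>2) ^ m = (X ^ k)\<^sup>2" .
    have c: "lag_coeff a k m = pochhammer (a + real m) (k - m) / fact (k - m) * ((- beta_coeff a) ^ m / fact m)"
      using m by (simp add: lag_coeff_def)
    show "pochhammer (a + real m) (k - m) / fact (k - m) * (X\<^sup>2) ^ (k - m) * ((X\<^sup>2 * (- beta_coeff a * s)) ^ m / fact m)
      = (X ^ k)\<^sup>2 * (lag_coeff a k m * s ^ m)"
      unfolding X2[symmetric] c power_mult_distrib[of "X\<^sup>2"] power_mult_distrib[of "- beta_coeff a"]
      by (simp only: divide_inverse mult_ac)
  qed
  also have "lag_scale a k * (A * exp (- (damping a * s))) * ((X ^ k)\<^sup>2 * (\<Sum>m\<le>k. lag_coeff a k m * s ^ m))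
      = rho a k * laguerre_eigenfun a k s"
    unfolding laguerre_eigenfun_poly rho_eq[OF a0] X_def[symmetric] A_def by (simp only: mult_ac)
  finally show ?thesis by (simp only: of_real_mult)
qed

text \<open>By induction on the degree, orthogonality to the Laguerre functions is orthogonality to all damped
monomials.\<close>

lemma laguerre_total:
  assumes a: "0 < a" and f: "f \<in> L2 (gamma_measure a)"
    and zero: "\<And>k. (LINT s|gamma_measure a. f s * complex_of_real (laguerre_eigenfun a k s)) = 0"
  shows "AE s in gamma_measure a. f s = 0"
proof (rule gamma_exponential_monomials_complete[OF a damping_nonneg[OF a] f, where p = 0])
  let ?I = "\<lambda>n. LINT s|gamma_measure a. complex_of_real (damped_monomial a n s) * f s"
  have int: "integrable (gamma_measure a) (\<lambda>s. complex_of_real (damped_monomial a n s) * f s)" for n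
    by (rule L2_mult_integrable[OF damped_monomial_L2[OF a] f])
  have comb: "(\<Sum>n<Suc k. complex_of_real (lag_scale a k * lag_coeff a k n) * ?I n) = 0" for k
  proof -
    have "(\<Sum>n<Suc k. complex_of_real (lag_scale a k * lag_coeff a k n) * ?I n)
      = (LINT s|gamma_measure a. (\<Sum>n<Suc k. complex_of_real (lag_scale a k * lag_coeff a k n) * (complex_of_real (damped_monomial a n s) * f s)))"
      using int by (subst Bochner_Integration.integral_sum) (auto intro: integrable_mult_right)
    also have "\<dots> = (LINT s|gamma_measure a. f s * complex_of_real (laguerre_eigenfun a k s))"
      unfolding laguerre_eigenfun_combination sum_distrib_left
      by (intro Bochner_Integration.integral_cong sum.cong refl) (simp add: mult_ac)
    finally show ?thesis by (simp add: zero)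
  qed
  have "?I n = 0" for n
  proof (induction n rule: less_induct)
    case (less n)
    have "complex_of_real (lag_scale a n * lag_coeff a n n) * ?I n = 0"
      using comb[of n] less by simp
    then show ?case using lag_scale_pos[OF a, of n] beta_gt_1[OF a] by (simp add: lag_coeff_diag)
  qed
  then show "(LINT t|gamma_measure a. complex_of_real (t ^ n * exp (- (damping a * t))) * f t) = 0" for n
    by (simp add: damped_monomial_def)
qed

section \<open>The spectra of the two operators\<close>

theorem S0_spectrum:
  assumes a: "1/2 \<le> a"
  shows "bij_betw (\<lambda>k. complex_of_real (rho a k)) UNIV {z. is_eigenvalue (gamma_measure a) (S0_op a) z}"
    and "is_simple_eigenvalue (gamma_measure a) (S0_op a) (complex_of_real (rho a k))"
    and "is_eigenfunction (gamma_measure a) (S0_op a) (complex_of_real (rho a k))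
                (\<lambda>s. complex_of_real (laguerre_eigenfun a k s))"
    and "injective_on_L2 (gamma_measure a) (S0_op a)"
proof -
  let ?M = "gamma_measure a"
  have a0: "0 < a" using a by simp
  interpret totally_positive_kernel ?M "gamma_feature a" "K0_kernel a" "\<lambda>s. exp (s / 8)" "1 / (1 + a / 8)"
    using gamma_totally_positive_kernel[OF a, of 0 "K0_kernel a"] K0_sums[OF a] by simp
  have eig: "is_eigenfunction ?M (S0_op a) (complex_of_real (rho a k)) (\<lambda>s. complex_of_real (laguerre_eigenfun a k s))" for k
    unfolding is_eigenfunction_def
  proof (intro conjI laguerre_eigenfun_L2 a0)
    show "\<not> (AE s in ?M. complex_of_real (laguerre_eigenfun a k s) = 0)"
      using laguerre_eigenfun_not_null[OF a0] by simp
    show "AE s in ?M. S0_op a (\<lambda>s. complex_of_real (laguerre_eigenfun a k s)) s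
        = complex_of_real (rho a k) * complex_of_real (laguerre_eigenfun a k s)"
      using M_nonneg by eventually_elim (rule laguerre_eigen_equation[OF a])
  qed
  have norm: "(LINT s|?M. complex_of_real (laguerre_eigenfun a k s) * complex_of_real (laguerre_eigenfun a k s)) \<noteq> 0" for k
  proof
    assume "(LINT s|?M. complex_of_real (laguerre_eigenfun a k s) * complex_of_real (laguerre_eigenfun a k s)) = 0"
    then have "complex_of_real (LINT s|?M. (cmod (complex_of_real (laguerre_eigenfun a k s)))\<^sup>2) = 0"
      unfolding integral_mult_cnj[symmetric] by simp
    then have "AE s in ?M. complex_of_real (laguerre_eigenfun a k s) = 0"
      by (intro integral_cmod_square_eq_0[OF laguerre_eigenfun_L2[OF a0]]) (simp only: of_real_eq_0_iff)
    then show False using laguerre_eigenfun_not_null[OF a0] by simp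
  qed
  note classified = eigen_classification[of "rho a" "\<lambda>k s. complex_of_real (laguerre_eigenfun a k s)",
      folded S0_op_def, OF eig norm inj_rho[OF a0] laguerre_total[OF a0]]
  show "bij_betw (\<lambda>k. complex_of_real (rho a k)) UNIV {z. is_eigenvalue ?M (S0_op a) z}"
    "is_simple_eigenvalue ?M (S0_op a) (complex_of_real (rho a k))"
    by (rule classified; assumption)+
  show "is_eigenfunction ?M (S0_op a) (complex_of_real (rho a k)) (\<lambda>s. complex_of_real (laguerre_eigenfun a k s))"
    by (rule eig)
  show "injective_on_L2 ?M (S0_op a)" unfolding S0_op_def by (rule T_injective)
qed

theorem S_spectrum:
  assumes a: "1/2 \<le> a"
  obtains \<delta> :: "nat \<Rightarrow> real" and \<phi> :: "nat \<Rightarrow> real \<Rightarrow> real" where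
    "\<And>n. 0 < \<delta> n" "\<And>n. \<delta> (Suc n) < \<delta> n"
    "bij_betw (\<lambda>n. complex_of_real (\<delta> n)) UNIV {z. is_eigenvalue (gamma_measure a) (S_op a) z}"
    "\<And>n. is_simple_eigenvalue (gamma_measure a) (S_op a) (complex_of_real (\<delta> n))"
    "\<And>n. is_eigenfunction (gamma_measure a) (S_op a) (complex_of_real (\<delta> n)) (\<lambda>s. complex_of_real (\<phi> n s))"
    "\<And>n. continuous_on {0..} (\<phi> n)"
    "oscillation_property \<phi>"
    "injective_on_L2 (gamma_measure a) (S_op a)"
proof -
  interpret totally_positive_kernel "gamma_measure a" "\<lambda>i. gamma_feature a (i + 2)" "K_kernel a" "\<lambda>s. exp (s / 8)" "1 / (1 + a / 8)"
    by (rule gamma_totally_positive_kernel[OF a K_sums[OF a] K_measurable])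
  show ?thesis
    using oscillating_eigenfunctions[folded S_op_def] T_injective[folded S_op_def] that by metis
qed

theorem proposition3p13:
  fixes \<alpha> :: real
  assumes "\<alpha> \<ge> 1 / 2"
  shows
    "(bij_betw (\<lambda>k. complex_of_real (rho \<alpha> k)) UNIV
        {z. is_eigenvalue (gamma_measure \<alpha>) (S0_op \<alpha>) z}
      \<and> (\<forall>k. 0 < rho \<alpha> k
           \<and> is_simple_eigenvalue (gamma_measure \<alpha>) (S0_op \<alpha>) (complex_of_real (rho \<alpha> k))
           \<and> is_eigenfunction (gamma_measure \<alpha>) (S0_op \<alpha>) (complex_of_real (rho \<alpha> k))
                (\<lambda>s. complex_of_real (laguerre_eigenfun \<alpha> k s)))
      \<and> oscillation_property (laguerre_eigenfun \<alpha>))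
     \<and> (\<exists>(\<delta> :: nat \<Rightarrow> real) (\<phi> :: nat \<Rightarrow> real \<Rightarrow> real).
          bij_betw (\<lambda>k. complex_of_real (\<delta> k)) {1..}
            {z. is_eigenvalue (gamma_measure \<alpha>) (S_op \<alpha>) z}
        \<and> antimono_on {1..} \<delta>
        \<and> (\<forall>k\<ge>1. 0 < \<delta> k
             \<and> is_simple_eigenvalue (gamma_measure \<alpha>) (S_op \<alpha>) (complex_of_real (\<delta> k))
             \<and> is_eigenfunction (gamma_measure \<alpha>) (S_op \<alpha>) (complex_of_real (\<delta> k))
                  (\<lambda>s. complex_of_real (\<phi> k s))
             \<and> continuous_on {0..} (\<phi> k))
        \<and> oscillation_property (\<lambda>i. \<phi> (i + 1)))
     \<and> injective_on_L2 (gamma_measure \<alpha>) (S0_op \<alpha>)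
     \<and> injective_on_L2 (gamma_measure \<alpha>) (S_op \<alpha>)"
proof -
  have a0: "0 < \<alpha>" using assms by simp
  obtain \<delta> \<phi> where pos: "\<And>n. 0 < \<delta> n" and dec: "\<And>n. \<delta> (Suc n) < \<delta> n"
    and bij: "bij_betw (\<lambda>n. complex_of_real (\<delta> n)) UNIV {z. is_eigenvalue (gamma_measure \<alpha>) (S_op \<alpha>) z}"
    and simple: "\<And>n. is_simple_eigenvalue (gamma_measure \<alpha>) (S_op \<alpha>) (complex_of_real (\<delta> n))"
    and eig: "\<And>n. is_eigenfunction (gamma_measure \<alpha>) (S_op \<alpha>) (complex_of_real (\<delta> n)) (\<lambda>s. complex_of_real (\<phi> n s))"
    and cont: "\<And>n. continuous_on {0..} (\<phi> n)" and osc: "oscillation_property \<phi>"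
    and inj: "injective_on_L2 (gamma_measure \<alpha>) (S_op \<alpha>)"
    using S_spectrum[OF assms] by metis
  have shift: "bij_betw (\<lambda>k::nat. k - 1) {1..} UNIV"
    by (rule bij_betw_byWitness[where f' = Suc]) auto
  have "bij_betw ((\<lambda>n. complex_of_real (\<delta> n)) \<circ> (\<lambda>k. k - 1)) {1..}
      {z. is_eigenvalue (gamma_measure \<alpha>) (S_op \<alpha>) z}"
    by (rule bij_betw_trans[OF shift bij])
  then have bij': "bij_betw (\<lambda>k. complex_of_real (\<delta> (k - 1))) {1..}
      {z. is_eigenvalue (gamma_measure \<alpha>) (S_op \<alpha>) z}" by (simp add: o_def)
  have "decseq \<delta>" using dec by (intro decseq_SucI less_imp_le)
  then have anti: "antimono_on {1..} (\<lambda>k. \<delta> (k - 1))"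
    unfolding monotone_on_def by (auto intro: decseqD diff_le_mono)
  have osc': "oscillation_property (\<lambda>i. \<phi> (i + 1 - 1))" using osc by simp
  show ?thesis
  proof (intro conjI allI impI exI[of _ "\<lambda>k. \<delta> (k - 1)"] exI[of _ "\<lambda>k. \<phi> (k - 1)"])
    show "0 < rho \<alpha> k" for k by (rule rho_pos[OF a0])
    show "0 < \<delta> (k - 1)" for k by (rule pos)
  qed (rule S0_spectrum[OF assms] laguerre_oscillation[OF a0] bij' anti simple eig cont osc' inj)+
qed

end
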